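(* Let $P$ be a locally compact Hausdorff space which is not $\sigma$-compact and such that $C_0(P)$ has a normalized frame $\{u_\beta\}_{\beta\in B}$. Let $\alpha P=P\cup\{p_\infty\}$ be the one-point compactification of $P$, let $[0,\omega_0]$ be the space of all ordinals $\le\omega_0$ (the first infinite ordinal) with the order topology, and let $$K=\alpha P\times[0,\omega_0]\setminus\{(p_\infty,\omega_0)\}.$$ For $\beta\in B$ define $y_\beta\in C_0(K)$ by $y_\beta(p,n)=u_\beta(p)$ (where $u_\beta(p_\infty)=0$), and for $n\in[0,\omega_0)$ let $w_n\in C_0(K)$ be equal to $1$ on $\alpha P\times\{n\}$ and to $0$ outside $\alpha P\times\{n\}$. Then the system $\{x_j\}_{j\in J}=\{y_\beta\}_{\beta\in B}\cup\{w_n\}_{n\in[0,\omega_0)}$ is a frame in $C_0(K)$ in the non-standard sense (that is, with ultraweak convergence of the corresponding series).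
   Context: A space is $\sigma$-compact if it is a countable union of compact subsets. $C_0(K)$ is the $C^*$-algebra of complex continuous functions on $K$ vanishing at infinity; it is a Hilbert module over itself, and over its unitalization, with inner product $\langle x,y\rangle=\overline{x}\,y$. $\dot{\mathcal A}$ denotes the unitalization of a $C^*$-algebra $\mathcal A$ (equal to $\mathcal A$ if $\mathcal A$ is unital). The system $\{x_j\}_{j\in J}$ is indexed by the disjoint union $J=B\sqcup[0,\omega_0)$. Frames: let $\mathcal N$ be a Hilbert $C^*$-module over a unital $C^*$-algebra $\mathcal A$. A family $\{x_j\}_{j\in J}$ (any index set) in $\mathcal N$ is a standard frame if there are constants $c_1,c_2>0$ such that for every $x\in\mathcal N$ the series $\sum_j\langle x,x_j\rangle\langle x_j,x\rangle$ converges in norm in $\mathcal A$ and $c_1\langle x,x\rangle\le\sum_j\langle x,x_j\rangle\langle x_j,x\rangle\le c_2\langle x,x\rangle$. It is a non-standard frame if the same holds with norm convergence replaced by convergence, in the ultraweak ($\sigma$-weak) topology, of the net of all finite partial sums to an element of the universal enveloping von Neumann algebra $\mathcal A''$ (the inequalities being understood in $\mathcal A''$). "Frame" means at least non-standard, i.e. the series converges at least ultraweakly. A frame is normalized if one can take $c_1=c_2=1$. For a Hilbert module over a non-unital $\mathcal A$, frames are understood by viewing it as a module over $\dot{\mathcal A}$. *)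

theory Defs
  imports "HOL-Analysis.Analysis" "HOL-Algebra.Ring"
begin

section \<open>Operators on complex Hilbert spaces\<close>

text \<open>A complex Hilbert space is given by a set \<open>H\<close> of complex-valued functions with the pointwise
  linear structure, and an inner product \<open>ip\<close> that is conjugate-linear in the first variable.
  Operators are functions on \<open>H\<close>, extended by \<open>undefined\<close> outside \<open>H\<close>.\<close>

definition bounded_operators ::
    "('i \<Rightarrow> complex) set \<Rightarrow> (('i \<Rightarrow> complex) \<Rightarrow> ('i \<Rightarrow> complex) \<Rightarrow> complex)
      \<Rightarrow> (('i \<Rightarrow> complex) \<Rightarrow> ('i \<Rightarrow> complex)) set" where
  "bounded_operators H ip =
    {T \<in> H \<rightarrow>\<^sub>E H.
       (\<forall>h\<in>H. \<forall>k\<in>H. T (\<lambda>i. h i + k i) = (\<lambda>i. T h i + T k i)) \<and>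
       (\<forall>c. \<forall>h\<in>H. T (\<lambda>i. c * h i) = (\<lambda>i. c * T h i)) \<and>
       (\<exists>C. \<forall>h\<in>H. Re (ip (T h) (T h)) \<le> C * Re (ip h h))}"

definition commutant ::
    "('i \<Rightarrow> complex) set \<Rightarrow> (('i \<Rightarrow> complex) \<Rightarrow> ('i \<Rightarrow> complex) \<Rightarrow> complex)
      \<Rightarrow> (('i \<Rightarrow> complex) \<Rightarrow> ('i \<Rightarrow> complex)) set
      \<Rightarrow> (('i \<Rightarrow> complex) \<Rightarrow> ('i \<Rightarrow> complex)) set" where
  "commutant H ip M =
    {T \<in> bounded_operators H ip. \<forall>S\<in>M. \<forall>h\<in>H. T (S h) = S (T h)}"

definition operator_le ::
    "('i \<Rightarrow> complex) set \<Rightarrow> (('i \<Rightarrow> complex) \<Rightarrow> ('i \<Rightarrow> complex) \<Rightarrow> complex)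
      \<Rightarrow> (('i \<Rightarrow> complex) \<Rightarrow> ('i \<Rightarrow> complex)) \<Rightarrow> (('i \<Rightarrow> complex) \<Rightarrow> ('i \<Rightarrow> complex)) \<Rightarrow> bool" where
  "operator_le H ip S T \<longleftrightarrow> (\<forall>\<xi>\<in>H. ip \<xi> (T \<xi>) - ip \<xi> (S \<xi>) \<in> \<real>\<^sub>\<ge>\<^sub>0)"

text \<open>The ultraweak topology is induced by the functionals \<open>T \<mapsto> \<Sum>n. \<langle>\<xi> n, T (\<eta> n)\<rangle>\<close> with
  square-summable sequences \<open>\<xi>\<close> and \<open>\<eta>\<close>.\<close>

definition square_summable ::
    "('i \<Rightarrow> complex) set \<Rightarrow> (('i \<Rightarrow> complex) \<Rightarrow> ('i \<Rightarrow> complex) \<Rightarrow> complex)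
      \<Rightarrow> (nat \<Rightarrow> 'i \<Rightarrow> complex) \<Rightarrow> bool" where
  "square_summable H ip \<xi> \<longleftrightarrow> (\<forall>n. \<xi> n \<in> H) \<and> summable (\<lambda>n. Re (ip (\<xi> n) (\<xi> n)))"

definition ultraweak_limit ::
    "('i \<Rightarrow> complex) set \<Rightarrow> (('i \<Rightarrow> complex) \<Rightarrow> ('i \<Rightarrow> complex) \<Rightarrow> complex)
      \<Rightarrow> ('t \<Rightarrow> ('i \<Rightarrow> complex) \<Rightarrow> ('i \<Rightarrow> complex)) \<Rightarrow> (('i \<Rightarrow> complex) \<Rightarrow> ('i \<Rightarrow> complex))
      \<Rightarrow> 't filter \<Rightarrow> bool" where
  "ultraweak_limit H ip T S F \<longleftrightarrow>
    (\<forall>\<xi> \<eta>. square_summable H ip \<xi> \<and> square_summable H ip \<eta> \<longrightarrow>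
       ((\<lambda>t. \<Sum>n. ip (\<xi> n) (T t (\<eta> n))) \<longlongrightarrow> (\<Sum>n. ip (\<xi> n) (S (\<eta> n)))) F)"


section \<open>The universal enveloping von Neumann algebra of a unital \<open>C\<^sup>*\<close>-algebra\<close>

record 'a star_algebra = "'a ring" +
  cscale :: "complex \<Rightarrow> 'a \<Rightarrow> 'a"
  star :: "'a \<Rightarrow> 'a"

definition states :: "'a star_algebra \<Rightarrow> ('a \<Rightarrow> complex) set" where
  "states A =
    {\<phi> \<in> extensional (carrier A).
       (\<forall>a\<in>carrier A. \<forall>b\<in>carrier A. \<phi> (a \<oplus>\<^bsub>A\<^esub> b) = \<phi> a + \<phi> b) \<and>
       (\<forall>c. \<forall>a\<in>carrier A. \<phi> (cscale A c a) = c * \<phi> a) \<and>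
       (\<forall>a\<in>carrier A. \<phi> (star A a \<otimes>\<^bsub>A\<^esub> a) \<in> \<real>\<^sub>\<ge>\<^sub>0) \<and>
       \<phi> \<one>\<^bsub>A\<^esub> = 1}"

text \<open>The GNS space of a state \<open>\<phi>\<close> is the completion of \<open>A\<close> for the semi-inner product
  \<open>\<langle>a, b\<rangle> = \<phi> (a\<^sup>* b)\<close>. The class of a Cauchy sequence \<open>a\<close> is represented by the function
  \<open>b \<mapsto> lim \<phi> (b\<^sup>* (a n)) = \<langle>b, [a]\<rangle>\<close>, which determines it since \<open>A\<close> is dense.\<close>

definition gns_Cauchy :: "'a star_algebra \<Rightarrow> ('a \<Rightarrow> complex) \<Rightarrow> (nat \<Rightarrow> 'a) \<Rightarrow> bool" where
  "gns_Cauchy A \<phi> a \<longleftrightarrow>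
    (\<forall>n. a n \<in> carrier A) \<and>
    (\<forall>e>0. \<exists>M. \<forall>m\<ge>M. \<forall>n\<ge>M.
       cmod (\<phi> (star A (a m \<ominus>\<^bsub>A\<^esub> a n) \<otimes>\<^bsub>A\<^esub> (a m \<ominus>\<^bsub>A\<^esub> a n))) < e)"

definition gns_vector :: "'a star_algebra \<Rightarrow> ('a \<Rightarrow> complex) \<Rightarrow> (nat \<Rightarrow> 'a) \<Rightarrow> 'a \<Rightarrow> complex" where
  "gns_vector A \<phi> a =
    (\<lambda>b. if b \<in> carrier A then lim (\<lambda>n. \<phi> (star A b \<otimes>\<^bsub>A\<^esub> a n)) else 0)"

definition gns_space :: "'a star_algebra \<Rightarrow> ('a \<Rightarrow> complex) \<Rightarrow> ('a \<Rightarrow> complex) set" where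
  "gns_space A \<phi> = gns_vector A \<phi> ` {a. gns_Cauchy A \<phi> a}"

definition gns_inner ::
    "'a star_algebra \<Rightarrow> ('a \<Rightarrow> complex) \<Rightarrow> ('a \<Rightarrow> complex) \<Rightarrow> ('a \<Rightarrow> complex) \<Rightarrow> complex" where
  "gns_inner A \<phi> h k =
    (THE z. \<exists>a b. gns_Cauchy A \<phi> a \<and> gns_Cauchy A \<phi> b \<and>
       h = gns_vector A \<phi> a \<and> k = gns_vector A \<phi> b \<and>
       (\<lambda>n. \<phi> (star A (a n) \<otimes>\<^bsub>A\<^esub> b n)) \<longlonglongrightarrow> z)"

text \<open>The universal Hilbert space is the Hilbert sum of the GNS spaces of all states;
  \<open>\<lambda>b. h (\<phi>, b)\<close> is the component of \<open>h\<close> at \<open>\<phi>\<close>.\<close>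

definition universal_space :: "'a star_algebra \<Rightarrow> (('a \<Rightarrow> complex) \<times> 'a \<Rightarrow> complex) set" where
  "universal_space A =
    {h. (\<forall>\<phi>\<in>states A. (\<lambda>b. h (\<phi>, b)) \<in> gns_space A \<phi>) \<and>
        (\<forall>\<phi> b. \<phi> \<notin> states A \<longrightarrow> h (\<phi>, b) = 0) \<and>
        (\<lambda>\<phi>. Re (gns_inner A \<phi> (\<lambda>b. h (\<phi>, b)) (\<lambda>b. h (\<phi>, b)))) summable_on states A}"

definition universal_inner ::
    "'a star_algebra \<Rightarrow> (('a \<Rightarrow> complex) \<times> 'a \<Rightarrow> complex)
      \<Rightarrow> (('a \<Rightarrow> complex) \<times> 'a \<Rightarrow> complex) \<Rightarrow> complex" where
  "universal_inner A h k =
    (\<Sum>\<^sub>\<infinity>\<phi>\<in>states A. gns_inner A \<phi> (\<lambda>b. h (\<phi>, b)) (\<lambda>b. k (\<phi>, b)))"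

text \<open>The representation extends left multiplication on \<open>A\<close>; in terms of the representing functions
  this reads \<open>\<langle>b, \<pi>(a) h\<rangle> = \<langle>a\<^sup>* b, h\<rangle>\<close>.\<close>

definition universal_rep ::
    "'a star_algebra \<Rightarrow> 'a
      \<Rightarrow> (('a \<Rightarrow> complex) \<times> 'a \<Rightarrow> complex) \<Rightarrow> (('a \<Rightarrow> complex) \<times> 'a \<Rightarrow> complex)" where
  "universal_rep A a =
    (\<lambda>h\<in>universal_space A. \<lambda>(\<phi>, b). if b \<in> carrier A then h (\<phi>, star A a \<otimes>\<^bsub>A\<^esub> b) else 0)"

definition enveloping_vN ::
    "'a star_algebra
      \<Rightarrow> ((('a \<Rightarrow> complex) \<times> 'a \<Rightarrow> complex) \<Rightarrow> (('a \<Rightarrow> complex) \<times> 'a \<Rightarrow> complex)) set" where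
  "enveloping_vN A =
    commutant (universal_space A) (universal_inner A)
      (commutant (universal_space A) (universal_inner A) (universal_rep A ` carrier A))"


section \<open>Non-standard frames\<close>

text \<open>\<open>N\<close> is the underlying set of the Hilbert \<open>A\<close>-module and \<open>ip\<close> its \<open>A\<close>-valued inner product.\<close>

definition nonstandard_frame_bounds ::
    "'a star_algebra \<Rightarrow> 'n set \<Rightarrow> ('n \<Rightarrow> 'n \<Rightarrow> 'a) \<Rightarrow> 'j set \<Rightarrow> ('j \<Rightarrow> 'n) \<Rightarrow> real \<Rightarrow> real \<Rightarrow> bool" where
  "nonstandard_frame_bounds A N ip J x c\<^sub>1 c\<^sub>2 \<longleftrightarrow>
    (\<forall>j\<in>J. x j \<in> N) \<and>
    (\<forall>y\<in>N. \<exists>S\<in>enveloping_vN A.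
       ultraweak_limit (universal_space A) (universal_inner A)
         (\<lambda>F. universal_rep A (finsum A (\<lambda>j. ip y (x j) \<otimes>\<^bsub>A\<^esub> ip (x j) y) F)) S
         (finite_subsets_at_top J) \<and>
       operator_le (universal_space A) (universal_inner A)
         (universal_rep A (cscale A (complex_of_real c\<^sub>1) (ip y y))) S \<and>
       operator_le (universal_space A) (universal_inner A)
         S (universal_rep A (cscale A (complex_of_real c\<^sub>2) (ip y y))))"

definition nonstandard_frame ::
    "'a star_algebra \<Rightarrow> 'n set \<Rightarrow> ('n \<Rightarrow> 'n \<Rightarrow> 'a) \<Rightarrow> 'j set \<Rightarrow> ('j \<Rightarrow> 'n) \<Rightarrow> bool" where
  "nonstandard_frame A N ip J x \<longleftrightarrow>
    (\<exists>c\<^sub>1>0. \<exists>c\<^sub>2>0. nonstandard_frame_bounds A N ip J x c\<^sub>1 c\<^sub>2)"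

definition normalized_frame ::
    "'a star_algebra \<Rightarrow> 'n set \<Rightarrow> ('n \<Rightarrow> 'n \<Rightarrow> 'a) \<Rightarrow> 'j set \<Rightarrow> ('j \<Rightarrow> 'n) \<Rightarrow> bool" where
  "normalized_frame A N ip J x \<longleftrightarrow> nonstandard_frame_bounds A N ip J x 1 1"


section \<open>The modules \<open>C\<^sub>0(X)\<close>\<close>

definition sigma_compact_space :: "'x topology \<Rightarrow> bool" where
  "sigma_compact_space X \<longleftrightarrow>
    (\<exists>C :: nat \<Rightarrow> 'x set. (\<forall>n. compactin X (C n)) \<and> (\<Union>n. C n) = topspace X)"

text \<open>Functions on \<open>X\<close> are extended by \<open>0\<close> outside the underlying set.\<close>

definition C0 :: "'x topology \<Rightarrow> ('x \<Rightarrow> complex) set" where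
  "C0 X =
    {f. continuous_map X euclidean f \<and>
        (\<forall>e>0. \<exists>C. compactin X C \<and> (\<forall>x\<in>topspace X - C. cmod (f x) < e)) \<and>
        (\<forall>x. x \<notin> topspace X \<longrightarrow> f x = 0)}"

definition C0_inner :: "('x \<Rightarrow> complex) \<Rightarrow> ('x \<Rightarrow> complex) \<Rightarrow> 'x \<Rightarrow> complex" where
  "C0_inner f g = (\<lambda>x. cnj (f x) * g x)"

text \<open>The unitalization is realized as \<open>C\<^sub>0(X) + \<complex>1\<close>; for compact \<open>X\<close> this is \<open>C\<^sub>0(X)\<close> itself.\<close>

definition C0_unitalization :: "'x topology \<Rightarrow> ('x \<Rightarrow> complex) star_algebra" where
  "C0_unitalization X =
    \<lparr>carrier = {f. \<exists>g\<in>C0 X. \<exists>c. f = (\<lambda>x. g x + c * indicator (topspace X) x)},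
     mult = (\<lambda>f g x. f x * g x),
     one = indicator (topspace X),
     zero = (\<lambda>x. 0),
     add = (\<lambda>f g x. f x + g x),
     cscale = (\<lambda>c f x. c * f x),
     star = (\<lambda>f x. cnj (f x))\<rparr>"


section \<open>The space \<open>K\<close> and the system in \<open>C\<^sub>0(K)\<close>\<close>

text \<open>The type \<^typ>\<open>enat\<close> with its order topology is the ordinal interval \<open>[0, \<omega>\<^sub>0]\<close>, and \<^term>\<open>None\<close> is
  the point at infinity of the one-point compactification.\<close>

definition K_space :: "'p topology \<Rightarrow> ('p option \<times> enat) topology" where
  "K_space P =
    (let Q = prod_topology (Alexandroff_compactification P) (euclidean :: enat topology)
     in subtopology Q (topspace Q - {(None, \<infinity>)}))"

definition y_fun :: "('p \<Rightarrow> complex) \<Rightarrow> 'p option \<times> enat \<Rightarrow> complex" where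
  "y_fun u = (\<lambda>(q, n). case q of None \<Rightarrow> 0 | Some p \<Rightarrow> u p)"

definition w_fun :: "'p topology \<Rightarrow> nat \<Rightarrow> 'p option \<times> enat \<Rightarrow> complex" where
  "w_fun P n = indicator (topspace (Alexandroff_compactification P) \<times> {enat n})"

end

theory Submission
  imports Defs
begin

text \<open>
  Testing the hypothesis against the vector states of \<open>C\<^sub>0(P) + \<complex>1\<close> given by point evaluations yields
  \<open>\<Sum>\<beta>. |u\<^sub>\<beta>(p)|\<^sup>2 = 1\<close> for every \<open>p\<close>. Hence on \<open>K\<close> the partial sums of \<open>\<Sum>j. |x\<^sub>j|\<^sup>2\<close> are bounded by \<open>2\<close>
  and their pointwise supremum is at least \<open>1\<close>. For \<open>f \<in> C\<^sub>0(K)\<close> the partial sums of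
  \<open>\<Sum>j. |f|\<^sup>2 |x\<^sub>j|\<^sup>2\<close> form a bounded increasing net \<open>a\<^sub>F\<close> of commuting positive operators, which converges
  strongly because \<open>\<parallel>(a\<^sub>G - a\<^sub>F) h\<parallel>\<^sup>2 \<le> C \<langle>h, (a\<^sub>G - a\<^sub>F) h\<rangle>\<close> for \<open>F \<subseteq> G\<close>; a bounded strong limit is an
  ultraweak limit and stays in the bicommutant. The upper frame bound \<open>2\<close> passes to the limit. For
  the lower bound \<open>1\<close>, Dini's argument on the compact sets where \<open>|f|\<close> is not small gives, for each
  \<open>\<epsilon> > 0\<close>, a finite \<open>F\<close> with \<open>a\<^sub>F \<ge> |f|\<^sup>2 - \<epsilon>\<close>, although \<open>a\<^sub>F\<close> itself need not converge in norm.
\<close>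

section \<open>Strong and ultraweak limits of operators\<close>

text \<open>The limit operator does not come from a function in the algebra: the pointwise sum of
  all squares \<bar>x j\<bar>^2 equals 2 at (p, n) with p in P and n finite, but 1 at
  (\<open>None\<close>, n) and at (p, \<open>\<infinity>\<close>), so it jumps. An inequality
  against the limit S therefore cannot be read off pointwise. Pointwise inequalities become operator
  inequalities only between algebra elements, through square roots; S is reached afterwards, vector
  by vector, as a limit of the numbers \<open>ip h (T h)\<close>. States are never represented by
  measures, so monotone convergence of integrals is not at hand; the estimate by a finite partial
  sum, up to a small multiple of the unit, takes its place. The form below may be degenerate because
  the same theory is used at three levels: on the algebra with the form of a state, on its GNS
  space, and on the Hilbert sum of all GNS spaces. Since vectors are concrete functions,
  completeness of the last two is a statement about these functions and has to be proved.\<close>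

locale semi_inner =
  fixes H :: "('i \<Rightarrow> complex) set"
    and ip :: "('i \<Rightarrow> complex) \<Rightarrow> ('i \<Rightarrow> complex) \<Rightarrow> complex"
  assumes zero_mem: "(\<lambda>i. 0) \<in> H"
    and add_mem: "h \<in> H \<Longrightarrow> k \<in> H \<Longrightarrow> (\<lambda>i. h i + k i) \<in> H"
    and scale_mem: "h \<in> H \<Longrightarrow> (\<lambda>i. c * h i) \<in> H"
    and ip_add: "h \<in> H \<Longrightarrow> k \<in> H \<Longrightarrow> l \<in> H \<Longrightarrow> ip h (\<lambda>i. k i + l i) = ip h k + ip h l"
    and ip_scale: "h \<in> H \<Longrightarrow> k \<in> H \<Longrightarrow> ip h (\<lambda>i. c * k i) = c * ip h k"
    and ip_commute: "h \<in> H \<Longrightarrow> k \<in> H \<Longrightarrow> ip k h = cnj (ip h k)"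
    and ip_ge_0: "h \<in> H \<Longrightarrow> 0 \<le> Re (ip h h)"
begin

definition nrm :: "('i \<Rightarrow> complex) \<Rightarrow> real" where
  "nrm h = sqrt (Re (ip h h))"

lemma diff_mem: "h \<in> H \<Longrightarrow> k \<in> H \<Longrightarrow> (\<lambda>i. h i - k i) \<in> H"
  using add_mem[OF _ scale_mem[of k "-1"], of h] by simp

lemma ip_add_left:
  "h \<in> H \<Longrightarrow> k \<in> H \<Longrightarrow> l \<in> H \<Longrightarrow> ip (\<lambda>i. h i + k i) l = ip h l + ip k l"
  by (simp add: ip_commute[of l "\<lambda>i. h i + k i"] ip_commute[of l h] ip_commute[of l k] add_mem ip_add)

lemma ip_scale_left: "h \<in> H \<Longrightarrow> k \<in> H \<Longrightarrow> ip (\<lambda>i. c * h i) k = cnj c * ip h k"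
  by (simp add: ip_commute[of k "\<lambda>i. c * h i"] ip_commute[of k h] scale_mem ip_scale)

lemma ip_diff: "h \<in> H \<Longrightarrow> k \<in> H \<Longrightarrow> l \<in> H \<Longrightarrow> ip h (\<lambda>i. k i - l i) = ip h k - ip h l"
  using ip_add[OF _ _ scale_mem[of l "-1"], of h k] ip_scale[of h l "-1"] by simp

lemma ip_diff_left: "h \<in> H \<Longrightarrow> k \<in> H \<Longrightarrow> l \<in> H \<Longrightarrow> ip (\<lambda>i. h i - k i) l = ip h l - ip k l"
  by (simp add: ip_commute[of l "\<lambda>i. h i - k i"] ip_commute[of l h] ip_commute[of l k] diff_mem ip_diff)

lemma ip_self: "h \<in> H \<Longrightarrow> ip h h = complex_of_real ((nrm h)\<^sup>2)"
  using ip_commute[of h h] ip_ge_0[of h] by (simp add: nrm_def complex_eq_iff)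

lemma nrm_nonneg [simp]: "h \<in> H \<Longrightarrow> 0 \<le> nrm h"
  by (simp add: nrm_def ip_ge_0)

lemma nrm_power2: "h \<in> H \<Longrightarrow> (nrm h)\<^sup>2 = Re (ip h h)"
  by (simp add: nrm_def ip_ge_0)

text \<open>Expand the square of h - t z k with z = \<open>ip k h\<close>. The factor z absorbs the
  phase, so the result is a real polynomial in t that is nonnegative everywhere. As the form may be
  degenerate, k can have seminorm 0, and that case is separate.\<close>

lemma cauchy_schwarz:
  assumes h: "h \<in> H" and k: "k \<in> H"
  shows "cmod (ip h k) \<le> nrm h * nrm k"
proof -
  define z where "z = ip k h"
  have *: "0 \<le> (nrm h)\<^sup>2 - 2 * t * (cmod z)\<^sup>2 + t\<^sup>2 * (cmod z)\<^sup>2 * (nrm k)\<^sup>2" for t :: real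
  proof -
    define c where "c = complex_of_real t * z"
    have ck: "(\<lambda>i. c * k i) \<in> H" and d: "(\<lambda>i. h i - c * k i) \<in> H"
      using h k scale_mem diff_mem by auto
    have "ip (\<lambda>i. h i - c * k i) (\<lambda>i. h i - c * k i)
        = ip h h - c * ip h k - cnj c * (ip k h - c * ip k k)"
      using h k ck d by (simp add: ip_diff ip_diff_left ip_scale ip_scale_left algebra_simps)
    also have "\<dots> = complex_of_real ((nrm h)\<^sup>2 - 2 * t * (cmod z)\<^sup>2 + t\<^sup>2 * (cmod z)\<^sup>2 * (nrm k)\<^sup>2)"
    proof -
      have n: "z * cnj z = complex_of_real ((cmod z)\<^sup>2)" by (rule complex_norm_square[symmetric])
      have "ip h k = cnj z" using ip_commute[OF k h] by (simp add: z_def)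
      then have 1: "c * ip h k = complex_of_real (t * (cmod z)\<^sup>2)"
        using n by (simp add: c_def mult.assoc)
      have "cnj c * z = complex_of_real t * (z * cnj z)" by (simp add: c_def)
      then have 2: "cnj c * ip k h = complex_of_real (t * (cmod z)\<^sup>2)"
        unfolding n by (simp add: z_def)
      have "cnj c * c = complex_of_real t * (complex_of_real t * (z * cnj z))"
        by (simp add: c_def)
      then have 3: "cnj c * (c * ip k k) = complex_of_real (t\<^sup>2 * (cmod z)\<^sup>2 * (nrm k)\<^sup>2)"
        unfolding n ip_self[OF k] by (simp add: power2_eq_square flip: mult.assoc)
      show ?thesis
        unfolding right_diff_distrib 1 2 3 ip_self[OF h] by simp
    qed
    finally show ?thesis
      using ip_ge_0[OF d] by simp
  qed
  have "(cmod z)\<^sup>2 \<le> (nrm h)\<^sup>2 * (nrm k)\<^sup>2"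
  proof (cases "nrm k = 0")
    case True
    have "z = 0"
    proof (rule ccontr)
      assume "z \<noteq> 0"
      \<comment> \<open>Without its quadratic term the polynomial is affine in t; this t gives it
        the value -(nrm h)^2 - 2, which is negative.\<close>
      then have "((nrm h)\<^sup>2 + 1) / (cmod z)\<^sup>2 * (cmod z)\<^sup>2 = (nrm h)\<^sup>2 + 1" by simp
      then show False
        using *[of "((nrm h)\<^sup>2 + 1) / (cmod z)\<^sup>2"] zero_le_power2[of "nrm h"]
        unfolding mult.assoc True by simp
    qed
    then show ?thesis by simp
  next
    case False
    define N where "N = (nrm k)\<^sup>2"
    have N: "N > 0" using False by (simp add: N_def)
    \<comment> \<open>t = 1 / N is the minimum point of the polynomial.\<close>
    then have "(1 / N)\<^sup>2 * (cmod z)\<^sup>2 * N = (cmod z)\<^sup>2 / N"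
      by (simp add: power2_eq_square[of "1 / N"])
    then have "(cmod z)\<^sup>2 / N \<le> (nrm h)\<^sup>2"
      using *[of "1 / N"] by (simp flip: N_def)
    then show ?thesis using N by (simp add: field_simps flip: N_def)
  qed
  then have "(cmod z)\<^sup>2 \<le> (nrm h * nrm k)\<^sup>2" by (simp add: power_mult_distrib)
  then have "cmod z \<le> nrm h * nrm k"
    by (rule power2_le_imp_le) (use h k in auto)
  then show ?thesis
    using ip_commute[OF k h] by (simp add: z_def)
qed

lemma nrm_triangle:
  assumes h: "h \<in> H" and k: "k \<in> H"
  shows "nrm (\<lambda>i. h i + k i) \<le> nrm h + nrm k"
proof -
  have "(nrm (\<lambda>i. h i + k i))\<^sup>2 = (nrm h)\<^sup>2 + 2 * Re (ip h k) + (nrm k)\<^sup>2"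
    using assms ip_commute[OF h k]
    by (simp add: nrm_power2 add_mem ip_add ip_add_left)
  also have "\<dots> \<le> (nrm h)\<^sup>2 + 2 * (nrm h * nrm k) + (nrm k)\<^sup>2"
    using cauchy_schwarz[OF h k] complex_Re_le_cmod[of "ip h k"] by linarith
  also have "\<dots> = (nrm h + nrm k)\<^sup>2" by (simp add: power2_sum)
  finally show ?thesis by (rule power2_le_imp_le) (use assms in auto)
qed

lemma nrm_scale: "h \<in> H \<Longrightarrow> nrm (\<lambda>i. c * h i) = cmod c * nrm h"
proof -
  assume h: "h \<in> H"
  have "c * cnj c = complex_of_real ((cmod c)\<^sup>2)" by (rule complex_norm_square[symmetric])
  then have "ip (\<lambda>i. c * h i) (\<lambda>i. c * h i) = complex_of_real ((cmod c * nrm h)\<^sup>2)"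
    using h by (simp add: ip_scale ip_scale_left scale_mem ip_self power_mult_distrib flip: mult.assoc)
  then show ?thesis using h by (simp add: nrm_def[of "\<lambda>i. c * h i"])
qed

lemma nrm_minus_commute: "h \<in> H \<Longrightarrow> k \<in> H \<Longrightarrow> nrm (\<lambda>i. h i - k i) = nrm (\<lambda>i. k i - h i)"
  using nrm_scale[OF diff_mem, of k h "-1"] by simp

lemma nrm_diff_triangle:
  assumes "h \<in> H" "k \<in> H" "l \<in> H"
  shows "nrm (\<lambda>i. h i - l i) \<le> nrm (\<lambda>i. h i - k i) + nrm (\<lambda>i. k i - l i)"
  using nrm_triangle[OF diff_mem[of h k] diff_mem[of k l]] assms by simp

lemma abs_nrm_diff:
  assumes "h \<in> H" "k \<in> H"
  shows "\<bar>nrm h - nrm k\<bar> \<le> nrm (\<lambda>i. h i - k i)"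
  using nrm_triangle[OF diff_mem[of h k], of k] nrm_triangle[OF diff_mem[of k h], of h]
    nrm_minus_commute[of h k] assms by simp

section \<open>Cauchy sequences and the continuity of the form\<close>

definition ncauchy :: "(nat \<Rightarrow> 'i \<Rightarrow> complex) \<Rightarrow> bool" where
  "ncauchy v \<longleftrightarrow> (\<forall>n. v n \<in> H) \<and>
    (\<forall>e>0. \<exists>M. \<forall>m\<ge>M. \<forall>n\<ge>M. nrm (\<lambda>i. v m i - v n i) < e)"

lemma ncauchy_mem: "ncauchy v \<Longrightarrow> v n \<in> H"
  by (simp add: ncauchy_def)

lemma ncauchyD:
  "ncauchy v \<Longrightarrow> e > 0 \<Longrightarrow> \<exists>M. \<forall>m\<ge>M. \<forall>n\<ge>M. nrm (\<lambda>i. v m i - v n i) < e"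
  by (simp add: ncauchy_def)

lemma ncauchy_bounded:
  assumes "ncauchy v"
  obtains B where "B > 0" "\<And>n. nrm (v n) \<le> B"
proof -
  note v = ncauchy_mem[OF assms]
  obtain M where M: "\<forall>m\<ge>M. \<forall>n\<ge>M. nrm (\<lambda>i. v m i - v n i) < 1"
    using ncauchyD[OF assms, of 1] by auto
  define B where "B = Max ((\<lambda>n. nrm (v n)) ` {..M}) + 1"
  have B: "nrm (v n) \<le> B - 1" if "n \<le> M" for n
    using that by (auto simp: B_def)
  have "nrm (v n) \<le> B" for n
  proof (cases "n \<le> M")
    case True then show ?thesis using B by force
  next
    case False
    then show ?thesis
      using abs_nrm_diff[OF v v, of n M] M[rule_format, of n M] B[of M] by simp
  qed
  moreover have "B > 0" using B[of 0] v[of 0] nrm_nonneg[of "v 0"] by linarith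
  ultimately show ?thesis using that by blast
qed

lemma ncauchy_add:
  assumes "ncauchy v" "ncauchy w" shows "ncauchy (\<lambda>n i. v n i + w n i)"
  unfolding ncauchy_def
proof (intro conjI allI impI)
  note m = ncauchy_mem[OF assms(1)] ncauchy_mem[OF assms(2)]
  show "(\<lambda>i. v n i + w n i) \<in> H" for n by (intro add_mem m)
  fix e :: real assume "e > 0"
  then obtain M N where M: "\<forall>m\<ge>M. \<forall>n\<ge>M. nrm (\<lambda>i. v m i - v n i) < e/2"
    and N: "\<forall>m\<ge>N. \<forall>n\<ge>N. nrm (\<lambda>i. w m i - w n i) < e/2"
    using ncauchyD[OF assms(1), of "e/2"] ncauchyD[OF assms(2), of "e/2"] by auto
  show "\<exists>M. \<forall>m\<ge>M. \<forall>n\<ge>M. nrm (\<lambda>i. v m i + w m i - (v n i + w n i)) < e"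
  proof (intro exI[of _ "max M N"] allI impI)
    fix p q assume "max M N \<le> p" "max M N \<le> q"
    then show "nrm (\<lambda>i. v p i + w p i - (v q i + w q i)) < e"
      using nrm_triangle[OF diff_mem[OF m(1,1), of p q] diff_mem[OF m(2,2), of p q]]
        M[rule_format, of p q] N[rule_format, of p q] by (simp add: algebra_simps)
  qed
qed

lemma ncauchy_scale:
  assumes "ncauchy v" shows "ncauchy (\<lambda>n i. c * v n i)"
  unfolding ncauchy_def
proof (intro conjI allI impI)
  note m = ncauchy_mem[OF assms(1)]
  show "(\<lambda>i. c * v n i) \<in> H" for n by (intro scale_mem m)
  fix e :: real assume "e > 0"
  then obtain M where M: "\<forall>m\<ge>M. \<forall>n\<ge>M. nrm (\<lambda>i. v m i - v n i) < e / (cmod c + 1)"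
    using ncauchyD[OF assms(1), of "e / (cmod c + 1)"] by (auto simp: add_nonneg_pos)
  have "nrm (\<lambda>i. c * v p i - c * v q i) < e" if "M \<le> p" "M \<le> q" for p q
  proof -
    have "nrm (\<lambda>i. c * v p i - c * v q i) = cmod c * nrm (\<lambda>i. v p i - v q i)"
      using nrm_scale[OF diff_mem[OF m m], of c p q] by (simp add: algebra_simps)
    also have "\<dots> \<le> (cmod c + 1) * nrm (\<lambda>i. v p i - v q i)"
      using nrm_nonneg[OF diff_mem[OF m m]] by (intro mult_right_mono) auto
    also have "\<dots> < e"
      using M[rule_format, OF that] by (simp add: pos_less_divide_eq add_nonneg_pos mult.commute)
    finally show ?thesis .
  qed
  then show "\<exists>M. \<forall>m\<ge>M. \<forall>n\<ge>M. nrm (\<lambda>i. c * v m i - c * v n i) < e" by blast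
qed

lemma ncauchy_diff:
  assumes "ncauchy v" "ncauchy w" shows "ncauchy (\<lambda>n i. v n i - w n i)"
  using ncauchy_add[OF assms(1) ncauchy_scale[OF assms(2), of "-1"]] by simp

lemma ncauchy_const: "h \<in> H \<Longrightarrow> ncauchy (\<lambda>n. h)"
  using nrm_scale[of h 0] by (simp add: ncauchy_def)

lemma ncauchy_convergent_ip:
  assumes v: "ncauchy v" and w: "ncauchy w"
  shows "convergent (\<lambda>n. ip (v n) (w n))"
proof -
  note m = ncauchy_mem[OF v] ncauchy_mem[OF w]
  obtain B where B: "B > 0" "\<And>n. nrm (v n) \<le> B" using ncauchy_bounded[OF v] by blast
  obtain C where C: "C > 0" "\<And>n. nrm (w n) \<le> C" using ncauchy_bounded[OF w] by blast
  have "Cauchy (\<lambda>n. ip (v n) (w n))"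
  proof (rule metric_CauchyI)
    fix e :: real assume e: "e > 0"
    obtain M where M: "\<forall>m\<ge>M. \<forall>n\<ge>M. nrm (\<lambda>i. v m i - v n i) < e / (2*C)"
      using ncauchyD[OF v, of "e/(2*C)"] e C by auto
    obtain N where N: "\<forall>m\<ge>N. \<forall>n\<ge>N. nrm (\<lambda>i. w m i - w n i) < e / (2*B)"
      using ncauchyD[OF w, of "e/(2*B)"] e B by auto
    show "\<exists>M. \<forall>m\<ge>M. \<forall>n\<ge>M. dist (ip (v m) (w m)) (ip (v n) (w n)) < e"
    proof (intro exI[of _ "max M N"] allI impI)
      fix p q assume pq: "max M N \<le> p" "max M N \<le> q"
      have "ip (v p) (w p) - ip (v q) (w q)
          = ip (\<lambda>i. v p i - v q i) (w p) + ip (v q) (\<lambda>i. w p i - w q i)"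
        by (simp add: ip_diff ip_diff_left m)
      then have "dist (ip (v p) (w p)) (ip (v q) (w q))
          \<le> nrm (\<lambda>i. v p i - v q i) * nrm (w p) + nrm (v q) * nrm (\<lambda>i. w p i - w q i)"
        by (simp only: dist_norm) (intro norm_triangle_le add_mono cauchy_schwarz diff_mem m)
      also have "\<dots> \<le> nrm (\<lambda>i. v p i - v q i) * C + B * nrm (\<lambda>i. w p i - w q i)"
        by (intro add_mono mult_mono) (use B C m diff_mem in auto)
      also have "\<dots> < e / (2*C) * C + B * (e / (2*B))"
        using M[rule_format, of p q] N[rule_format, of p q] pq B C
        by (intro add_strict_mono mult_strict_right_mono mult_strict_left_mono) auto
      also have "\<dots> = e" using B C by simp
      finally show "dist (ip (v p) (w p)) (ip (v q) (w q)) < e" .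
    qed
  qed
  then show ?thesis by (simp add: Cauchy_convergent_iff)
qed

text \<open>Split the square of \<open>nrm (d n)\<close> at a fixed late member d M: the part with d
  n - d M is small by the Cauchy property, the pairing with d M by weak convergence. This is what
  makes a GNS vector determined by its pairings with the algebra.\<close>

lemma ncauchy_weak_null:
  assumes d: "ncauchy d" and z: "\<And>c. c \<in> H \<Longrightarrow> (\<lambda>n. ip c (d n)) \<longlonglongrightarrow> 0"
  shows "(\<lambda>n. nrm (d n)) \<longlonglongrightarrow> 0"
proof -
  note m = ncauchy_mem[OF d]
  obtain B where B: "B > 0" "\<And>n. nrm (d n) \<le> B" using ncauchy_bounded[OF d] by blast
  have "(\<lambda>n. (nrm (d n))\<^sup>2) \<longlonglongrightarrow> 0"
  proof (rule LIMSEQ_I)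
    fix e :: real assume e: "e > 0"
    obtain M where M: "\<forall>p\<ge>M. \<forall>n\<ge>M. nrm (\<lambda>i. d p i - d n i) < e / (2*B)"
      using ncauchyD[OF d, of "e/(2*B)"] e B by auto
    obtain N where N: "\<forall>n\<ge>N. norm (ip (d M) (d n) - 0) < e/2"
      using LIMSEQ_D[OF z[OF m[of M]], of "e/2"] e by auto
    show "\<exists>N. \<forall>n\<ge>N. norm ((nrm (d n))\<^sup>2 - 0) < e"
    proof (intro exI[of _ "max M N"] allI impI)
      fix n assume n: "max M N \<le> n"
      have "complex_of_real ((nrm (d n))\<^sup>2) = ip (\<lambda>i. d n i - d M i) (d n) + ip (d M) (d n)"
        by (simp add: ip_diff_left m ip_self)
      then have "cmod (complex_of_real ((nrm (d n))\<^sup>2))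
          \<le> nrm (\<lambda>i. d n i - d M i) * nrm (d n) + cmod (ip (d M) (d n))"
        by (simp only:) (intro norm_triangle_le add_mono cauchy_schwarz diff_mem m order_refl)
      also have "\<dots> \<le> nrm (\<lambda>i. d n i - d M i) * B + cmod (ip (d M) (d n))"
        by (intro add_mono mult_mono) (use B m diff_mem in auto)
      also have "\<dots> < e / (2*B) * B + e/2"
        using M[rule_format, of n M] N[rule_format, of n] n B
        by (intro add_strict_mono mult_strict_right_mono) auto
      also have "\<dots> = e" using B by simp
      finally show "norm ((nrm (d n))\<^sup>2 - 0) < e" by (simp add: norm_power)
    qed
  qed
  then have "(\<lambda>n. sqrt ((nrm (d n))\<^sup>2)) \<longlonglongrightarrow> sqrt 0" by (rule tendsto_real_sqrt)
  then show ?thesis by (simp add: m)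
qed

text \<open>Membership is asked only eventually because nets over
  \<open>finite_subsets_at_top\<close> are controlled only at finite sets inside the index
  set.\<close>

lemma tendsto_ip:
  assumes "\<forall>\<^sub>F t in F. v t \<in> H" "k \<in> H" "h \<in> H" "((\<lambda>t. nrm (\<lambda>i. v t i - k i)) \<longlongrightarrow> 0) F"
  shows "((\<lambda>t. ip h (v t)) \<longlongrightarrow> ip h k) F"
proof -
  have "((\<lambda>t. nrm h * nrm (\<lambda>i. v t i - k i)) \<longlongrightarrow> 0) F"
    using tendsto_mult_right_zero[OF assms(4)] by simp
  moreover have "\<forall>\<^sub>F t in F. norm (ip h (v t) - ip h k) \<le> nrm h * nrm (\<lambda>i. v t i - k i)"
    using assms(1)
    by eventually_elim (use assms(2,3) cauchy_schwarz[OF assms(3) diff_mem] in \<open>simp flip: ip_diff\<close>)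
  ultimately have "((\<lambda>t. ip h (v t) - ip h k) \<longlongrightarrow> 0) F"
    by (rule Lim_null_comparison[rotated])
  then show ?thesis using LIM_zero_iff by blast
qed

lemma tendsto_nrm:
  assumes "\<forall>\<^sub>F t in F. v t \<in> H" "k \<in> H" "((\<lambda>t. nrm (\<lambda>i. v t i - k i)) \<longlongrightarrow> 0) F"
  shows "((\<lambda>t. nrm (v t)) \<longlongrightarrow> nrm k) F"
proof -
  have "\<forall>\<^sub>F t in F. norm (nrm (v t) - nrm k) \<le> nrm (\<lambda>i. v t i - k i)"
    using assms(1) by eventually_elim (use assms(2) abs_nrm_diff in auto)
  then have "((\<lambda>t. nrm (v t) - nrm k) \<longlongrightarrow> 0) F"
    using assms(3) by (rule Lim_null_comparison)
  then show ?thesis using LIM_zero_iff by blast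
qed

text \<open>Makes the inner product of two classes of Cauchy sequences independent of the
  representatives.\<close>

lemma ip_seq_equiv:
  assumes "ncauchy a" "ncauchy b" "ncauchy a'" "ncauchy b'"
    and "(\<lambda>n. nrm (\<lambda>i. a n i - a' n i)) \<longlonglongrightarrow> 0" "(\<lambda>n. nrm (\<lambda>i. b n i - b' n i)) \<longlonglongrightarrow> 0"
  shows "(\<lambda>n. ip (a n) (b n) - ip (a' n) (b' n)) \<longlonglongrightarrow> 0"
proof -
  note m = assms(1-4)[THEN ncauchy_mem]
  obtain B where B: "B > 0" "\<And>n. nrm (b n) \<le> B" using ncauchy_bounded[OF assms(2)] by blast
  obtain C where C: "C > 0" "\<And>n. nrm (a' n) \<le> C" using ncauchy_bounded[OF assms(3)] by blast
  have "(\<lambda>n. nrm (\<lambda>i. a n i - a' n i) * B + C * nrm (\<lambda>i. b n i - b' n i)) \<longlonglongrightarrow> 0 * B + C * 0"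
    by (intro tendsto_intros assms)
  then have lim: "(\<lambda>n. nrm (\<lambda>i. a n i - a' n i) * B + C * nrm (\<lambda>i. b n i - b' n i)) \<longlonglongrightarrow> 0"
    by simp
  show ?thesis
  proof (rule Lim_null_comparison[OF always_eventually[OF allI] lim])
    fix n
    have "ip (a n) (b n) - ip (a' n) (b' n)
        = ip (\<lambda>i. a n i - a' n i) (b n) + ip (a' n) (\<lambda>i. b n i - b' n i)"
      by (simp add: ip_diff ip_diff_left m)
    then have "norm (ip (a n) (b n) - ip (a' n) (b' n))
        \<le> nrm (\<lambda>i. a n i - a' n i) * nrm (b n) + nrm (a' n) * nrm (\<lambda>i. b n i - b' n i)"
      by (simp only:) (intro norm_triangle_le add_mono cauchy_schwarz diff_mem m)
    also have "\<dots> \<le> nrm (\<lambda>i. a n i - a' n i) * B + C * nrm (\<lambda>i. b n i - b' n i)"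
      by (intro add_mono mult_mono) (use B C m diff_mem in auto)
    finally show "norm (ip (a n) (b n) - ip (a' n) (b' n)) \<le> \<dots>" .
  qed
qed

text \<open>The functional of one vector is the ultraweak functional of the sequence h, 0, 0, ...
  The operators are arbitrary functions here, so that they send 0 into H is a hypothesis; it makes
  the remaining terms of the series vanish.\<close>

lemma ultraweak_limit_vector:
  assumes lim: "ultraweak_limit H ip T S F" and h: "h \<in> H"
    and T: "\<forall>\<^sub>F t in F. T t (\<lambda>i. 0) \<in> H" and S: "S (\<lambda>i. 0) \<in> H"
  shows "((\<lambda>t. ip h (T t h)) \<longlongrightarrow> ip h (S h)) F"
proof -
  define \<xi> where "\<xi> n = (if n = 0 then h else (\<lambda>i. 0))" for n :: nat
  have z: "ip (\<lambda>i. 0) k = 0" if "k \<in> H" for k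
    using ip_scale_left[OF zero_mem that, of 0] by simp
  have "square_summable H ip \<xi>"
    unfolding square_summable_def
  proof (intro conjI allI)
    show "\<xi> n \<in> H" for n by (simp add: \<xi>_def h zero_mem)
    show "summable (\<lambda>n. Re (ip (\<xi> n) (\<xi> n)))"
      by (rule summable_finite[of "{0}"]) (auto simp: \<xi>_def z[OF zero_mem])
  qed
  then have *: "((\<lambda>t. \<Sum>n. ip (\<xi> n) (T t (\<xi> n))) \<longlongrightarrow> (\<Sum>n. ip (\<xi> n) (S (\<xi> n)))) F"
    using lim by (auto simp: ultraweak_limit_def)
  have e: "(\<Sum>n. ip (\<xi> n) (R (\<xi> n))) = ip h (R h)" if "R (\<lambda>i. 0) \<in> H" for R
    by (subst suminf_finite[of "{0}"]) (auto simp: \<xi>_def z that)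
  have "\<forall>\<^sub>F t in F. (\<Sum>n. ip (\<xi> n) (T t (\<xi> n))) = ip h (T t h)"
    using T by eventually_elim (rule e)
  with * show ?thesis unfolding e[of S, OF S] by (rule Lim_transform_eventually)
qed

end

text \<open>The definition compares squares and allows a constant of either sign;
  \<open>sqrt \<bar>C\<bar>\<close> and \<open>C\<^sup>2\<close> translate between it and an
  ordinary norm bound.\<close>

lemma bounded_operators_iff:
  assumes "semi_inner H ip"
  shows "T \<in> bounded_operators H ip \<longleftrightarrow> T \<in> H \<rightarrow>\<^sub>E H \<and>
    (\<forall>h\<in>H. \<forall>k\<in>H. T (\<lambda>i. h i + k i) = (\<lambda>i. T h i + T k i)) \<and>
    (\<forall>c. \<forall>h\<in>H. T (\<lambda>i. c * h i) = (\<lambda>i. c * T h i)) \<and>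
    (\<exists>C\<ge>0. \<forall>h\<in>H. semi_inner.nrm ip (T h) \<le> C * semi_inner.nrm ip h)"
proof -
  interpret semi_inner H ip by fact
  have "(\<exists>C. \<forall>h\<in>H. Re (ip (T h) (T h)) \<le> C * Re (ip h h)) \<longleftrightarrow>
      (\<exists>C\<ge>0. \<forall>h\<in>H. nrm (T h) \<le> C * nrm h)" if T: "T \<in> H \<rightarrow>\<^sub>E H"
  proof
    assume "\<exists>C. \<forall>h\<in>H. Re (ip (T h) (T h)) \<le> C * Re (ip h h)"
    then obtain C where C: "\<And>h. h \<in> H \<Longrightarrow> Re (ip (T h) (T h)) \<le> C * Re (ip h h)" by blast
    have "nrm (T h) \<le> sqrt \<bar>C\<bar> * nrm h" if "h \<in> H" for h
    proof -
      have "Re (ip (T h) (T h)) \<le> \<bar>C\<bar> * Re (ip h h)"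
        using C[OF that] ip_ge_0[OF that] mult_right_mono[OF abs_ge_self, of "Re (ip h h)" C] by linarith
      then show ?thesis by (simp add: nrm_def flip: real_sqrt_mult)
    qed
    then show "\<exists>C\<ge>0. \<forall>h\<in>H. nrm (T h) \<le> C * nrm h"
      by (intro exI[of _ "sqrt \<bar>C\<bar>"]) auto
  next
    assume "\<exists>C\<ge>0. \<forall>h\<in>H. nrm (T h) \<le> C * nrm h"
    then obtain C where C: "\<And>h. h \<in> H \<Longrightarrow> nrm (T h) \<le> C * nrm h" by blast
    have "Re (ip (T h) (T h)) \<le> C\<^sup>2 * Re (ip h h)" if "h \<in> H" for h
    proof -
      have "T h \<in> H" using T that by auto
      then have "(nrm (T h))\<^sup>2 \<le> (C * nrm h)\<^sup>2" using C[OF that] by (intro power_mono) auto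
      then show ?thesis using \<open>T h \<in> H\<close> that by (simp add: power_mult_distrib nrm_power2)
    qed
    then show "\<exists>C. \<forall>h\<in>H. Re (ip (T h) (T h)) \<le> C * Re (ip h h)" by blast
  qed
  then show ?thesis unfolding bounded_operators_def by blast
qed

locale hilbert_functions = semi_inner +
  assumes definite: "h \<in> H \<Longrightarrow> ip h h = 0 \<Longrightarrow> h = (\<lambda>i. 0)"
    and complete: "ncauchy v \<Longrightarrow> \<exists>k\<in>H. (\<lambda>n. nrm (\<lambda>i. v n i - k i)) \<longlonglongrightarrow> 0"
begin

lemma nrm_eq_0: "h \<in> H \<Longrightarrow> nrm h = 0 \<Longrightarrow> h = (\<lambda>i. 0)"
  using definite ip_self by simp

lemma strong_limit_unique:
  assumes "F \<noteq> bot" "\<forall>\<^sub>F t in F. v t \<in> H" "k \<in> H" "l \<in> H"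
    and "((\<lambda>t. nrm (\<lambda>i. v t i - k i)) \<longlongrightarrow> 0) F" "((\<lambda>t. nrm (\<lambda>i. v t i - l i)) \<longlongrightarrow> 0) F"
  shows "k = l"
proof -
  have "((\<lambda>t. nrm (\<lambda>i. v t i - k i) + nrm (\<lambda>i. v t i - l i)) \<longlongrightarrow> 0 + 0) F"
    by (intro tendsto_add assms)
  moreover have "\<forall>\<^sub>F t in F. nrm (\<lambda>i. k i - l i) \<le> nrm (\<lambda>i. v t i - k i) + nrm (\<lambda>i. v t i - l i)"
    using assms(2)
    by eventually_elim (metis assms(3,4) nrm_diff_triangle nrm_minus_commute)
  ultimately have "nrm (\<lambda>i. k i - l i) \<le> 0 + 0"
    using assms(1) by (intro tendsto_lowerbound)
  then have "nrm (\<lambda>i. k i - l i) = 0"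
    using nrm_nonneg[OF diff_mem[OF assms(3,4)]] by simp
  then have "(\<lambda>i. k i - l i) = (\<lambda>i. 0)" using nrm_eq_0 diff_mem assms(3,4) by blast
  then show ?thesis by (auto simp: fun_eq_iff)
qed

text \<open>Lifts completeness from sequences to filters. Indices s n with error 1/(n+1) give a
  Cauchy sequence, since two eventual conditions hold at a common index of a proper filter; its
  limit attracts the whole net. The Cauchy condition compares the tail with a single member, which
  is the form that an almost attained supremum provides.\<close>

lemma net_complete:
  assumes "F \<noteq> bot" and v: "\<forall>\<^sub>F t in F. v t \<in> H"
    and c: "\<And>e. e > 0 \<Longrightarrow> \<exists>s. v s \<in> H \<and> (\<forall>\<^sub>F t in F. nrm (\<lambda>i. v t i - v s i) < e)"
  shows "\<exists>k\<in>H. ((\<lambda>t. nrm (\<lambda>i. v t i - k i)) \<longlongrightarrow> 0) F"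
proof -
  define e where "e n = inverse (real (Suc n))" for n
  have "\<forall>n. \<exists>s. v s \<in> H \<and> (\<forall>\<^sub>F t in F. nrm (\<lambda>i. v t i - v s i) < e n)"
    using c by (simp add: e_def)
  from choice[OF this] obtain s where s: "\<And>n. v (s n) \<in> H"
    "\<And>n. \<forall>\<^sub>F t in F. nrm (\<lambda>i. v t i - v (s n) i) < e n" by blast
  have e0: "e \<longlonglongrightarrow> 0" unfolding e_def by (rule LIMSEQ_inverse_real_of_nat)
  have ss: "nrm (\<lambda>i. v (s m) i - v (s n) i) < e m + e n" for m n
  proof -
    have "\<forall>\<^sub>F t in F. nrm (\<lambda>i. v (s m) i - v (s n) i) < e m + e n"
      using v s(2)[of m] s(2)[of n]
    proof eventually_elim
      case (elim t)
      then show ?case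
        using nrm_diff_triangle[of "v (s m)" "v t" "v (s n)"] nrm_minus_commute[of "v t" "v (s m)"] s(1)
        by simp
    qed
    then show ?thesis using eventually_happens'[OF assms(1)] by blast
  qed
  have "ncauchy (\<lambda>n. v (s n))"
    unfolding ncauchy_def
  proof (intro conjI allI impI)
    fix r :: real assume "r > 0"
    then obtain M where M: "\<forall>n\<ge>M. norm (e n - 0) < r/2" using LIMSEQ_D[OF e0, of "r/2"] by auto
    show "\<exists>M. \<forall>m\<ge>M. \<forall>n\<ge>M. nrm (\<lambda>i. v (s m) i - v (s n) i) < r"
    proof (intro exI[of _ M] allI impI)
      fix m n assume "M \<le> m" "M \<le> n"
      then show "nrm (\<lambda>i. v (s m) i - v (s n) i) < r"
        using ss[of m n] M[rule_format, of m] M[rule_format, of n] by simp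
    qed
  qed (use s in auto)
  then obtain k where k: "k \<in> H" "(\<lambda>n. nrm (\<lambda>i. v (s n) i - k i)) \<longlonglongrightarrow> 0"
    using complete by blast
  have "((\<lambda>t. nrm (\<lambda>i. v t i - k i)) \<longlongrightarrow> 0) F"
  proof (rule tendstoI)
    fix r :: real assume r: "r > 0"
    have "(\<lambda>n. e n + nrm (\<lambda>i. v (s n) i - k i)) \<longlonglongrightarrow> 0 + 0" by (intro tendsto_add e0 k)
    then have "\<forall>\<^sub>F n in sequentially. e n + nrm (\<lambda>i. v (s n) i - k i) < r"
      using r by (intro order_tendstoD) auto
    then obtain n where n: "e n + nrm (\<lambda>i. v (s n) i - k i) < r"
      by (auto simp: eventually_sequentially)
    show "\<forall>\<^sub>F t in F. dist (nrm (\<lambda>i. v t i - k i)) 0 < r"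
      using v s(2)[of n]
    proof eventually_elim
      case (elim t)
      then show ?case
        using n nrm_diff_triangle[of "v t" "v (s n)" k] s(1) k(1) nrm_nonneg[OF diff_mem[of "v t" k]]
        by simp
    qed
  qed
  then show ?thesis using k(1) by blast
qed

text \<open>Limits are taken vector by vector. Additivity and homogeneity follow from uniqueness of
  limits, the bound from convergence of norms.\<close>

lemma strong_limit_exists:
  assumes F: "F \<noteq> bot"
    and T: "\<forall>\<^sub>F t in F. T t \<in> bounded_operators H ip \<and> (\<forall>h\<in>H. nrm (T t h) \<le> C * nrm h)"
    and "C \<ge> 0"
    and c: "\<And>h e. h \<in> H \<Longrightarrow> e > 0 \<Longrightarrow>
      \<exists>s. T s h \<in> H \<and> (\<forall>\<^sub>F t in F. nrm (\<lambda>i. T t h i - T s h i) < e)"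
  shows "\<exists>S\<in>bounded_operators H ip. (\<forall>h\<in>H. nrm (S h) \<le> C * nrm h) \<and>
    (\<forall>h\<in>H. ((\<lambda>t. nrm (\<lambda>i. T t h i - S h i)) \<longlongrightarrow> 0) F)"
proof -
  have T': "\<forall>\<^sub>F t in F. T t \<in> H \<rightarrow> H \<and>
    (\<forall>h\<in>H. \<forall>k\<in>H. T t (\<lambda>i. h i + k i) = (\<lambda>i. T t h i + T t k i)) \<and>
    (\<forall>c. \<forall>h\<in>H. T t (\<lambda>i. c * h i) = (\<lambda>i. c * T t h i)) \<and>
    (\<forall>h\<in>H. nrm (T t h) \<le> C * nrm h)"
    using T by eventually_elim (auto simp: bounded_operators_def PiE_def)
  have mem: "\<forall>\<^sub>F t in F. T t h \<in> H" if "h \<in> H" for h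
    using T' by eventually_elim (use that in auto)
  have "\<exists>k\<in>H. ((\<lambda>t. nrm (\<lambda>i. T t h i - k i)) \<longlongrightarrow> 0) F" if "h \<in> H" for h
    using net_complete[OF F mem[OF that]] c[OF that] by blast
  then obtain S' where S': "\<And>h. h \<in> H \<Longrightarrow> S' h \<in> H"
    "\<And>h. h \<in> H \<Longrightarrow> ((\<lambda>t. nrm (\<lambda>i. T t h i - S' h i)) \<longlongrightarrow> 0) F" by metis
  \<comment> \<open>Members of \<open>bounded_operators\<close> are \<open>undefined\<close> outside
    H, hence the restriction.\<close>
  define S where "S = restrict S' H"
  have S: "\<And>h. h \<in> H \<Longrightarrow> S h \<in> H"
    "\<And>h. h \<in> H \<Longrightarrow> ((\<lambda>t. nrm (\<lambda>i. T t h i - S h i)) \<longlongrightarrow> 0) F"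
    using S' by (auto simp: S_def)
  have add: "S (\<lambda>i. h i + k i) = (\<lambda>i. S h i + S k i)" if hk: "h \<in> H" "k \<in> H" for h k
  proof (rule strong_limit_unique[OF F])
    show "\<forall>\<^sub>F t in F. T t (\<lambda>i. h i + k i) \<in> H" using hk by (intro mem add_mem)
    show "S (\<lambda>i. h i + k i) \<in> H" "(\<lambda>i. S h i + S k i) \<in> H" using hk by (auto intro!: S add_mem)
    show "((\<lambda>t. nrm (\<lambda>i. T t (\<lambda>i. h i + k i) i - S (\<lambda>i. h i + k i) i)) \<longlongrightarrow> 0) F"
      using hk by (intro S add_mem)
    have "((\<lambda>t. nrm (\<lambda>i. T t h i - S h i) + nrm (\<lambda>i. T t k i - S k i)) \<longlongrightarrow> 0 + 0) F"
      using hk by (intro tendsto_add S)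
    then have lim: "((\<lambda>t. nrm (\<lambda>i. T t h i - S h i) + nrm (\<lambda>i. T t k i - S k i)) \<longlongrightarrow> 0) F" by simp
    show "((\<lambda>t. nrm (\<lambda>i. T t (\<lambda>i. h i + k i) i - (S h i + S k i))) \<longlongrightarrow> 0) F"
    proof (rule Lim_null_comparison[OF _ lim])
      show "\<forall>\<^sub>F t in F. norm (nrm (\<lambda>i. T t (\<lambda>i. h i + k i) i - (S h i + S k i)))
        \<le> nrm (\<lambda>i. T t h i - S h i) + nrm (\<lambda>i. T t k i - S k i)"
        using T' mem[OF hk(1)] mem[OF hk(2)]
      proof eventually_elim
        case (elim t)
        have d: "(\<lambda>i. T t h i - S h i) \<in> H" "(\<lambda>i. T t k i - S k i) \<in> H"
          using elim hk by (auto intro!: diff_mem S)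
        have e: "(\<lambda>i. T t (\<lambda>i. h i + k i) i - (S h i + S k i))
          = (\<lambda>i. (T t h i - S h i) + (T t k i - S k i))"
          using elim hk by (auto simp: fun_eq_iff)
        show ?case
          unfolding e using nrm_triangle[OF d] nrm_nonneg[OF add_mem[OF d]] by simp
      qed
    qed
  qed
  have scale: "S (\<lambda>i. c * h i) = (\<lambda>i. c * S h i)" if h: "h \<in> H" for c h
  proof (rule strong_limit_unique[OF F])
    show "\<forall>\<^sub>F t in F. T t (\<lambda>i. c * h i) \<in> H" using h by (intro mem scale_mem)
    show "S (\<lambda>i. c * h i) \<in> H" "(\<lambda>i. c * S h i) \<in> H" using h by (auto intro!: S scale_mem)
    show "((\<lambda>t. nrm (\<lambda>i. T t (\<lambda>i. c * h i) i - S (\<lambda>i. c * h i) i)) \<longlongrightarrow> 0) F"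
      using h by (intro S scale_mem)
    have lim: "((\<lambda>t. cmod c * nrm (\<lambda>i. T t h i - S h i)) \<longlongrightarrow> 0) F"
      using h by (intro tendsto_mult_right_zero S)
    show "((\<lambda>t. nrm (\<lambda>i. T t (\<lambda>i. c * h i) i - c * S h i)) \<longlongrightarrow> 0) F"
    proof (rule Lim_null_comparison[OF _ lim])
      show "\<forall>\<^sub>F t in F. norm (nrm (\<lambda>i. T t (\<lambda>i. c * h i) i - c * S h i))
        \<le> cmod c * nrm (\<lambda>i. T t h i - S h i)"
        using T' mem[OF h]
      proof eventually_elim
        case (elim t)
        have d: "(\<lambda>i. T t h i - S h i) \<in> H"
          using elim h by (auto intro!: diff_mem S)
        have e: "(\<lambda>i. T t (\<lambda>i. c * h i) i - c * S h i) = (\<lambda>i. c * (T t h i - S h i))"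
          using elim h by (auto simp: fun_eq_iff algebra_simps)
        show ?case
          unfolding e using nrm_scale[OF d] d by simp
      qed
    qed
  qed
  have bound: "nrm (S h) \<le> C * nrm h" if h: "h \<in> H" for h
    using T' by (intro tendsto_upperbound[OF tendsto_nrm[OF mem[OF h] S(1)[OF h] S(2)[OF h]] _ F])
      (auto elim!: eventually_mono simp: h)
  have "S \<in> bounded_operators H ip"
    unfolding bounded_operators_iff[OF semi_inner_axioms]
    using add scale bound \<open>C \<ge> 0\<close> S(1) by (auto simp: S_def)
  then show ?thesis using bound S by blast
qed

text \<open>The uniform bound dominates the n-th term by C times the sum of the squared norms of
  \<xi> n and \<eta> n, which is summable and does not depend on t. Tannery's theorem then exchanges
  the limit with the series.\<close>

lemma strong_limit_ultraweak:
  assumes F: "F \<noteq> bot"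
    and T: "\<forall>\<^sub>F t in F. \<forall>h\<in>H. T t h \<in> H \<and> nrm (T t h) \<le> C * nrm h"
    and S: "\<And>h. h \<in> H \<Longrightarrow> S h \<in> H" "\<And>h. h \<in> H \<Longrightarrow> ((\<lambda>t. nrm (\<lambda>i. T t h i - S h i)) \<longlongrightarrow> 0) F"
    and "C \<ge> 0"
  shows "ultraweak_limit H ip T S F"
  unfolding ultraweak_limit_def
proof (intro allI impI, elim conjE)
  fix \<xi> \<eta> assume "square_summable H ip \<xi>" "square_summable H ip \<eta>"
  then have x: "\<And>n. \<xi> n \<in> H" "summable (\<lambda>n. (nrm (\<xi> n))\<^sup>2)"
    and y: "\<And>n. \<eta> n \<in> H" "summable (\<lambda>n. (nrm (\<eta> n))\<^sup>2)"
    by (auto simp: square_summable_def nrm_power2)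
  define M where "M n = C * ((nrm (\<xi> n))\<^sup>2 + (nrm (\<eta> n))\<^sup>2)" for n
  have "summable M" unfolding M_def by (intro summable_mult summable_add x y)
  have lim: "((\<lambda>t. ip (\<xi> n) (T t (\<eta> n))) \<longlongrightarrow> ip (\<xi> n) (S (\<eta> n))) F" for n
    using T by (intro tendsto_ip S x y) (auto elim!: eventually_mono simp: y)
  have "\<forall>\<^sub>F t in F. \<forall>n. cmod (ip (\<xi> n) (T t (\<eta> n))) \<le> M n"
    using T
  proof eventually_elim
    case (elim t)
    show ?case
    proof
      fix n
      have "cmod (ip (\<xi> n) (T t (\<eta> n))) \<le> nrm (\<xi> n) * nrm (T t (\<eta> n))"
        using elim x y by (intro cauchy_schwarz) auto
      also have "\<dots> \<le> nrm (\<xi> n) * (C * nrm (\<eta> n))"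
        using elim x y by (intro mult_left_mono) auto
      also have "\<dots> = C * (nrm (\<xi> n) * nrm (\<eta> n))" by simp
      also have "\<dots> \<le> M n"
        unfolding M_def
        using \<open>C \<ge> 0\<close> sum_squares_bound[of "nrm (\<xi> n)" "nrm (\<eta> n)"]
          mult_nonneg_nonneg[OF nrm_nonneg[OF x(1)[of n]] nrm_nonneg[OF y(1)[of n]]]
        by (intro mult_left_mono) linarith+
      finally show "cmod (ip (\<xi> n) (T t (\<eta> n))) \<le> M n" .
    qed
  qed
  then have "\<forall>\<^sub>F (n, t) in at_top \<times>\<^sub>F F. cmod (ip (\<xi> n) (T t (\<eta> n))) \<le> M n"
    unfolding eventually_prod_filter
    by (intro exI[of _ "\<lambda>_. True"] exI[of _ "\<lambda>t. \<forall>n. cmod (ip (\<xi> n) (T t (\<eta> n))) \<le> M n"]) auto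
  from tannerys_theorem[OF lim this \<open>summable M\<close> F]
  show "((\<lambda>t. \<Sum>n. ip (\<xi> n) (T t (\<eta> n))) \<longlongrightarrow> (\<Sum>n. ip (\<xi> n) (S (\<eta> n)))) F" by blast
qed

text \<open>In T t (R h) = R (T t h) the left side tends to S (R h), and the right side to R (S h)
  because R is bounded. Taking for M a commutant keeps strong limits inside a bicommutant.\<close>

lemma commutant_strong_limit:
  assumes F: "F \<noteq> bot" and T: "\<forall>\<^sub>F t in F. T t \<in> commutant H ip M"
    and M: "M \<subseteq> bounded_operators H ip"
    and S: "S \<in> bounded_operators H ip"
      "\<And>h. h \<in> H \<Longrightarrow> ((\<lambda>t. nrm (\<lambda>i. T t h i - S h i)) \<longlongrightarrow> 0) F"
  shows "S \<in> commutant H ip M"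
  unfolding commutant_def
proof (intro CollectI conjI ballI S)
  fix R h assume R: "R \<in> M" and h: "h \<in> H"
  have RH: "R k \<in> H" if "k \<in> H" for k using R M that by (auto simp: bounded_operators_def)
  have SH: "S k \<in> H" if "k \<in> H" for k using S that by (auto simp: bounded_operators_def)
  obtain C where C: "C \<ge> 0" "\<And>k. k \<in> H \<Longrightarrow> nrm (R k) \<le> C * nrm k"
    using R M bounded_operators_iff[OF semi_inner_axioms, of R] by blast
  have Rdiff: "R (\<lambda>i. k i - l i) = (\<lambda>i. R k i - R l i)" if kl: "k \<in> H" "l \<in> H" for k l
  proof -
    have "R \<in> bounded_operators H ip" using R M by blast
    then have "R (\<lambda>i. k i + (-1) * l i) = (\<lambda>i. R k i + R (\<lambda>i. (-1) * l i) i)"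
      and "R (\<lambda>i. (-1) * l i) = (\<lambda>i. (-1) * R l i)"
      using kl scale_mem[of l "-1"] unfolding bounded_operators_def by (fast, fast)
    then show ?thesis by simp
  qed
  have mem: "\<forall>\<^sub>F t in F. T t k \<in> H" if "k \<in> H" for k
    using T by eventually_elim (use that in \<open>auto simp: commutant_def bounded_operators_def\<close>)
  show "S (R h) = R (S h)"
  proof (rule strong_limit_unique[OF F])
    show "\<forall>\<^sub>F t in F. T t (R h) \<in> H" by (intro mem RH h)
    show "S (R h) \<in> H" "R (S h) \<in> H" using RH SH h by auto
    show "((\<lambda>t. nrm (\<lambda>i. T t (R h) i - S (R h) i)) \<longlongrightarrow> 0) F" by (intro S RH h)
    have lim: "((\<lambda>t. C * nrm (\<lambda>i. T t h i - S h i)) \<longlongrightarrow> 0) F"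
      using h by (intro tendsto_mult_right_zero S)
    show "((\<lambda>t. nrm (\<lambda>i. T t (R h) i - R (S h) i)) \<longlongrightarrow> 0) F"
    proof (rule Lim_null_comparison[OF _ lim])
      show "\<forall>\<^sub>F t in F. norm (nrm (\<lambda>i. T t (R h) i - R (S h) i)) \<le> C * nrm (\<lambda>i. T t h i - S h i)"
        using T mem[OF h]
      proof eventually_elim
        case (elim t)
        have d: "(\<lambda>i. T t h i - S h i) \<in> H" using elim SH h diff_mem by blast
        have "T t (R h) = R (T t h)" using elim R h by (auto simp: commutant_def)
        then have e: "(\<lambda>i. T t (R h) i - R (S h) i) = R (\<lambda>i. T t h i - S h i)"
          using Rdiff elim SH h by simp
        show ?case unfolding e using C(2)[OF d] nrm_nonneg[OF RH[OF d]] by simp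
      qed
    qed
  qed
qed

end

section \<open>The algebra \<open>C\<^sub>0(X) + \<complex>1\<close>\<close>

text \<open>Describes members of the unitalization by their scalar part c, seen as a limit at
  infinity. On a compact space every c qualifies, so c need not be unique. Unlike the decomposition
  into a \<open>C0\<close> function and a scalar, this form passes directly through continuous
  operations.\<close>

definition has_limit_at_infinity :: "'x topology \<Rightarrow> ('x \<Rightarrow> complex) \<Rightarrow> complex \<Rightarrow> bool" where
  "has_limit_at_infinity X f c \<longleftrightarrow> continuous_map X euclidean f \<and>
     (\<forall>e>0. \<exists>C. compactin X C \<and> (\<forall>x\<in>topspace X - C. cmod (f x - c) < e)) \<and>
     (\<forall>x. x \<notin> topspace X \<longrightarrow> f x = 0)"

lemma C0_iff: "f \<in> C0 X \<longleftrightarrow> has_limit_at_infinity X f 0"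
  by (simp add: C0_def has_limit_at_infinity_def)

text \<open>One closure principle that covers sums, products, conjugates and square roots. The
  condition \<open>\<Phi> 0 0 = 0\<close> preserves the convention that functions vanish off the
  space.\<close>

lemma has_limit_at_infinity_compose:
  assumes f: "has_limit_at_infinity X f c" and g: "has_limit_at_infinity X g d"
    and \<Phi>: "continuous_on UNIV (\<lambda>p. \<Phi> (fst p) (snd p))" "\<Phi> 0 0 = 0"
  shows "has_limit_at_infinity X (\<lambda>x. \<Phi> (f x) (g x)) (\<Phi> c d)"
  unfolding has_limit_at_infinity_def
proof (intro conjI allI impI)
  show "continuous_map X euclidean (\<lambda>x. \<Phi> (f x) (g x))"
    unfolding continuous_map_atin limitin_canonical_iff
  proof
    fix x assume "x \<in> topspace X"
    then have "(f \<longlongrightarrow> f x) (atin X x)" "(g \<longlongrightarrow> g x) (atin X x)"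
      using f g by (simp_all add: has_limit_at_infinity_def continuous_map_atin)
    then have "((\<lambda>x. (f x, g x)) \<longlongrightarrow> (f x, g x)) (atin X x)" by (rule tendsto_Pair)
    from continuous_on_tendsto_compose[OF \<Phi>(1) this]
    show "((\<lambda>x. \<Phi> (f x) (g x)) \<longlongrightarrow> \<Phi> (f x) (g x)) (atin X x)" by simp
  qed
  show "\<Phi> (f x) (g x) = 0" if "x \<notin> topspace X" for x
    using that f g \<Phi>(2) by (simp add: has_limit_at_infinity_def)
  fix e :: real assume "e > 0"
  moreover have "isCont (\<lambda>p. \<Phi> (fst p) (snd p)) (c, d)"
    using \<Phi>(1) by (simp add: continuous_on_eq_continuous_at)
  ultimately obtain r where r: "r > 0"
    "\<And>p. dist p (c, d) < r \<Longrightarrow> dist (\<Phi> (fst p) (snd p)) (\<Phi> c d) < e"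
    unfolding continuous_at_eps_delta by (metis fst_conv snd_conv)
  obtain C where C: "compactin X C" "\<forall>x\<in>topspace X - C. cmod (f x - c) < r/2"
    using f r(1) unfolding has_limit_at_infinity_def by (meson half_gt_zero)
  obtain D where D: "compactin X D" "\<forall>x\<in>topspace X - D. cmod (g x - d) < r/2"
    using g r(1) unfolding has_limit_at_infinity_def by (meson half_gt_zero)
  show "\<exists>C. compactin X C \<and> (\<forall>x\<in>topspace X - C. cmod (\<Phi> (f x) (g x) - \<Phi> c d) < e)"
  proof (intro exI[of _ "C \<union> D"] conjI ballI)
    show "compactin X (C \<union> D)" using C D by (simp add: compactin_Un)
    fix x assume x: "x \<in> topspace X - (C \<union> D)"
    have "dist (f x, g x) (c, d) \<le> dist (f x) c + dist (g x) d"
      unfolding dist_Pair_Pair by (rule sqrt_sum_squares_le_sum) auto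
    also have "\<dots> < r"
      using C(2) D(2) x by (simp add: dist_norm) (smt (verit) DiffI field_sum_of_halves)
    finally show "cmod (\<Phi> (f x) (g x) - \<Phi> c d) < e"
      using r(2)[of "(f x, g x)"] by (simp add: dist_norm)
  qed
qed

lemma has_limit_at_infinity_indicator:
  "has_limit_at_infinity X (indicator (topspace X)) 1"
proof -
  have "continuous_map X euclidean (indicator (topspace X) :: _ \<Rightarrow> complex)"
    by (rule continuous_map_eq[of X _ "\<lambda>x. 1"]) auto
  then show ?thesis
    unfolding has_limit_at_infinity_def by (auto intro!: exI[of _ "{}"])
qed

lemma has_limit_at_infinity_0: "has_limit_at_infinity X (\<lambda>x. 0) 0"
  unfolding has_limit_at_infinity_def by (auto intro!: exI[of _ "{}"])

lemma C0_unitalization_simps [simp]: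
  "f \<otimes>\<^bsub>C0_unitalization X\<^esub> g = (\<lambda>x. f x * g x)"
  "\<one>\<^bsub>C0_unitalization X\<^esub> = indicator (topspace X)"
  "\<zero>\<^bsub>C0_unitalization X\<^esub> = (\<lambda>x. 0)"
  "f \<oplus>\<^bsub>C0_unitalization X\<^esub> g = (\<lambda>x. f x + g x)"
  "cscale (C0_unitalization X) c f = (\<lambda>x. c * f x)"
  "star (C0_unitalization X) f = (\<lambda>x. cnj (f x))"
  by (simp_all add: C0_unitalization_def)

lemma carrier_C0_unitalization_iff:
  "f \<in> carrier (C0_unitalization X) \<longleftrightarrow> (\<exists>c. has_limit_at_infinity X f c)"
proof
  assume "f \<in> carrier (C0_unitalization X)"
  then obtain g c where g: "has_limit_at_infinity X g 0"
    and f: "f = (\<lambda>x. g x + c * indicator (topspace X) x)"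
    by (auto simp: C0_unitalization_def C0_iff)
  have "has_limit_at_infinity X f (0 + c * 1)"
    unfolding f by (rule has_limit_at_infinity_compose[OF g has_limit_at_infinity_indicator,
          of "\<lambda>z w. z + c * w"]) (auto intro!: continuous_intros)
  then show "\<exists>c. has_limit_at_infinity X f c" by blast
next
  assume "\<exists>c. has_limit_at_infinity X f c"
  then obtain c where f: "has_limit_at_infinity X f c" by blast
  have "has_limit_at_infinity X (\<lambda>x. f x - c * indicator (topspace X) x) (c - c * 1)"
    by (rule has_limit_at_infinity_compose[OF f has_limit_at_infinity_indicator,
          of "\<lambda>z w. z - c * w"]) (auto intro!: continuous_intros)
  then show "f \<in> carrier (C0_unitalization X)"
    unfolding C0_unitalization_def
    by (auto simp: C0_iff intro!: bexI[of _ "\<lambda>x. f x - c * indicator (topspace X) x"] exI[of _ c])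
qed

lemma carrier_C0_unitalization_compose:
  assumes "f \<in> carrier (C0_unitalization X)" "g \<in> carrier (C0_unitalization X)"
    and "continuous_on UNIV (\<lambda>p. \<Phi> (fst p) (snd p))" "\<Phi> 0 0 = 0"
  shows "(\<lambda>x. \<Phi> (f x) (g x)) \<in> carrier (C0_unitalization X)"
  using assms has_limit_at_infinity_compose unfolding carrier_C0_unitalization_iff by blast

lemma C0_subset_carrier: "f \<in> C0 X \<Longrightarrow> f \<in> carrier (C0_unitalization X)"
  by (auto simp: C0_iff carrier_C0_unitalization_iff)

text \<open>The square root is what later turns pointwise nonnegativity into positivity. Real
  \<open>sqrt\<close> is continuous on the whole line, negative arguments included, so the
  composition principle applies to it.\<close>

lemma
  assumes f: "f \<in> carrier (C0_unitalization X)"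
  shows carrier_scale: "(\<lambda>x. c * f x) \<in> carrier (C0_unitalization X)"
    and carrier_cnj: "(\<lambda>x. cnj (f x)) \<in> carrier (C0_unitalization X)"
    and carrier_sqrt: "(\<lambda>x. complex_of_real (sqrt (Re (f x)))) \<in> carrier (C0_unitalization X)"
proof -
  note * = carrier_C0_unitalization_compose[OF f f]
  show "(\<lambda>x. c * f x) \<in> carrier (C0_unitalization X)"
    by (rule *[of "\<lambda>z w. c * z"]) (auto intro!: continuous_intros)
  show "(\<lambda>x. cnj (f x)) \<in> carrier (C0_unitalization X)"
    by (rule *[of "\<lambda>z w. cnj z"]) (auto intro!: continuous_intros)
  show "(\<lambda>x. complex_of_real (sqrt (Re (f x)))) \<in> carrier (C0_unitalization X)"
    by (rule *[of "\<lambda>z w. complex_of_real (sqrt (Re z))"]) (auto intro!: continuous_intros)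
qed

lemma
  assumes f: "f \<in> carrier (C0_unitalization X)" and g: "g \<in> carrier (C0_unitalization X)"
  shows carrier_add: "(\<lambda>x. f x + g x) \<in> carrier (C0_unitalization X)"
    and carrier_diff: "(\<lambda>x. f x - g x) \<in> carrier (C0_unitalization X)"
    and carrier_mult: "(\<lambda>x. f x * g x) \<in> carrier (C0_unitalization X)"
proof -
  note * = carrier_C0_unitalization_compose[OF f g]
  show "(\<lambda>x. f x + g x) \<in> carrier (C0_unitalization X)"
    by (rule *) (auto intro!: continuous_intros)
  show "(\<lambda>x. f x - g x) \<in> carrier (C0_unitalization X)"
    by (rule *) (auto intro!: continuous_intros)
  show "(\<lambda>x. f x * g x) \<in> carrier (C0_unitalization X)"
    by (rule *) (auto intro!: continuous_intros)
qed

lemmas carrier_closed = carrier_scale carrier_cnj carrier_add carrier_diff carrier_mult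

lemma indicator_mem_carrier: "indicator (topspace X) \<in> carrier (C0_unitalization X)"
  and zero_mem_carrier: "(\<lambda>x. 0) \<in> carrier (C0_unitalization X)"
  using has_limit_at_infinity_indicator has_limit_at_infinity_0
  unfolding carrier_C0_unitalization_iff by blast+

lemma carrier_C0_unitalization_outside:
  "f \<in> carrier (C0_unitalization X) \<Longrightarrow> x \<notin> topspace X \<Longrightarrow> f x = 0"
  by (auto simp: carrier_C0_unitalization_iff has_limit_at_infinity_def)

text \<open>f is bounded on a compact set by continuity, and off it stays within 1 of its limit. The
  bound serves as the operator bound of multiplication by f.\<close>

lemma carrier_C0_unitalization_bounded:
  assumes "f \<in> carrier (C0_unitalization X)"
  shows "\<exists>M\<ge>0. \<forall>x. cmod (f x) \<le> M"
proof -
  obtain c where f: "continuous_map X euclidean f" "\<forall>x. x \<notin> topspace X \<longrightarrow> f x = 0"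
    and "\<forall>e>0. \<exists>C. compactin X C \<and> (\<forall>x\<in>topspace X - C. cmod (f x - c) < e)"
    using assms unfolding carrier_C0_unitalization_iff has_limit_at_infinity_def by blast
  then obtain C where C: "compactin X C" "\<forall>x\<in>topspace X - C. cmod (f x - c) < 1"
    by (meson zero_less_one)
  have "compact (f ` C)" using image_compactin[OF C(1) f(1)] by simp
  then obtain B where B: "B > 0" "\<And>x. x \<in> C \<Longrightarrow> cmod (f x) \<le> B"
    using compact_imp_bounded bounded_pos by (metis imageI)
  have "cmod (f x) \<le> B + cmod c + 1" for x
  proof -
    consider "x \<in> C" | "x \<in> topspace X - C" | "x \<notin> topspace X" by blast
    then show ?thesis
    proof cases
      case 1 then show ?thesis using B(2)[of x] norm_ge_zero[of c] by linarith
    next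
      case 2
      then show ?thesis using C(2) B(1) norm_triangle_ineq2[of "f x" c] by force
    next
      case 3
      then show ?thesis using f(2) B(1) by simp
    qed
  qed
  then show ?thesis using B(1) by (intro exI[of _ "B + cmod c + 1"]) auto
qed

lemma abelian_group_C0_unitalization: "abelian_group (C0_unitalization X)"
proof (rule abelian_groupI)
  fix f assume f: "f \<in> carrier (C0_unitalization X)"
  then have "(\<lambda>x. (-1) * f x) \<in> carrier (C0_unitalization X)"
    by (rule carrier_scale)
  then show "\<exists>g\<in>carrier (C0_unitalization X). g \<oplus>\<^bsub>C0_unitalization X\<^esub> f = \<zero>\<^bsub>C0_unitalization X\<^esub>"
    by (intro bexI) auto
qed (auto simp: zero_mem_carrier carrier_closed add.assoc add.commute)

lemma a_minus_C0_unitalization: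
  assumes f: "f \<in> carrier (C0_unitalization X)" and g: "g \<in> carrier (C0_unitalization X)"
  shows "f \<ominus>\<^bsub>C0_unitalization X\<^esub> g = (\<lambda>x. f x - g x)"
proof -
  interpret abelian_group "C0_unitalization X" by (rule abelian_group_C0_unitalization)
  have "(\<lambda>x. (-1) * g x) \<in> carrier (C0_unitalization X)"
    by (rule carrier_scale[OF g])
  then have "\<ominus>\<^bsub>C0_unitalization X\<^esub> g = (\<lambda>x. (-1) * g x)"
    using g by (intro minus_equality) auto
  then show ?thesis by (simp add: a_minus_def)
qed

lemma finsum_C0_unitalization:
  assumes "finite F" "\<And>j. j \<in> F \<Longrightarrow> f j \<in> carrier (C0_unitalization X)"
  shows "finsum (C0_unitalization X) f F = (\<lambda>x. \<Sum>j\<in>F. f j x)"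
    "(\<lambda>x. \<Sum>j\<in>F. f j x) \<in> carrier (C0_unitalization X)"
proof -
  interpret abelian_group "C0_unitalization X" by (rule abelian_group_C0_unitalization)
  have "finsum (C0_unitalization X) f F = (\<lambda>x. \<Sum>j\<in>F. f j x) \<and>
    (\<lambda>x. \<Sum>j\<in>F. f j x) \<in> carrier (C0_unitalization X)"
    using assms
  proof (induction F rule: finite_induct)
    case empty then show ?case by (simp add: zero_mem_carrier)
  next
    case (insert j F)
    then show ?case
      by (auto simp: finsum_insert Pi_def intro!: carrier_add)
  qed
  then show "finsum (C0_unitalization X) f F = (\<lambda>x. \<Sum>j\<in>F. f j x)"
    "(\<lambda>x. \<Sum>j\<in>F. f j x) \<in> carrier (C0_unitalization X)" by auto
qed

section \<open>The GNS space of a state\<close>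

locale C0_algebra =
  fixes X :: "'x topology"
begin

abbreviation A where "A \<equiv> C0_unitalization X"

end

locale C0_state = C0_algebra X
  for X :: "'x topology" +
  fixes \<phi> :: "('x \<Rightarrow> complex) \<Rightarrow> complex"
  assumes state: "\<phi> \<in> states (C0_unitalization X)"
begin

lemma state_add: "a \<in> carrier A \<Longrightarrow> b \<in> carrier A \<Longrightarrow> \<phi> (\<lambda>x. a x + b x) = \<phi> a + \<phi> b"
  and state_scale: "a \<in> carrier A \<Longrightarrow> \<phi> (\<lambda>x. c * a x) = c * \<phi> a"
  and state_square: "a \<in> carrier A \<Longrightarrow> \<phi> (\<lambda>x. cnj (a x) * a x) \<in> \<real>\<^sub>\<ge>\<^sub>0"
  using state by (auto simp: states_def)

text \<open>States are required to be nonnegative only on elements of the form star a times a; the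
  pointwise square root brings every nonnegative function into that form.\<close>

lemma state_pos:
  assumes a: "a \<in> carrier A" and pos: "\<And>x. a x \<in> \<real>\<^sub>\<ge>\<^sub>0"
  shows "\<phi> a \<in> \<real>\<^sub>\<ge>\<^sub>0"
proof -
  have "(\<lambda>x. cnj (complex_of_real (sqrt (Re (a x)))) * complex_of_real (sqrt (Re (a x)))) = a"
    using pos by (auto simp: complex_nonneg_Reals_iff complex_eq_iff)
  then show ?thesis
    using state_square[OF carrier_sqrt[OF a]] by simp
qed

abbreviation pip where "pip a b \<equiv> \<phi> (\<lambda>x. cnj (a x) * b x)"

lemma prod_mem: "a \<in> carrier A \<Longrightarrow> b \<in> carrier A \<Longrightarrow> (\<lambda>x. cnj (a x) * b x) \<in> carrier A"
  by (intro carrier_closed)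

text \<open>The algebra before completion, with the form of the state. Hermitian symmetry is not
  part of the definition of a state and has to be derived from positivity.\<close>

sublocale pre: semi_inner "carrier A" "\<lambda>a b. \<phi> (\<lambda>x. cnj (a x) * b x)"
proof
  fix a b c assume a: "a \<in> carrier A" and b: "b \<in> carrier A"
  show "(\<lambda>x. a x + b x) \<in> carrier A" by (rule carrier_add[OF a b])
  show "(\<lambda>x. z * a x) \<in> carrier A" for z by (rule carrier_scale[OF a])
  show "0 \<le> Re (pip a a)" using state_square[OF a] by (simp add: complex_nonneg_Reals_iff)
  show scale: "pip a (\<lambda>x. z * b x) = z * pip a b" for z
    using state_scale[OF prod_mem[OF a b]] by (simp add: algebra_simps)
  have add: "pip a (\<lambda>x. b x + c x) = pip a b + pip a c"
    if "a \<in> carrier A" "b \<in> carrier A" "c \<in> carrier A" for a b c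
    using state_add[OF prod_mem[OF that(1,2)] prod_mem[OF that(1,3)]] by (simp add: algebra_simps)
  show "c \<in> carrier A \<Longrightarrow> pip a (\<lambda>x. b x + c x) = pip a b + pip a c" by (rule add[OF a b])
  have real: "Im (pip a a) = 0" if "a \<in> carrier A" for a
    using state_square[OF that] by (simp add: complex_nonneg_Reals_iff)
  \<comment> \<open>Polarization: the form is real at a + w b, at a and at w b, so the mixed terms
    have imaginary part 0. The choices w = 1 and w = \<i> give the imaginary and the real part of
    the symmetry.\<close>
  have polar: "Im (w * pip a b + cnj w * pip b a) = 0" for w
  proof -
    define b' where "b' = (\<lambda>x. w * b x)"
    have b': "b' \<in> carrier A" unfolding b'_def by (rule carrier_scale[OF b])
    have m: "(\<lambda>x. a x + b' x) \<in> carrier A" by (rule carrier_add[OF a b'])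
    have e: "(\<lambda>x. cnj (a x + b' x) * (a x + b' x))
      = (\<lambda>x. (cnj (a x) * a x + cnj (b' x) * b' x) + (w * (cnj (a x) * b x) + cnj w * (cnj (b x) * a x)))"
      by (simp add: b'_def fun_eq_iff algebra_simps)
    have "\<phi> (\<lambda>x. cnj (a x + b' x) * (a x + b' x))
      = (pip a a + pip b' b') + (w * pip a b + cnj w * pip b a)"
    proof -
      have m1: "(\<lambda>x. w * (cnj (a x) * b x)) \<in> carrier A" and m2: "(\<lambda>x. cnj w * (cnj (b x) * a x)) \<in> carrier A"
        by (intro carrier_scale prod_mem a b)+
      show ?thesis
        unfolding e
          state_add[OF carrier_add[OF prod_mem[OF a a] prod_mem[OF b' b']]
            carrier_add[OF m1 m2]]
          state_add[OF prod_mem[OF a a] prod_mem[OF b' b']] state_add[OF m1 m2]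
          state_scale[OF prod_mem[OF a b]] state_scale[OF prod_mem[OF b a]] ..
    qed
    then show ?thesis using real[OF m] real[OF a] real[OF b'] by simp
  qed
  show "pip b a = cnj (pip a b)"
    using polar[of 1] polar[of \<i>] by (simp add: complex_eq_iff)
qed (rule zero_mem_carrier)

lemma gns_Cauchy_iff: "gns_Cauchy A \<phi> a \<longleftrightarrow> pre.ncauchy a"
proof -
  have "(\<forall>e>0. \<exists>M. \<forall>m\<ge>M. \<forall>n\<ge>M. cmod (pip (\<lambda>x. a m x - a n x) (\<lambda>x. a m x - a n x)) < e) \<longleftrightarrow>
      (\<forall>e>0. \<exists>M. \<forall>m\<ge>M. \<forall>n\<ge>M. pre.nrm (\<lambda>x. a m x - a n x) < e)"
    if a: "\<And>n. a n \<in> carrier A"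
  proof -
    have m: "(\<lambda>x. a m x - a n x) \<in> carrier A" for m n by (rule pre.diff_mem[OF a a])
    have e: "cmod (pip (\<lambda>x. a m x - a n x) (\<lambda>x. a m x - a n x)) = (pre.nrm (\<lambda>x. a m x - a n x))\<^sup>2" for m n
      unfolding pre.ip_self[OF m] by (simp add: norm_power)
    have less: "y\<^sup>2 < e\<^sup>2 \<longleftrightarrow> y < e" if "0 \<le> y" "0 < e" for y e :: real
      using that by (auto intro: power_strict_mono power2_less_imp_less)
    show ?thesis
      unfolding e
    proof safe
      fix r :: real assume *: "\<forall>e>0. \<exists>M. \<forall>m\<ge>M. \<forall>n\<ge>M. (pre.nrm (\<lambda>x. a m x - a n x))\<^sup>2 < e" and r: "r > 0"
      then have "\<exists>M. \<forall>m\<ge>M. \<forall>n\<ge>M. (pre.nrm (\<lambda>x. a m x - a n x))\<^sup>2 < r\<^sup>2" by simp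
      then show "\<exists>M. \<forall>m\<ge>M. \<forall>n\<ge>M. pre.nrm (\<lambda>x. a m x - a n x) < r"
        by (simp add: less[OF pre.nrm_nonneg[OF m] r])
    next
      fix r :: real assume *: "\<forall>e>0. \<exists>M. \<forall>m\<ge>M. \<forall>n\<ge>M. pre.nrm (\<lambda>x. a m x - a n x) < e" and r: "r > 0"
      have r': "sqrt r > 0" using r by simp
      then have "\<exists>M. \<forall>m\<ge>M. \<forall>n\<ge>M. pre.nrm (\<lambda>x. a m x - a n x) < sqrt r" using * by blast
      then show "\<exists>M. \<forall>m\<ge>M. \<forall>n\<ge>M. (pre.nrm (\<lambda>x. a m x - a n x))\<^sup>2 < r"
        using less[OF pre.nrm_nonneg[OF m] r'] r by simp
    qed
  qed
  then show ?thesis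
    unfolding gns_Cauchy_def pre.ncauchy_def
    by (simp add: a_minus_C0_unitalization cong: conj_cong)
qed

section \<open>Functions representing the vectors of the GNS space\<close>

abbreviation gv where "gv \<equiv> gns_vector A \<phi>"
abbreviation gip where "gip \<equiv> gns_inner A \<phi>"

lemma gns_space_iff: "h \<in> gns_space A \<phi> \<longleftrightarrow> (\<exists>a. pre.ncauchy a \<and> h = gv a)"
  by (auto simp: gns_space_def gns_Cauchy_iff)

lemma gv_outside: "b \<notin> carrier A \<Longrightarrow> gv a b = 0"
  by (simp add: gns_vector_def)

lemma gv_tendsto:
  assumes "pre.ncauchy a" "b \<in> carrier A"
  shows "(\<lambda>n. pip b (a n)) \<longlonglongrightarrow> gv a b"
  using pre.ncauchy_convergent_ip[OF pre.ncauchy_const[OF assms(2)] assms(1)] assms(2)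
  by (simp add: gns_vector_def convergent_LIMSEQ_iff)

lemma gv_eqI:
  assumes "pre.ncauchy a" "\<And>b. b \<in> carrier A \<Longrightarrow> (\<lambda>n. pip b (a n)) \<longlonglongrightarrow> h b"
    "\<And>b. b \<notin> carrier A \<Longrightarrow> h b = 0"
  shows "gv a = h"
proof
  fix b show "gv a b = h b"
    using LIMSEQ_unique[OF gv_tendsto[OF assms(1)] assms(2)] assms(3) gv_outside
    by (cases "b \<in> carrier A") auto
qed

lemma gv_add:
  assumes a: "pre.ncauchy a" and b: "pre.ncauchy b"
  shows "gv (\<lambda>n x. a n x + b n x) = (\<lambda>c. gv a c + gv b c)"
proof (rule gv_eqI[OF pre.ncauchy_add[OF a b]])
  fix c assume c: "c \<in> carrier A"
  show "(\<lambda>n. pip c (\<lambda>x. a n x + b n x)) \<longlonglongrightarrow> gv a c + gv b c"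
    using tendsto_add[OF gv_tendsto[OF a c] gv_tendsto[OF b c]]
    by (simp only: pre.ip_add[OF c pre.ncauchy_mem[OF a] pre.ncauchy_mem[OF b]])
qed (simp add: gv_outside)

lemma gv_scale:
  assumes a: "pre.ncauchy a"
  shows "gv (\<lambda>n x. z * a n x) = (\<lambda>c. z * gv a c)"
proof (rule gv_eqI[OF pre.ncauchy_scale[OF a]])
  fix c assume c: "c \<in> carrier A"
  show "(\<lambda>n. pip c (\<lambda>x. z * a n x)) \<longlonglongrightarrow> z * gv a c"
    using tendsto_mult_left[OF gv_tendsto[OF a c], of z]
    by (simp only: pre.ip_scale[OF c pre.ncauchy_mem[OF a]])
qed (simp add: gv_outside)

lemma gv_diff:
  assumes a: "pre.ncauchy a" and b: "pre.ncauchy b"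
  shows "gv (\<lambda>n x. a n x - b n x) = (\<lambda>c. gv a c - gv b c)"
  using gv_add[OF a pre.ncauchy_scale[OF b, of "-1"]] gv_scale[OF b, of "-1"] by simp

text \<open>The representing function records only pairings with the algebra, that is, weak
  information; for Cauchy sequences \<open>ncauchy_weak_null\<close> upgrades weak to norm
  convergence. Hence equality of representing functions is exactly equivalence of Cauchy
  sequences.\<close>

lemma gv_null:
  assumes a: "pre.ncauchy a"
  shows "gv a = (\<lambda>c. 0) \<longleftrightarrow> (\<lambda>n. pre.nrm (a n)) \<longlonglongrightarrow> 0"
proof
  assume *: "gv a = (\<lambda>c. 0)"
  show "(\<lambda>n. pre.nrm (a n)) \<longlonglongrightarrow> 0"
    by (rule pre.ncauchy_weak_null[OF a]) (use gv_tendsto[OF a] * in simp)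
next
  assume lim: "(\<lambda>n. pre.nrm (a n)) \<longlonglongrightarrow> 0"
  show "gv a = (\<lambda>c. 0)"
  proof (rule gv_eqI[OF a])
    fix c assume c: "c \<in> carrier A"
    show "(\<lambda>n. pip c (a n)) \<longlonglongrightarrow> 0"
      by (rule Lim_null_comparison[OF always_eventually[OF allI]
            tendsto_mult_right_zero[OF lim, of "pre.nrm c"]])
        (rule pre.cauchy_schwarz[OF c pre.ncauchy_mem[OF a]])
  qed simp
qed

lemma gv_eq_iff:
  assumes "pre.ncauchy a" "pre.ncauchy b"
  shows "gv a = gv b \<longleftrightarrow> (\<lambda>n. pre.nrm (\<lambda>x. a n x - b n x)) \<longlonglongrightarrow> 0"
  using gv_null[OF pre.ncauchy_diff[OF assms]] gv_diff[OF assms] by (simp add: fun_eq_iff)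

text \<open>Justifies the definite description in \<open>gns_inner\<close>: the limit exists by the
  Cauchy property and is the same for all representatives by \<open>ip_seq_equiv\<close>.\<close>

lemma gip_tendsto:
  assumes a: "pre.ncauchy a" and b: "pre.ncauchy b"
  shows "(\<lambda>n. pip (a n) (b n)) \<longlonglongrightarrow> gip (gv a) (gv b)"
proof -
  obtain z where z: "(\<lambda>n. pip (a n) (b n)) \<longlonglongrightarrow> z"
    using pre.ncauchy_convergent_ip[OF a b] by (auto simp: convergent_def)
  have "gip (gv a) (gv b) = z"
    unfolding gns_inner_def
  proof (rule the_equality)
    show "\<exists>a' b'. gns_Cauchy A \<phi> a' \<and> gns_Cauchy A \<phi> b' \<and> gv a = gv a' \<and> gv b = gv b' \<and>
        (\<lambda>n. \<phi> (star A (a' n) \<otimes>\<^bsub>A\<^esub> b' n)) \<longlonglongrightarrow> z"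
      using a b z by (auto simp: gns_Cauchy_iff)
    fix z' assume "\<exists>a' b'. gns_Cauchy A \<phi> a' \<and> gns_Cauchy A \<phi> b' \<and> gv a = gv a' \<and> gv b = gv b' \<and>
        (\<lambda>n. \<phi> (star A (a' n) \<otimes>\<^bsub>A\<^esub> b' n)) \<longlonglongrightarrow> z'"
    then obtain a' b' where a': "pre.ncauchy a'" and b': "pre.ncauchy b'"
      and e: "gv a' = gv a" "gv b' = gv b" and z': "(\<lambda>n. pip (a' n) (b' n)) \<longlonglongrightarrow> z'"
      by (auto simp: gns_Cauchy_iff)
    have "(\<lambda>n. pip (a' n) (b' n) - pip (a n) (b n)) \<longlonglongrightarrow> 0"
      using e by (intro pre.ip_seq_equiv a a' b b') (simp_all flip: gv_eq_iff add: a a' b b')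
    moreover have "(\<lambda>n. pip (a' n) (b' n) - pip (a n) (b n)) \<longlonglongrightarrow> z' - z"
      by (intro tendsto_diff z z')
    ultimately show "z' = z" using LIMSEQ_unique by fastforce
  qed
  then show ?thesis using z by simp
qed

text \<open>Each axiom is the limit of the corresponding identity or inequality along representing
  sequences in the algebra.\<close>

sublocale gns: semi_inner "gns_space A \<phi>" "gns_inner A \<phi>"
proof
  show "(\<lambda>c. 0) \<in> gns_space A \<phi>"
    using gv_scale[OF pre.ncauchy_const[OF zero_mem_carrier], of 0]
      pre.ncauchy_const[OF zero_mem_carrier] by (auto simp: gns_space_iff)
  fix h k l assume "h \<in> gns_space A \<phi>"
  then obtain a where a: "pre.ncauchy a" and h: "h = gv a" by (auto simp: gns_space_iff)
  show "(\<lambda>i. c * h i) \<in> gns_space A \<phi>" for c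
    using gv_scale[OF a, of c] pre.ncauchy_scale[OF a, of c] h by (auto simp: gns_space_iff)
  have "(\<lambda>n. Re (pip (a n) (a n))) \<longlonglongrightarrow> Re (gip h h)"
    unfolding h by (intro tendsto_Re gip_tendsto a)
  then show "0 \<le> Re (gip h h)"
    by (rule LIMSEQ_le_const) (use pre.ip_ge_0[OF pre.ncauchy_mem[OF a]] in auto)
  assume "k \<in> gns_space A \<phi>"
  then obtain b where b: "pre.ncauchy b" and k: "k = gv b" by (auto simp: gns_space_iff)
  show "(\<lambda>i. h i + k i) \<in> gns_space A \<phi>"
    using gv_add[OF a b] pre.ncauchy_add[OF a b] h k by (auto simp: gns_space_iff)
  show "gip k h = cnj (gip h k)"
  proof (rule LIMSEQ_unique)
    show "(\<lambda>n. pip (b n) (a n)) \<longlonglongrightarrow> gip k h" unfolding h k by (intro gip_tendsto a b)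
    show "(\<lambda>n. pip (b n) (a n)) \<longlonglongrightarrow> cnj (gip h k)"
      unfolding h k pre.ip_commute[OF pre.ncauchy_mem[OF a] pre.ncauchy_mem[OF b]]
      by (intro tendsto_cnj gip_tendsto a b)
  qed
  show "gip h (\<lambda>i. c * k i) = c * gip h k" for c
  proof (rule LIMSEQ_unique)
    show "(\<lambda>n. pip (a n) (\<lambda>x. c * b n x)) \<longlonglongrightarrow> gip h (\<lambda>i. c * k i)"
      unfolding h k gv_scale[OF b, symmetric] by (intro gip_tendsto pre.ncauchy_scale a b)
    show "(\<lambda>n. pip (a n) (\<lambda>x. c * b n x)) \<longlonglongrightarrow> c * gip h k"
      unfolding h k pre.ip_scale[OF pre.ncauchy_mem[OF a] pre.ncauchy_mem[OF b]]
      by (intro tendsto_mult_left gip_tendsto a b)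
  qed
  assume "l \<in> gns_space A \<phi>"
  then obtain c where c: "pre.ncauchy c" and l: "l = gv c" by (auto simp: gns_space_iff)
  show "gip h (\<lambda>i. k i + l i) = gip h k + gip h l"
  proof (rule LIMSEQ_unique)
    show "(\<lambda>n. pip (a n) (\<lambda>x. b n x + c n x)) \<longlonglongrightarrow> gip h (\<lambda>i. k i + l i)"
      unfolding h k l gv_add[OF b c, symmetric] by (intro gip_tendsto pre.ncauchy_add a b c)
    show "(\<lambda>n. pip (a n) (\<lambda>x. b n x + c n x)) \<longlonglongrightarrow> gip h k + gip h l"
      unfolding h k l
        pre.ip_add[OF pre.ncauchy_mem[OF a] pre.ncauchy_mem[OF b] pre.ncauchy_mem[OF c]]
      by (intro tendsto_add gip_tendsto a b c)
  qed
qed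

lemma gv_mem: "pre.ncauchy a \<Longrightarrow> gv a \<in> gns_space A \<phi>"
  by (auto simp: gns_space_iff)

lemma gns_nrm_tendsto:
  assumes a: "pre.ncauchy a"
  shows "(\<lambda>n. pre.nrm (a n)) \<longlonglongrightarrow> gns.nrm (gv a)"
  unfolding pre.nrm_def gns.nrm_def by (intro tendsto_real_sqrt tendsto_Re gip_tendsto a)

lemma gns_nrm_const: "c \<in> carrier A \<Longrightarrow> gns.nrm (gv (\<lambda>n. c)) = pre.nrm c"
  using LIMSEQ_unique[OF gns_nrm_tendsto[OF pre.ncauchy_const] tendsto_const] by blast

text \<open>Density of the algebra in its GNS space: the distance from the class of a to the
  constant a p is the limit over n of the seminorms of a n - a p.\<close>

lemma gv_approx:
  assumes a: "pre.ncauchy a"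
  shows "(\<lambda>m. gns.nrm (\<lambda>i. gv a i - gv (\<lambda>n. a m) i)) \<longlonglongrightarrow> 0"
proof (rule LIMSEQ_I)
  note m = pre.ncauchy_mem[OF a]
  fix r :: real assume r: "r > 0"
  obtain M where M: "\<forall>m\<ge>M. \<forall>n\<ge>M. pre.nrm (\<lambda>x. a m x - a n x) < r/2"
    using pre.ncauchyD[OF a, of "r/2"] r by auto
  show "\<exists>M. \<forall>p\<ge>M. norm (gns.nrm (\<lambda>i. gv a i - gv (\<lambda>n. a p) i) - 0) < r"
  proof (intro exI[of _ M] allI impI)
    fix p assume p: "M \<le> p"
    have d: "pre.ncauchy (\<lambda>n x. a n x - a p x)" by (intro pre.ncauchy_diff pre.ncauchy_const a m)
    have e: "gv (\<lambda>n x. a n x - a p x) = (\<lambda>i. gv a i - gv (\<lambda>n. a p) i)"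
      by (rule gv_diff[OF a pre.ncauchy_const[OF m]])
    have "gns.nrm (gv (\<lambda>n x. a n x - a p x)) \<le> r/2"
      by (rule LIMSEQ_le_const2[OF gns_nrm_tendsto[OF d]])
        (use M p in \<open>auto intro!: exI[of _ M] less_imp_le\<close>)
    then show "norm (gns.nrm (\<lambda>i. gv a i - gv (\<lambda>n. a p) i) - 0) < r"
      using r gns.nrm_nonneg[OF gv_mem[OF d]] unfolding e by simp
  qed
qed

text \<open>Completeness: approximate v n by an algebra element c n up to 1/(n+1). The algebra
  embeds isometrically, so c is itself a Cauchy sequence, and its class is the limit of v.\<close>

sublocale gns: hilbert_functions "gns_space A \<phi>" "gns_inner A \<phi>"
proof
  fix h assume "h \<in> gns_space A \<phi>" and z: "gip h h = 0"
  then obtain a where a: "pre.ncauchy a" and h: "h = gv a" by (auto simp: gns_space_iff)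
  show "h = (\<lambda>i. 0)"
    using gns_nrm_tendsto[OF a] z gv_null[OF a] unfolding h by (simp add: gns.nrm_def)
next
  fix v assume v: "gns.ncauchy v"
  note vm = gns.ncauchy_mem[OF v]
  have "\<exists>c\<in>carrier A. gns.nrm (\<lambda>i. v n i - gv (\<lambda>_. c) i) < inverse (real (Suc n))" for n
  proof -
    obtain a where a: "pre.ncauchy a" and h: "v n = gv a" using vm[of n] by (auto simp: gns_space_iff)
    obtain m where "norm (gns.nrm (\<lambda>i. gv a i - gv (\<lambda>n. a m) i) - 0) < inverse (real (Suc n))"
      using LIMSEQ_D[OF gv_approx[OF a], of "inverse (real (Suc n))"] by auto
    then show ?thesis
      using h by (intro bexI[OF _ pre.ncauchy_mem[OF a, of m]]) auto
  qed
  then have "\<forall>n. \<exists>c. c \<in> carrier A \<and> gns.nrm (\<lambda>i. v n i - gv (\<lambda>_. c) i) < inverse (real (Suc n))"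
    by blast
  from choice[OF this] obtain c where c: "\<And>n. c n \<in> carrier A"
    and vc: "\<And>n. gns.nrm (\<lambda>i. v n i - gv (\<lambda>_. c n) i) < inverse (real (Suc n))" by blast
  define w where "w n = gv (\<lambda>_. c n)" for n
  have wm: "w n \<in> gns_space A \<phi>" for n unfolding w_def by (intro gv_mem pre.ncauchy_const c)
  have vw: "(\<lambda>n. gns.nrm (\<lambda>i. v n i - w n i)) \<longlonglongrightarrow> 0"
    by (rule Lim_null_comparison[OF always_eventually[OF allI] LIMSEQ_inverse_real_of_nat])
      (use vc gns.nrm_nonneg[OF gns.diff_mem[OF vm wm]] in \<open>simp add: w_def less_imp_le\<close>)
  have cc: "pre.nrm (\<lambda>x. c m x - c n x) = gns.nrm (\<lambda>i. w m i - w n i)" for m n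
    using gns_nrm_const[OF pre.diff_mem[OF c c], of m n]
      gv_diff[OF pre.ncauchy_const[OF c] pre.ncauchy_const[OF c], of m n] by (simp add: w_def)
  have cC: "pre.ncauchy c"
    unfolding pre.ncauchy_def
  proof (intro conjI allI impI c)
    fix r :: real assume r: "r > 0"
    obtain M where M: "\<forall>m\<ge>M. \<forall>n\<ge>M. gns.nrm (\<lambda>i. v m i - v n i) < r/3"
      using gns.ncauchyD[OF v, of "r/3"] r by auto
    obtain N where N: "\<forall>n\<ge>N. norm (gns.nrm (\<lambda>i. v n i - w n i) - 0) < r/3"
      using LIMSEQ_D[OF vw, of "r/3"] r by auto
    show "\<exists>M. \<forall>m\<ge>M. \<forall>n\<ge>M. pre.nrm (\<lambda>x. c m x - c n x) < r"
    proof (intro exI[of _ "max M N"] allI impI)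
      fix p q assume pq: "max M N \<le> p" "max M N \<le> q"
      have "gns.nrm (\<lambda>i. w p i - w q i)
        \<le> gns.nrm (\<lambda>i. w p i - v p i) + (gns.nrm (\<lambda>i. v p i - v q i) + gns.nrm (\<lambda>i. v q i - w q i))"
        using gns.nrm_diff_triangle[OF wm vm wm, of p q p] gns.nrm_diff_triangle[OF vm vm wm, of p q q]
        by linarith
      then show "pre.nrm (\<lambda>x. c p x - c q x) < r"
        unfolding cc using M[rule_format, of p q] N[rule_format, of p] N[rule_format, of q] pq
          gns.nrm_minus_commute[OF wm vm, of p p] by simp
    qed
  qed
  show "\<exists>k\<in>gns_space A \<phi>. (\<lambda>n. gns.nrm (\<lambda>i. v n i - k i)) \<longlonglongrightarrow> 0"
  proof (intro bexI[OF _ gv_mem[OF cC]])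
    have "(\<lambda>n. gns.nrm (\<lambda>i. v n i - w n i) + gns.nrm (\<lambda>i. gv c i - w n i)) \<longlonglongrightarrow> 0 + 0"
      using gv_approx[OF cC] by (intro tendsto_add vw) (simp add: w_def)
    then have lim: "(\<lambda>n. gns.nrm (\<lambda>i. v n i - w n i) + gns.nrm (\<lambda>i. gv c i - w n i)) \<longlonglongrightarrow> 0" by simp
    show "(\<lambda>n. gns.nrm (\<lambda>i. v n i - gv c i)) \<longlonglongrightarrow> 0"
    proof (rule Lim_null_comparison[OF always_eventually[OF allI] lim])
      fix n
      show "norm (gns.nrm (\<lambda>i. v n i - gv c i))
        \<le> gns.nrm (\<lambda>i. v n i - w n i) + gns.nrm (\<lambda>i. gv c i - w n i)"
        using gns.nrm_diff_triangle[OF vm wm gv_mem[OF cC], of n n]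
          gns.nrm_minus_commute[OF wm gv_mem[OF cC], of n]
          gns.nrm_nonneg[OF gns.diff_mem[OF vm gv_mem[OF cC]], of n] by simp
    qed
  qed
qed

text \<open>Left multiplication by f, expressed on representing functions by moving the adjoint of f
  to the test element b. It is one component of \<open>universal_rep\<close>.\<close>

definition gact :: "('x \<Rightarrow> complex) \<Rightarrow> (('x \<Rightarrow> complex) \<Rightarrow> complex) \<Rightarrow> ('x \<Rightarrow> complex) \<Rightarrow> complex" where
  "gact f h = (\<lambda>b. if b \<in> carrier A then h (\<lambda>x. cnj (f x) * b x) else 0)"

text \<open>The function M^2 \<bar>a\<bar>^2 - \<bar>f a\<bar>^2 is nonnegative at every point, so
  the state is nonnegative on it.\<close>

lemma pre_nrm_mult_le:
  assumes f: "f \<in> carrier A" and M: "\<And>x. cmod (f x) \<le> M" and a: "a \<in> carrier A"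
  shows "pre.nrm (\<lambda>x. f x * a x) \<le> M * pre.nrm a"
proof -
  have "M \<ge> 0" using M[of undefined] norm_ge_zero order_trans by blast
  have fa: "(\<lambda>x. f x * a x) \<in> carrier A" by (intro carrier_closed f a)
  define c where "c = complex_of_real (M\<^sup>2)"
  define g where "g = (\<lambda>x. c * (cnj (a x) * a x) - cnj (f x * a x) * (f x * a x))"
  have g: "g \<in> carrier A" unfolding g_def by (intro carrier_diff carrier_scale prod_mem a fa)
  have "g x = complex_of_real ((M\<^sup>2 - (cmod (f x))\<^sup>2) * (cmod (a x))\<^sup>2)" for x
    by (simp add: g_def c_def complex_norm_square algebra_simps del: of_real_power)
  moreover have "(cmod (f x))\<^sup>2 \<le> M\<^sup>2" for x using M by (intro power_mono) auto
  ultimately have "g x \<in> \<real>\<^sub>\<ge>\<^sub>0" for x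
    by (simp del: of_real_power of_real_mult of_real_diff)
  from state_pos[OF g this] have "\<phi> g \<in> \<real>\<^sub>\<ge>\<^sub>0" .
  moreover have "\<phi> g = c * pip a a - pip (\<lambda>x. f x * a x) (\<lambda>x. f x * a x)"
    using state_add[OF g prod_mem[OF fa fa]] state_scale[OF prod_mem[OF a a], of c]
    by (simp add: g_def algebra_simps)
  ultimately have "(pre.nrm (\<lambda>x. f x * a x))\<^sup>2 \<le> (M * pre.nrm a)\<^sup>2"
    unfolding pre.ip_self[OF a] pre.ip_self[OF fa] c_def
    by (simp add: complex_nonneg_Reals_iff power_mult_distrib flip: of_real_power)
  then show ?thesis by (rule power2_le_imp_le) (use \<open>M \<ge> 0\<close> a in auto)
qed

lemma ncauchy_mult:
  assumes f: "f \<in> carrier A" and a: "pre.ncauchy a"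
  shows "pre.ncauchy (\<lambda>n x. f x * a n x)"
  unfolding pre.ncauchy_def
proof (intro conjI allI impI)
  note m = pre.ncauchy_mem[OF a]
  show "(\<lambda>x. f x * a n x) \<in> carrier A" for n by (intro carrier_mult f m)
  obtain M where M: "M \<ge> 0" "\<And>x. cmod (f x) \<le> M" using carrier_C0_unitalization_bounded[OF f] by blast
  fix r :: real assume r: "r > 0"
  obtain N where N: "\<forall>m\<ge>N. \<forall>n\<ge>N. pre.nrm (\<lambda>x. a m x - a n x) < r / (M + 1)"
    using pre.ncauchyD[OF a, of "r / (M+1)"] r M by auto
  have "pre.nrm (\<lambda>x. f x * a p x - f x * a q x) < r" if "N \<le> p" "N \<le> q" for p q
  proof -
    have d: "(\<lambda>x. a p x - a q x) \<in> carrier A" by (intro carrier_diff m)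
    have "pre.nrm (\<lambda>x. f x * (a p x - a q x)) \<le> M * pre.nrm (\<lambda>x. a p x - a q x)"
      by (rule pre_nrm_mult_le[OF f M(2) d])
    also have "\<dots> \<le> (M + 1) * pre.nrm (\<lambda>x. a p x - a q x)"
      using pre.nrm_nonneg[OF d] by (intro mult_right_mono) auto
    also have "\<dots> < r" using N[rule_format, OF that] M(1) by (simp add: pos_less_divide_eq mult.commute)
    finally show ?thesis by (simp add: right_diff_distrib)
  qed
  then show "\<exists>M. \<forall>m\<ge>M. \<forall>n\<ge>M. pre.nrm (\<lambda>x. f x * a m x - f x * a n x) < r" by blast
qed

text \<open>Reduces the action to multiplication of representing sequences, from which its algebraic
  properties and its norm bound pass to the limit.\<close>

lemma gact_gv:
  assumes f: "f \<in> carrier A" and a: "pre.ncauchy a"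
  shows "gact f (gv a) = gv (\<lambda>n x. f x * a n x)"
proof (rule sym, rule gv_eqI[OF ncauchy_mult[OF f a]])
  fix b assume b: "b \<in> carrier A"
  have "(\<lambda>x. cnj (f x) * b x) \<in> carrier A" by (rule prod_mem[OF f b])
  from gv_tendsto[OF a this] show "(\<lambda>n. pip b (\<lambda>x. f x * a n x)) \<longlonglongrightarrow> gact f (gv a) b"
    using b by (simp add: gact_def mult_ac)
qed (simp add: gact_def)

lemma gact_mem:
  assumes "f \<in> carrier A" "h \<in> gns_space A \<phi>"
  shows "gact f h \<in> gns_space A \<phi>"
proof -
  obtain a where a: "pre.ncauchy a" and h: "h = gv a" using assms(2) by (auto simp: gns_space_iff)
  show ?thesis unfolding h gact_gv[OF assms(1) a] by (intro gv_mem ncauchy_mult assms a)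
qed

lemma gact_nrm_le:
  assumes f: "f \<in> carrier A" and M: "\<And>x. cmod (f x) \<le> M" and h: "h \<in> gns_space A \<phi>"
  shows "gns.nrm (gact f h) \<le> M * gns.nrm h"
proof -
  obtain a where a: "pre.ncauchy a" and h: "h = gv a" using h by (auto simp: gns_space_iff)
  show ?thesis unfolding h gact_gv[OF f a]
    by (rule LIMSEQ_le[OF gns_nrm_tendsto[OF ncauchy_mult[OF f a]]
          tendsto_mult_left[OF gns_nrm_tendsto[OF a]]])
      (use pre_nrm_mult_le[OF f M pre.ncauchy_mem[OF a]] in auto)
qed

lemma gact_adjoint:
  assumes f: "f \<in> carrier A" and h: "h \<in> gns_space A \<phi>" and k: "k \<in> gns_space A \<phi>"
  shows "gip k (gact f h) = gip (gact (\<lambda>x. cnj (f x)) k) h"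
proof -
  obtain a where a: "pre.ncauchy a" and h: "h = gv a" using h by (auto simp: gns_space_iff)
  obtain b where b: "pre.ncauchy b" and k: "k = gv b" using k by (auto simp: gns_space_iff)
  have f': "(\<lambda>x. cnj (f x)) \<in> carrier A" by (rule carrier_cnj[OF f])
  have "(\<lambda>n. pip (b n) (\<lambda>x. f x * a n x)) \<longlonglongrightarrow> gip k (gact f h)"
    unfolding h k gact_gv[OF f a] by (intro gip_tendsto b ncauchy_mult f a)
  moreover have "(\<lambda>n. pip (\<lambda>x. cnj (f x) * b n x) (a n)) \<longlonglongrightarrow> gip (gact (\<lambda>x. cnj (f x)) k) h"
    unfolding h k gact_gv[OF f' b] by (intro gip_tendsto a ncauchy_mult f' b)
  ultimately show ?thesis by (intro LIMSEQ_unique) (auto simp: mult_ac)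
qed

lemma gact_add:
  assumes f: "f \<in> carrier A" and g: "g \<in> carrier A" and h: "h \<in> gns_space A \<phi>"
  shows "gact (\<lambda>x. f x + g x) h = (\<lambda>b. gact f h b + gact g h b)"
proof -
  obtain a where a: "pre.ncauchy a" and h: "h = gv a" using h by (auto simp: gns_space_iff)
  show ?thesis
    unfolding h gact_gv[OF f a] gact_gv[OF g a] gact_gv[OF carrier_add[OF f g] a]
      gv_add[OF ncauchy_mult[OF f a] ncauchy_mult[OF g a], symmetric]
    by (simp add: distrib_right)
qed

lemma gact_scale:
  assumes f: "f \<in> carrier A" and h: "h \<in> gns_space A \<phi>"
  shows "gact (\<lambda>x. c * f x) h = (\<lambda>b. c * gact f h b)"
proof -
  obtain a where a: "pre.ncauchy a" and h: "h = gv a" using h by (auto simp: gns_space_iff)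
  show ?thesis
    unfolding h gact_gv[OF f a] gact_gv[OF carrier_scale[OF f] a]
      gv_scale[OF ncauchy_mult[OF f a], symmetric]
    by (simp add: mult.assoc)
qed

end

section \<open>The universal representation\<close>

context C0_algebra
begin

abbreviation U where "U \<equiv> universal_space A"
abbreviation uip where "uip \<equiv> universal_inner A"
abbreviation rep where "rep \<equiv> universal_rep A"
abbreviation gnrm where "gnrm \<phi> \<equiv> semi_inner.nrm (gns_inner A \<phi>)"

lemma state_locale: "\<phi> \<in> states A \<Longrightarrow> C0_state X \<phi>"
  by (rule C0_state.intro)

lemma gns_hilbert: "\<phi> \<in> states A \<Longrightarrow> hilbert_functions (gns_space A \<phi>) (gns_inner A \<phi>)"
proof -
  assume "\<phi> \<in> states A"
  then interpret C0_state X \<phi> by (rule state_locale)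
  show ?thesis by (rule gns.hilbert_functions_axioms)
qed

lemma gns_semi: "\<phi> \<in> states A \<Longrightarrow> semi_inner (gns_space A \<phi>) (gns_inner A \<phi>)"
  using gns_hilbert hilbert_functions.axioms(1) by blast

section \<open>The Hilbert sum of the GNS spaces\<close>

lemma universal_space_iff:
  "h \<in> U \<longleftrightarrow> (\<forall>\<phi>\<in>states A. (\<lambda>b. h (\<phi>, b)) \<in> gns_space A \<phi>) \<and>
    (\<forall>\<phi> b. \<phi> \<notin> states A \<longrightarrow> h (\<phi>, b) = 0) \<and>
    (\<lambda>\<phi>. (gnrm \<phi> (\<lambda>b. h (\<phi>, b)))\<^sup>2) summable_on states A"
proof -
  have "(\<lambda>\<phi>. Re (gns_inner A \<phi> (\<lambda>b. h (\<phi>, b)) (\<lambda>b. h (\<phi>, b)))) summable_on states A \<longleftrightarrow>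
      (\<lambda>\<phi>. (gnrm \<phi> (\<lambda>b. h (\<phi>, b)))\<^sup>2) summable_on states A"
    if "\<forall>\<phi>\<in>states A. (\<lambda>b. h (\<phi>, b)) \<in> gns_space A \<phi>"
    using that by (intro summable_on_cong) (simp add: semi_inner.nrm_power2[OF gns_semi])
  then show ?thesis unfolding universal_space_def by blast
qed

lemma component_mem: "h \<in> U \<Longrightarrow> \<phi> \<in> states A \<Longrightarrow> (\<lambda>b. h (\<phi>, b)) \<in> gns_space A \<phi>"
  and component_outside: "h \<in> U \<Longrightarrow> \<phi> \<notin> states A \<Longrightarrow> h (\<phi>, b) = 0"
  and component_summable: "h \<in> U \<Longrightarrow> (\<lambda>\<phi>. (gnrm \<phi> (\<lambda>b. h (\<phi>, b)))\<^sup>2) summable_on states A"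
  by (auto simp: universal_space_iff)

text \<open>Cauchy-Schwarz in each component, followed by bounding the product of the two norms by
  the sum of their squares.\<close>

lemma universal_inner_summable:
  assumes h: "h \<in> U" and k: "k \<in> U"
  shows "(\<lambda>\<phi>. gns_inner A \<phi> (\<lambda>b. h (\<phi>, b)) (\<lambda>b. k (\<phi>, b))) summable_on states A"
proof (rule abs_summable_summable, rule summable_on_comparison_test)
  show "(\<lambda>\<phi>. (gnrm \<phi> (\<lambda>b. h (\<phi>, b)))\<^sup>2 + (gnrm \<phi> (\<lambda>b. k (\<phi>, b)))\<^sup>2) summable_on states A"
    by (intro summable_on_add component_summable h k)
  fix \<phi> assume s: "\<phi> \<in> states A"
  interpret C0_state X \<phi> by (rule state_locale[OF s])
  show "norm (gip (\<lambda>b. h (\<phi>, b)) (\<lambda>b. k (\<phi>, b))) \<le> (gns.nrm (\<lambda>b. h (\<phi>, b)))\<^sup>2 + (gns.nrm (\<lambda>b. k (\<phi>, b)))\<^sup>2"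
    using gns.cauchy_schwarz[OF component_mem[OF h s] component_mem[OF k s]]
      sum_squares_bound[of "gns.nrm (\<lambda>b. h (\<phi>, b))" "gns.nrm (\<lambda>b. k (\<phi>, b))"]
      mult_nonneg_nonneg[OF gns.nrm_nonneg[OF component_mem[OF h s]] gns.nrm_nonneg[OF component_mem[OF k s]]]
    by linarith
qed simp

lemma universal_self:
  assumes h: "h \<in> U"
  shows "uip h h = complex_of_real (\<Sum>\<^sub>\<infinity>\<phi>\<in>states A. (gnrm \<phi> (\<lambda>b. h (\<phi>, b)))\<^sup>2)"
proof -
  have "uip h h = (\<Sum>\<^sub>\<infinity>\<phi>\<in>states A. complex_of_real ((gnrm \<phi> (\<lambda>b. h (\<phi>, b)))\<^sup>2))"
    unfolding universal_inner_def
    by (intro infsum_cong semi_inner.ip_self[OF gns_semi] component_mem h)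
  also have "\<dots> = complex_of_real (\<Sum>\<^sub>\<infinity>\<phi>\<in>states A. (gnrm \<phi> (\<lambda>b. h (\<phi>, b)))\<^sup>2)"
    by (intro infsumI has_sum_of_real has_sum_infsum component_summable h)
  finally show ?thesis .
qed

lemma universal_add_mem:
  assumes h: "h \<in> U" and k: "k \<in> U"
  shows "(\<lambda>i. h i + k i) \<in> U"
  unfolding universal_space_iff
proof (intro conjI ballI allI impI)
  show "(\<lambda>b. h (\<phi>, b) + k (\<phi>, b)) \<in> gns_space A \<phi>" if "\<phi> \<in> states A" for \<phi>
    by (intro semi_inner.add_mem[OF gns_semi] that component_mem h k)
  show "h (\<phi>, b) + k (\<phi>, b) = 0" if "\<phi> \<notin> states A" for \<phi> b
    using component_outside[OF h that] component_outside[OF k that] by simp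
  show "(\<lambda>\<phi>. (gnrm \<phi> (\<lambda>b. h (\<phi>, b) + k (\<phi>, b)))\<^sup>2) summable_on states A"
  proof (rule summable_on_comparison_test)
    show "(\<lambda>\<phi>. 2 * (gnrm \<phi> (\<lambda>b. h (\<phi>, b)))\<^sup>2 + 2 * (gnrm \<phi> (\<lambda>b. k (\<phi>, b)))\<^sup>2) summable_on states A"
      by (intro summable_on_add summable_on_cmult_right component_summable h k)
    fix \<phi> assume s: "\<phi> \<in> states A"
    interpret C0_state X \<phi> by (rule state_locale[OF s])
    note m = component_mem[OF h s] component_mem[OF k s]
    have "(gns.nrm (\<lambda>b. h (\<phi>, b) + k (\<phi>, b)))\<^sup>2 \<le> (gns.nrm (\<lambda>b. h (\<phi>, b)) + gns.nrm (\<lambda>b. k (\<phi>, b)))\<^sup>2"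
      by (intro power_mono gns.nrm_triangle gns.nrm_nonneg gns.add_mem m)
    also have "\<dots> \<le> 2 * (gns.nrm (\<lambda>b. h (\<phi>, b)))\<^sup>2 + 2 * (gns.nrm (\<lambda>b. k (\<phi>, b)))\<^sup>2"
      using sum_squares_bound[of "gns.nrm (\<lambda>b. h (\<phi>, b))" "gns.nrm (\<lambda>b. k (\<phi>, b))"]
      by (simp add: power2_sum)
    finally show "(gns.nrm (\<lambda>b. h (\<phi>, b) + k (\<phi>, b)))\<^sup>2 \<le> \<dots>" .
  qed simp
qed

lemma universal_scale_mem:
  assumes h: "h \<in> U"
  shows "(\<lambda>i. c * h i) \<in> U"
  unfolding universal_space_iff
proof (intro conjI ballI allI impI)
  show "(\<lambda>b. c * h (\<phi>, b)) \<in> gns_space A \<phi>" if "\<phi> \<in> states A" for \<phi>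
    by (intro semi_inner.scale_mem[OF gns_semi] that component_mem h)
  show "c * h (\<phi>, b) = 0" if "\<phi> \<notin> states A" for \<phi> b
    using component_outside[OF h that] by simp
  have "(\<lambda>\<phi>. (cmod c)\<^sup>2 * (gnrm \<phi> (\<lambda>b. h (\<phi>, b)))\<^sup>2) summable_on states A"
    by (intro summable_on_cmult_right component_summable h)
  then show "(\<lambda>\<phi>. (gnrm \<phi> (\<lambda>b. c * h (\<phi>, b)))\<^sup>2) summable_on states A"
    by (rule summable_on_cong[THEN iffD1, rotated])
      (simp add: semi_inner.nrm_scale[OF gns_semi component_mem[OF h]] power_mult_distrib)
qed

sublocale uni: semi_inner U uip
proof
  show "(\<lambda>i. 0) \<in> U"
  proof -
    have "gnrm \<phi> (\<lambda>b. 0) = 0" if s: "\<phi> \<in> states A" for \<phi>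
    proof -
      interpret C0_state X \<phi> by (rule state_locale[OF s])
      show ?thesis using gns.nrm_scale[OF gns.zero_mem, of 0] by simp
    qed
    then have "(\<lambda>\<phi>. (gnrm \<phi> (\<lambda>b. 0))\<^sup>2) summable_on states A" by (intro summable_on_0) simp
    then show ?thesis
      using semi_inner.zero_mem[OF gns_semi] by (auto simp: universal_space_iff)
  qed
  fix h k l c assume h: "h \<in> U"
  show "(\<lambda>i. c * h i) \<in> U" by (rule universal_scale_mem[OF h])
  show "0 \<le> Re (uip h h)"
    unfolding universal_self[OF h] by (simp add: infsum_nonneg)
  assume k: "k \<in> U"
  show "(\<lambda>i. h i + k i) \<in> U" by (rule universal_add_mem[OF h k])
  have "uip k h = (\<Sum>\<^sub>\<infinity>\<phi>\<in>states A. cnj (gns_inner A \<phi> (\<lambda>b. h (\<phi>, b)) (\<lambda>b. k (\<phi>, b))))"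
    unfolding universal_inner_def
    by (intro infsum_cong semi_inner.ip_commute[OF gns_semi] component_mem h k)
  then show "uip k h = cnj (uip h k)" by (simp add: universal_inner_def)
  have "uip h (\<lambda>i. c * k i) = (\<Sum>\<^sub>\<infinity>\<phi>\<in>states A. c * gns_inner A \<phi> (\<lambda>b. h (\<phi>, b)) (\<lambda>b. k (\<phi>, b)))"
    unfolding universal_inner_def
    by (intro infsum_cong semi_inner.ip_scale[OF gns_semi] component_mem h k)
  also have "\<dots> = c * uip h k"
    unfolding universal_inner_def by (intro infsum_cmult_right universal_inner_summable h k)
  finally show "uip h (\<lambda>i. c * k i) = c * uip h k" .
  assume l: "l \<in> U"
  have "uip h (\<lambda>i. k i + l i) = (\<Sum>\<^sub>\<infinity>\<phi>\<in>states A. gns_inner A \<phi> (\<lambda>b. h (\<phi>, b)) (\<lambda>b. k (\<phi>, b))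
      + gns_inner A \<phi> (\<lambda>b. h (\<phi>, b)) (\<lambda>b. l (\<phi>, b)))"
    unfolding universal_inner_def
    by (intro infsum_cong semi_inner.ip_add[OF gns_semi] component_mem h k l)
  also have "\<dots> = uip h k + uip h l"
    unfolding universal_inner_def by (intro infsum_add universal_inner_summable h k l)
  finally show "uip h (\<lambda>i. k i + l i) = uip h k + uip h l" .
qed

lemma uni_nrm_power2:
  "h \<in> U \<Longrightarrow> (uni.nrm h)\<^sup>2 = (\<Sum>\<^sub>\<infinity>\<phi>\<in>states A. (gnrm \<phi> (\<lambda>b. h (\<phi>, b)))\<^sup>2)"
  by (simp add: uni.nrm_power2 universal_self)

lemma sum_component_nrm_le:
  assumes h: "h \<in> U" and "finite \<Phi>" "\<Phi> \<subseteq> states A"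
  shows "(\<Sum>\<phi>\<in>\<Phi>. (gnrm \<phi> (\<lambda>b. h (\<phi>, b)))\<^sup>2) \<le> (uni.nrm h)\<^sup>2"
  unfolding uni_nrm_power2[OF h]
  by (intro finite_sum_le_infsum component_summable assms) auto

lemma component_nrm_le:
  assumes h: "h \<in> U" and s: "\<phi> \<in> states A"
  shows "gnrm \<phi> (\<lambda>b. h (\<phi>, b)) \<le> uni.nrm h"
  by (rule power2_le_imp_le) (use sum_component_nrm_le[OF h, of "{\<phi>}"] s h in auto)

text \<open>Components converge in each GNS space; K collects their limits. The distance from v n to
  K is estimated on finite sets of states: there the bound on v n - v m survives the limit in m, and
  only then is the sum over all states taken.\<close>

lemma universal_complete:
  assumes v: "uni.ncauchy v"
  shows "\<exists>k\<in>U. (\<lambda>n. uni.nrm (\<lambda>i. v n i - k i)) \<longlonglongrightarrow> 0"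
proof -
  note vm = uni.ncauchy_mem[OF v]
  have "\<exists>k\<in>gns_space A \<phi>. (\<lambda>n. gnrm \<phi> (\<lambda>b. v n (\<phi>, b) - k b)) \<longlonglongrightarrow> 0" if s: "\<phi> \<in> states A" for \<phi>
  proof -
    interpret C0_state X \<phi> by (rule state_locale[OF s])
    have "gns.ncauchy (\<lambda>n b. v n (\<phi>, b))"
      unfolding gns.ncauchy_def
    proof (intro conjI allI impI component_mem vm s)
      fix e :: real assume "e > 0"
      then obtain M where "\<forall>m\<ge>M. \<forall>n\<ge>M. uni.nrm (\<lambda>i. v m i - v n i) < e"
        using uni.ncauchyD[OF v] by blast
      then show "\<exists>M. \<forall>m\<ge>M. \<forall>n\<ge>M. gns.nrm (\<lambda>b. v m (\<phi>, b) - v n (\<phi>, b)) < e"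
        using component_nrm_le[OF uni.diff_mem[OF vm vm] s] order_le_less_trans by blast
    qed
    then show ?thesis by (rule gns.complete)
  qed
  then have "\<forall>\<phi>\<in>states A. \<exists>k. k \<in> gns_space A \<phi> \<and> (\<lambda>n. gnrm \<phi> (\<lambda>b. v n (\<phi>, b) - k b)) \<longlonglongrightarrow> 0"
    by blast
  from bchoice[OF this] obtain k where k: "\<And>\<phi>. \<phi> \<in> states A \<Longrightarrow> k \<phi> \<in> gns_space A \<phi>"
    "\<And>\<phi>. \<phi> \<in> states A \<Longrightarrow> (\<lambda>n. gnrm \<phi> (\<lambda>b. v n (\<phi>, b) - k \<phi> b)) \<longlonglongrightarrow> 0" by blast
  define K where "K = (\<lambda>(\<phi>, b). if \<phi> \<in> states A then k \<phi> b else 0)"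
  have bound: "(\<lambda>i. v n i - K i) \<in> U \<and> uni.nrm (\<lambda>i. v n i - K i) \<le> e"
    if e: "e > 0" and n: "\<And>m. m \<ge> n \<Longrightarrow> uni.nrm (\<lambda>i. v n i - v m i) \<le> e" for n e
  proof -
    define d where "d \<phi> = gnrm \<phi> (\<lambda>b. v n (\<phi>, b) - k \<phi> b)" for \<phi>
    have d: "(\<lambda>m. gnrm \<phi> (\<lambda>b. v n (\<phi>, b) - v m (\<phi>, b))) \<longlonglongrightarrow> d \<phi>" if s: "\<phi> \<in> states A" for \<phi>
    proof -
      interpret C0_state X \<phi> by (rule state_locale[OF s])
      note m = component_mem[OF vm s]
      show ?thesis
        unfolding d_def
      proof (rule gns.tendsto_nrm)
        show "\<forall>\<^sub>F m in sequentially. (\<lambda>b. v n (\<phi>, b) - v m (\<phi>, b)) \<in> gns_space A \<phi>"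
          by (intro always_eventually allI gns.diff_mem m)
        show "(\<lambda>b. v n (\<phi>, b) - k \<phi> b) \<in> gns_space A \<phi>" by (intro gns.diff_mem m k s)
        show "(\<lambda>m. gns.nrm (\<lambda>b. v n (\<phi>, b) - v m (\<phi>, b) - (v n (\<phi>, b) - k \<phi> b))) \<longlonglongrightarrow> 0"
          using k(2)[OF s] by (simp add: gns.nrm_minus_commute[OF k(1)[OF s] m])
      qed
    qed
    have sum: "(\<Sum>\<phi>\<in>\<Phi>. (d \<phi>)\<^sup>2) \<le> e\<^sup>2" if \<Phi>: "finite \<Phi>" "\<Phi> \<subseteq> states A" for \<Phi>
    proof (rule LIMSEQ_le_const2)
      show "(\<lambda>m. \<Sum>\<phi>\<in>\<Phi>. (gnrm \<phi> (\<lambda>b. v n (\<phi>, b) - v m (\<phi>, b)))\<^sup>2) \<longlonglongrightarrow> (\<Sum>\<phi>\<in>\<Phi>. (d \<phi>)\<^sup>2)"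
        by (intro tendsto_sum tendsto_power d) (use \<Phi> in auto)
      have "(\<Sum>\<phi>\<in>\<Phi>. (gnrm \<phi> (\<lambda>b. v n (\<phi>, b) - v m (\<phi>, b)))\<^sup>2) \<le> e\<^sup>2" if "m \<ge> n" for m
        using sum_component_nrm_le[OF uni.diff_mem[OF vm vm] \<Phi>, of n m]
          power_mono[OF n[OF that] uni.nrm_nonneg[OF uni.diff_mem[OF vm vm]], of 2] by linarith
      then show "\<exists>N. \<forall>m\<ge>N. (\<Sum>\<phi>\<in>\<Phi>. (gnrm \<phi> (\<lambda>b. v n (\<phi>, b) - v m (\<phi>, b)))\<^sup>2) \<le> e\<^sup>2" by blast
    qed
    have summ: "(\<lambda>\<phi>. (d \<phi>)\<^sup>2) summable_on states A"
      by (rule nonneg_bdd_above_summable_on) (use sum in \<open>auto intro!: bdd_aboveI2\<close>)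
    have mem: "(\<lambda>i. v n i - K i) \<in> U"
      unfolding universal_space_iff
    proof (intro conjI ballI allI impI)
      show "(\<lambda>b. v n (\<phi>, b) - K (\<phi>, b)) \<in> gns_space A \<phi>" if "\<phi> \<in> states A" for \<phi>
        using semi_inner.diff_mem[OF gns_semi[OF that] component_mem[OF vm that] k(1)[OF that], of n]
          that by (simp add: K_def)
      show "v n (\<phi>, b) - K (\<phi>, b) = 0" if "\<phi> \<notin> states A" for \<phi> b
        using that component_outside[OF vm that] by (simp add: K_def)
      show "(\<lambda>\<phi>. (gnrm \<phi> (\<lambda>b. v n (\<phi>, b) - K (\<phi>, b)))\<^sup>2) summable_on states A"
        using summ by (rule summable_on_cong[THEN iffD1, rotated]) (simp add: K_def d_def)
    qed
    have "(uni.nrm (\<lambda>i. v n i - K i))\<^sup>2 = (\<Sum>\<^sub>\<infinity>\<phi>\<in>states A. (d \<phi>)\<^sup>2)"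
      unfolding uni_nrm_power2[OF mem] by (intro infsum_cong) (simp add: K_def d_def)
    also have "\<dots> \<le> e\<^sup>2" by (rule infsum_le_finite_sums[OF summ sum])
    finally have "uni.nrm (\<lambda>i. v n i - K i) \<le> e" by (rule power2_le_imp_le) (use e in simp)
    then show ?thesis using mem by blast
  qed
  have ev: "\<exists>N. \<forall>n\<ge>N. (\<lambda>i. v n i - K i) \<in> U \<and> uni.nrm (\<lambda>i. v n i - K i) \<le> e" if e: "e > 0" for e
  proof -
    obtain N where "\<forall>m\<ge>N. \<forall>n\<ge>N. uni.nrm (\<lambda>i. v m i - v n i) < e"
      using uni.ncauchyD[OF v e] by blast
    then show ?thesis by (intro exI[of _ N] allI impI bound[OF e]) (auto intro: less_imp_le)
  qed
  obtain N where N: "(\<lambda>i. v N i - K i) \<in> U" using ev[of 1] by auto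
  \<comment> \<open>Square-summability is known only for differences v n - K, so K is recovered as v
    N - (v N - K).\<close>
  have "K \<in> U" using uni.diff_mem[OF vm[of N] N] by simp
  moreover have "(\<lambda>n. uni.nrm (\<lambda>i. v n i - K i)) \<longlonglongrightarrow> 0"
  proof (rule LIMSEQ_I)
    fix r :: real assume r: "r > 0"
    then obtain N where "\<forall>n\<ge>N. (\<lambda>i. v n i - K i) \<in> U \<and> uni.nrm (\<lambda>i. v n i - K i) \<le> r/2"
      using ev[of "r/2"] by auto
    then show "\<exists>N. \<forall>n\<ge>N. norm (uni.nrm (\<lambda>i. v n i - K i) - 0) < r"
      using r by (intro exI[of _ N]) force
  qed
  ultimately show ?thesis by blast
qed

sublocale uni: hilbert_functions U uip
proof
  fix h assume h: "h \<in> U" and z: "uip h h = 0"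
  have "h (\<phi>, b) = 0" for \<phi> b
  proof (cases "\<phi> \<in> states A")
    case True
    interpret C0_state X \<phi> by (rule state_locale[OF True])
    have "gns.nrm (\<lambda>b. h (\<phi>, b)) \<le> uni.nrm h" by (rule component_nrm_le[OF h True])
    also have "uni.nrm h = 0" by (simp add: uni.nrm_def z)
    finally have "gns.nrm (\<lambda>b. h (\<phi>, b)) = 0"
      using gns.nrm_nonneg[OF component_mem[OF h True]] by simp
    then show ?thesis using gns.nrm_eq_0[OF component_mem[OF h True]] by (simp add: fun_eq_iff)
  qed (rule component_outside[OF h])
  then show "h = (\<lambda>i. 0)" by auto
qed (rule universal_complete)

section \<open>Boundedness, algebraic rules and positivity of the universal representation\<close>

lemma rep_component:
  assumes h: "h \<in> U" and s: "\<phi> \<in> states A"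
  shows "(\<lambda>b. rep f h (\<phi>, b)) = C0_state.gact X f (\<lambda>b. h (\<phi>, b))"
  using h by (simp add: universal_rep_def C0_state.gact_def[OF state_locale[OF s]] fun_eq_iff)

lemma rep_mem_nrm:
  assumes f: "f \<in> carrier A" and M: "\<And>x. cmod (f x) \<le> M" and h: "h \<in> U"
  shows "rep f h \<in> U" "uni.nrm (rep f h) \<le> M * uni.nrm h"
proof -
  have "M \<ge> 0" using M[of undefined] norm_ge_zero order_trans by blast
  define d where "d \<phi> = gnrm \<phi> (\<lambda>b. rep f h (\<phi>, b))" for \<phi>
  have le: "(d \<phi>)\<^sup>2 \<le> M\<^sup>2 * (gnrm \<phi> (\<lambda>b. h (\<phi>, b)))\<^sup>2" if s: "\<phi> \<in> states A" for \<phi>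
  proof -
    interpret C0_state X \<phi> by (rule state_locale[OF s])
    show ?thesis
      unfolding d_def rep_component[OF h s] power_mult_distrib[symmetric]
      by (intro power_mono gact_nrm_le gns.nrm_nonneg gact_mem f M component_mem h s)
  qed
  have s1: "(\<lambda>\<phi>. M\<^sup>2 * (gnrm \<phi> (\<lambda>b. h (\<phi>, b)))\<^sup>2) summable_on states A"
    by (intro summable_on_cmult_right component_summable h)
  have s2: "(\<lambda>\<phi>. (d \<phi>)\<^sup>2) summable_on states A"
    by (rule summable_on_comparison_test[OF s1 le]) auto
  show m: "rep f h \<in> U"
    unfolding universal_space_iff
  proof (intro conjI ballI allI impI)
    show "(\<lambda>b. rep f h (\<phi>, b)) \<in> gns_space A \<phi>" if s: "\<phi> \<in> states A" for \<phi>
      unfolding rep_component[OF h s] by (intro C0_state.gact_mem[OF state_locale[OF s]] f component_mem h s)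
    show "rep f h (\<phi>, b) = 0" if "\<phi> \<notin> states A" for \<phi> b
      using h component_outside[OF h that] by (simp add: universal_rep_def)
    show "(\<lambda>\<phi>. (gnrm \<phi> (\<lambda>b. rep f h (\<phi>, b)))\<^sup>2) summable_on states A"
      using s2 by (simp add: d_def)
  qed
  have "(uni.nrm (rep f h))\<^sup>2 = (\<Sum>\<^sub>\<infinity>\<phi>\<in>states A. (d \<phi>)\<^sup>2)"
    unfolding uni_nrm_power2[OF m] d_def ..
  also have "\<dots> \<le> (\<Sum>\<^sub>\<infinity>\<phi>\<in>states A. M\<^sup>2 * (gnrm \<phi> (\<lambda>b. h (\<phi>, b)))\<^sup>2)"
    by (rule infsum_mono[OF s2 s1 le])
  also have "\<dots> = (M * uni.nrm h)\<^sup>2"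
    unfolding power_mult_distrib uni_nrm_power2[OF h]
    by (intro infsum_cmult_right component_summable h)
  finally show "uni.nrm (rep f h) \<le> M * uni.nrm h"
    by (rule power2_le_imp_le) (use \<open>M \<ge> 0\<close> h in simp)
qed

lemma rep_mem: "f \<in> carrier A \<Longrightarrow> h \<in> U \<Longrightarrow> rep f h \<in> U"
  using carrier_C0_unitalization_bounded[of f X] rep_mem_nrm(1) by blast

lemma rep_bounded_operator:
  assumes f: "f \<in> carrier A"
  shows "rep f \<in> bounded_operators U uip"
  unfolding bounded_operators_iff[OF uni.semi_inner_axioms]
proof (intro conjI ballI allI)
  show "rep f \<in> U \<rightarrow>\<^sub>E U" using rep_mem[OF f] by (auto simp: universal_rep_def)
  show "rep f (\<lambda>i. h i + k i) = (\<lambda>i. rep f h i + rep f k i)" if "h \<in> U" "k \<in> U" for h k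
    using that universal_add_mem[OF that] by (auto simp: universal_rep_def fun_eq_iff)
  show "rep f (\<lambda>i. c * h i) = (\<lambda>i. c * rep f h i)" if "h \<in> U" for h c
    using that universal_scale_mem[OF that] by (auto simp: universal_rep_def fun_eq_iff)
  obtain M where "M \<ge> 0" "\<And>x. cmod (f x) \<le> M" using carrier_C0_unitalization_bounded[OF f] by blast
  then show "\<exists>C\<ge>0. \<forall>h\<in>U. uni.nrm (rep f h) \<le> C * uni.nrm h"
    using rep_mem_nrm(2)[OF f] by blast
qed

lemma rep_adjoint:
  assumes f: "f \<in> carrier A" and h: "h \<in> U" and k: "k \<in> U"
  shows "uip k (rep f h) = uip (rep (\<lambda>x. cnj (f x)) k) h"
  unfolding universal_inner_def
proof (rule infsum_cong)
  fix \<phi> assume s: "\<phi> \<in> states A"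
  interpret C0_state X \<phi> by (rule state_locale[OF s])
  show "gip (\<lambda>b. k (\<phi>, b)) (\<lambda>b. rep f h (\<phi>, b)) = gip (\<lambda>b. rep (\<lambda>x. cnj (f x)) k (\<phi>, b)) (\<lambda>b. h (\<phi>, b))"
    unfolding rep_component[OF h s] rep_component[OF k s]
    by (intro gact_adjoint f component_mem h k s)
qed

lemma rep_add:
  assumes f: "f \<in> carrier A" and g: "g \<in> carrier A" and h: "h \<in> U"
  shows "rep (\<lambda>x. f x + g x) h = (\<lambda>i. rep f h i + rep g h i)"
proof
  fix i :: "(('x \<Rightarrow> complex) \<Rightarrow> complex) \<times> ('x \<Rightarrow> complex)"
  obtain \<phi> b where i: "i = (\<phi>, b)" by (cases i)
  show "rep (\<lambda>x. f x + g x) h i = rep f h i + rep g h i"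
  proof (cases "\<phi> \<in> states A")
    case s: True
    interpret C0_state X \<phi> by (rule state_locale[OF s])
    show ?thesis
      using fun_cong[OF rep_component[OF h s], of _ b] fun_cong[OF gact_add[OF f g component_mem[OF h s]], of b]
      by (simp add: i)
  next
    case False
    then show ?thesis using h component_outside[OF h False] by (simp add: i universal_rep_def)
  qed
qed

lemma rep_scale:
  assumes f: "f \<in> carrier A" and h: "h \<in> U"
  shows "rep (\<lambda>x. c * f x) h = (\<lambda>i. c * rep f h i)"
proof
  fix i :: "(('x \<Rightarrow> complex) \<Rightarrow> complex) \<times> ('x \<Rightarrow> complex)"
  obtain \<phi> b where i: "i = (\<phi>, b)" by (cases i)
  show "rep (\<lambda>x. c * f x) h i = c * rep f h i"
  proof (cases "\<phi> \<in> states A")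
    case s: True
    interpret C0_state X \<phi> by (rule state_locale[OF s])
    show ?thesis
      using fun_cong[OF rep_component[OF h s], of _ b] fun_cong[OF gact_scale[OF f component_mem[OF h s]], of c b]
      by (simp add: i)
  next
    case False
    then show ?thesis using h component_outside[OF h False] by (simp add: i universal_rep_def)
  qed
qed

lemma rep_diff:
  assumes f: "f \<in> carrier A" and g: "g \<in> carrier A" and h: "h \<in> U"
  shows "rep (\<lambda>x. f x - g x) h = (\<lambda>i. rep f h i - rep g h i)"
  using rep_add[OF f carrier_scale[OF g, of "-1"] h] rep_scale[OF g h, of "-1"] by simp

lemma rep_mult:
  assumes f: "f \<in> carrier A" and g: "g \<in> carrier A" and h: "h \<in> U"
  shows "rep (\<lambda>x. f x * g x) h = rep f (rep g h)"
  using h rep_mem[OF g h] carrier_mult[OF carrier_cnj[OF f]]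
  by (auto simp: universal_rep_def fun_eq_iff mult_ac)

text \<open>With s the pointwise square root of f, the form equals the squared norm of
  \<open>rep s h\<close>. All order relations between operators are obtained from pointwise ones
  through this lemma.\<close>

lemma rep_nonneg:
  assumes f: "f \<in> carrier A" and pos: "\<And>x. f x \<in> \<real>\<^sub>\<ge>\<^sub>0" and h: "h \<in> U"
  shows "uip h (rep f h) \<in> \<real>\<^sub>\<ge>\<^sub>0"
proof -
  define s where "s = (\<lambda>x. complex_of_real (sqrt (Re (f x))))"
  have s: "s \<in> carrier A" unfolding s_def by (rule carrier_sqrt[OF f])
  have "f = (\<lambda>x. s x * s x)"
    using pos by (auto simp: s_def complex_nonneg_Reals_iff complex_eq_iff)
  then have "uip h (rep f h) = uip (rep s h) (rep s h)"
    using rep_mult[OF s s h] rep_adjoint[OF s rep_mem[OF s h] h] by (simp add: s_def)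
  then show ?thesis using uni.ip_self[OF rep_mem[OF s h]] by (simp del: of_real_power)
qed

text \<open>For fixed h the real numbers \<open>uip h (rep (a F) h)\<close> are bounded, so a finite
  F almost attains their supremum, and every larger G can gain only little. Convergence of these
  numbers is returned beside the ultraweak limit because order comparisons with S use it
  directly.\<close>

lemma increasing_net_limit:
  fixes J :: "'j set" and a :: "'j set \<Rightarrow> 'x \<Rightarrow> complex"
  assumes a: "\<And>F. finite F \<Longrightarrow> F \<subseteq> J \<Longrightarrow> a F \<in> carrier A"
    and real: "\<And>F x. finite F \<Longrightarrow> F \<subseteq> J \<Longrightarrow> a F x \<in> \<real>\<^sub>\<ge>\<^sub>0"
    and mono: "\<And>F G x. finite G \<Longrightarrow> F \<subseteq> G \<Longrightarrow> G \<subseteq> J \<Longrightarrow> Re (a F x) \<le> Re (a G x)"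
    and bound: "\<And>F x. finite F \<Longrightarrow> F \<subseteq> J \<Longrightarrow> Re (a F x) \<le> C"
  shows "\<exists>S\<in>enveloping_vN A. ultraweak_limit U uip (\<lambda>F. rep (a F)) S (finite_subsets_at_top J) \<and>
    (\<forall>h\<in>U. ((\<lambda>F. uip h (rep (a F) h)) \<longlongrightarrow> uip h (S h)) (finite_subsets_at_top J))"
proof -
  have "C \<ge> 0"
    using real[of "{}" undefined] bound[of "{}" undefined] by (auto simp: complex_nonneg_Reals_iff)
  have cb: "cmod (a F x) \<le> C" if "finite F" "F \<subseteq> J" for F x
    using real[OF that, of x] bound[OF that, of x] by (auto elim!: nonneg_Reals_cases)
  have ev: "\<forall>\<^sub>F F in finite_subsets_at_top J. finite F \<and> F \<subseteq> J"
    by (rule eventually_finite_subsets_at_top_weakI) auto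
  have T: "\<forall>\<^sub>F F in finite_subsets_at_top J. rep (a F) \<in> bounded_operators U uip \<and>
      (\<forall>h\<in>U. uni.nrm (rep (a F) h) \<le> C * uni.nrm h)"
    using ev by eventually_elim (auto intro!: rep_bounded_operator rep_mem_nrm(2) a cb)
  have "\<exists>F. rep (a F) h \<in> U \<and>
      (\<forall>\<^sub>F G in finite_subsets_at_top J. uni.nrm (\<lambda>i. rep (a G) h i - rep (a F) h i) < e)"
    if h: "h \<in> U" and e: "e > 0" for h and e :: real
  proof -
    define q where "q F = Re (uip h (rep (a F) h))" for F
    have qb: "q F \<le> uni.nrm h * (C * uni.nrm h)" if "finite F" "F \<subseteq> J" for F
    proof -
      have "q F \<le> cmod (uip h (rep (a F) h))" unfolding q_def by (rule complex_Re_le_cmod)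
      also have "\<dots> \<le> uni.nrm h * uni.nrm (rep (a F) h)"
        by (intro uni.cauchy_schwarz h rep_mem a that)
      also have "\<dots> \<le> uni.nrm h * (C * uni.nrm h)"
        by (intro mult_left_mono rep_mem_nrm(2) a cb that h uni.nrm_nonneg)
      finally show ?thesis .
    qed
    define Q where "Q = {F. finite F \<and> F \<subseteq> J}"
    \<comment> \<open>The gap to s is kept below e^2 / (C + 1), so that C times it is strictly less
      than e^2, also when C = 0.\<close>
    define s where "s = (SUP F\<in>Q. q F)"
    have bdd: "bdd_above (q ` Q)" using qb by (auto simp: Q_def intro!: bdd_aboveI2)
    have "Q \<noteq> {}" by (auto simp: Q_def)
    have "s - e\<^sup>2 / (C + 1) < s" using e \<open>C \<ge> 0\<close> by simp
    then obtain F where F: "F \<in> Q" and qF: "s - e\<^sup>2 / (C + 1) < q F"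
      unfolding s_def using less_cSUP_iff[OF \<open>Q \<noteq> {}\<close> bdd] by blast
    then have F': "finite F" "F \<subseteq> J" by (auto simp: Q_def)
    have "uni.nrm (\<lambda>i. rep (a G) h i - rep (a F) h i) < e" if G: "finite G" "F \<subseteq> G" "G \<subseteq> J" for G
    proof -
      define d where "d = (\<lambda>x. a G x - a F x)"
      have d: "d \<in> carrier A" unfolding d_def by (intro carrier_diff a F' G)
      have dr: "\<exists>y. d x = complex_of_real y \<and> 0 \<le> y \<and> y \<le> C" for x
        using real[OF G(1,3), of x] real[OF F', of x] mono[OF G, of x] bound[OF G(1,3), of x]
        by (auto simp: d_def complex_eq_iff complex_nonneg_Reals_iff intro!: exI[of _ "Re (a G x) - Re (a F x)"])
      have dc: "(\<lambda>x. cnj (d x)) = d"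
        using dr by (auto simp: fun_eq_iff) (metis complex_cnj_complex_of_real)
      \<comment> \<open>Since 0 \<le> d \<le> C at every point, d^2 \<le> C d; positivity of the
        operator of g bounds the squared norm of \<open>rep d h\<close> by C times the increment of
        the form.\<close>
      define g where "g = (\<lambda>x. complex_of_real C * d x - d x * d x)"
      have g: "g \<in> carrier A" unfolding g_def by (intro carrier_closed d)
      have "g x \<in> \<real>\<^sub>\<ge>\<^sub>0" for x
      proof -
        obtain y where "d x = complex_of_real y" "0 \<le> y" "y \<le> C" using dr by blast
        moreover then have "g x = complex_of_real ((C - y) * y)" by (simp add: g_def algebra_simps)
        ultimately show ?thesis by (simp del: of_real_mult of_real_diff)
      qed
      from rep_nonneg[OF g this h] have "0 \<le> Re (uip h (rep g h))"
        by (simp add: complex_nonneg_Reals_iff)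
      moreover have "rep g h = (\<lambda>i. complex_of_real C * rep d h i - rep d (rep d h) i)"
        unfolding g_def rep_diff[OF carrier_scale[OF d] carrier_mult[OF d d] h]
          rep_scale[OF d h] rep_mult[OF d d h] ..
      moreover have "uip h (\<lambda>i. complex_of_real C * rep d h i - rep d (rep d h) i)
          = complex_of_real C * uip h (rep d h) - uip (rep d h) (rep d h)"
        using rep_adjoint[OF d rep_mem[OF d h] h]
        by (simp add: uni.ip_diff uni.ip_scale h rep_mem d universal_scale_mem dc)
      moreover have "uip h (rep d h) = uip h (rep (a G) h) - uip h (rep (a F) h)"
        unfolding d_def rep_diff[OF a[OF G(1,3)] a[OF F'] h]
        by (intro uni.ip_diff h rep_mem a F' G)
      ultimately have "(uni.nrm (rep d h))\<^sup>2 \<le> C * (q G - q F)"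
        by (simp add: uni.nrm_power2 rep_mem d h q_def)
      also have "\<dots> \<le> C * (e\<^sup>2 / (C + 1))"
      proof (rule mult_left_mono)
        have "q G \<le> s" unfolding s_def using G by (intro cSUP_upper bdd) (auto simp: Q_def)
        then show "q G - q F \<le> e\<^sup>2 / (C + 1)" using qF by simp
      qed (rule \<open>C \<ge> 0\<close>)
      also have "\<dots> < e\<^sup>2" using e \<open>C \<ge> 0\<close> by (simp add: field_simps)
      finally have "uni.nrm (rep d h) < e" by (rule power2_less_imp_less) (use e in simp)
      then show ?thesis unfolding d_def rep_diff[OF a[OF G(1,3)] a[OF F'] h] .
    qed
    then have "\<forall>\<^sub>F G in finite_subsets_at_top J. uni.nrm (\<lambda>i. rep (a G) h i - rep (a F) h i) < e"
      unfolding eventually_finite_subsets_at_top using F' by blast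
    then show ?thesis using rep_mem[OF a[OF F'] h] by blast
  qed
  from uni.strong_limit_exists[OF finite_subsets_at_top_neq_bot T \<open>C \<ge> 0\<close> this]
  obtain S where S: "S \<in> bounded_operators U uip"
    and lim: "\<And>h. h \<in> U \<Longrightarrow> ((\<lambda>F. uni.nrm (\<lambda>i. rep (a F) h i - S h i)) \<longlongrightarrow> 0) (finite_subsets_at_top J)"
    by blast
  have SU: "S h \<in> U" if "h \<in> U" for h using S that by (auto simp: bounded_operators_def)
  have "S \<in> enveloping_vN A"
    unfolding enveloping_vN_def
  \<comment> \<open>Applied with the commutant of the represented algebra as M; each
    \<open>rep (a F)\<close> commutes with it by definition, so the limit lies in the
    bicommutant.\<close>
  proof (rule uni.commutant_strong_limit[OF finite_subsets_at_top_neq_bot _ _ S lim])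
    show "commutant U uip (rep ` carrier A) \<subseteq> bounded_operators U uip" by (auto simp: commutant_def)
    show "\<forall>\<^sub>F F in finite_subsets_at_top J. rep (a F) \<in> commutant U uip (commutant U uip (rep ` carrier A))"
      using ev
    proof eventually_elim
      case (elim F)
      then have "a F \<in> carrier A" using a by blast
      then show ?case by (auto simp: commutant_def intro: rep_bounded_operator)
    qed
  qed
  moreover have "ultraweak_limit U uip (\<lambda>F. rep (a F)) S (finite_subsets_at_top J)"
  proof (rule uni.strong_limit_ultraweak[OF finite_subsets_at_top_neq_bot _ SU lim \<open>C \<ge> 0\<close>])
    show "\<forall>\<^sub>F F in finite_subsets_at_top J. \<forall>h\<in>U. rep (a F) h \<in> U \<and> uni.nrm (rep (a F) h) \<le> C * uni.nrm h"
      using ev by eventually_elim (auto intro!: rep_mem rep_mem_nrm(2) a cb)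
  qed
  moreover have "((\<lambda>F. uip h (rep (a F) h)) \<longlongrightarrow> uip h (S h)) (finite_subsets_at_top J)" if h: "h \<in> U" for h
    by (rule uni.tendsto_ip[OF _ SU[OF h] h lim[OF h]])
      (use ev in eventually_elim, auto intro!: rep_mem a h)
  ultimately show ?thesis by blast
qed

text \<open>Evaluation at p is a state; its cyclic vector, the class of the unit, placed in the
  summand of that state and extended by 0, is the required \<xi>.\<close>

lemma point_vector:
  assumes p: "p \<in> topspace X"
  shows "\<exists>\<xi>\<in>U. \<forall>f\<in>carrier A. uip \<xi> (rep f \<xi>) = f p"
proof -
  \<comment> \<open>Restricted to the carrier because states are extensional.\<close>
  define \<delta> where "\<delta> = (\<lambda>f\<in>carrier A. f p)"
  have \<delta>: "\<delta> \<in> states A"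
    unfolding states_def \<delta>_def
    by (auto simp: carrier_closed indicator_mem_carrier p complex_nonneg_Reals_iff)
  interpret C0_state X \<delta> by (rule state_locale[OF \<delta>])
  note one = pre.ncauchy_const[OF indicator_mem_carrier]
  define v where "v = gv (\<lambda>n. indicator (topspace X))"
  have v: "v \<in> gns_space A \<delta>" unfolding v_def by (rule gv_mem[OF one])
  define \<xi> where "\<xi> = (\<lambda>(\<psi>, b). if \<psi> = \<delta> then v b else 0)"
  have comp: "(\<lambda>b. \<xi> (\<psi>, b)) = (if \<psi> = \<delta> then v else (\<lambda>b. 0))" for \<psi>
    by (simp add: \<xi>_def)
  have nz: "gnrm \<psi> (\<lambda>b. 0) = 0" if "\<psi> \<in> states A" for \<psi>
    using semi_inner.nrm_scale[OF gns_semi[OF that] semi_inner.zero_mem[OF gns_semi[OF that]], of 0] by simp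
  have \<xi>: "\<xi> \<in> U"
    unfolding universal_space_iff
  proof (intro conjI ballI allI impI)
    show "(\<lambda>b. \<xi> (\<psi>, b)) \<in> gns_space A \<psi>" if "\<psi> \<in> states A" for \<psi>
      unfolding comp using v semi_inner.zero_mem[OF gns_semi[OF that]] by simp
    show "\<xi> (\<psi>, b) = 0" if "\<psi> \<notin> states A" for \<psi> b
      using that \<delta> by (auto simp: \<xi>_def)
    show "(\<lambda>\<psi>. (gnrm \<psi> (\<lambda>b. \<xi> (\<psi>, b)))\<^sup>2) summable_on states A"
      by (subst summable_on_cong_neutral[where T = "{\<delta>}" and g = "\<lambda>\<psi>. (gnrm \<psi> (\<lambda>b. \<xi> (\<psi>, b)))\<^sup>2"])
        (auto simp: \<delta> comp nz)
  qed
  have "uip \<xi> (rep f \<xi>) = f p" if f: "f \<in> carrier A" for f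
  proof -
    have "uip \<xi> (rep f \<xi>) = (\<Sum>\<^sub>\<infinity>\<psi>\<in>{\<delta>}. gns_inner A \<psi> (\<lambda>b. \<xi> (\<psi>, b)) (\<lambda>b. rep f \<xi> (\<psi>, b)))"
      unfolding universal_inner_def
    proof (rule infsum_cong_neutral)
      fix \<psi> assume \<psi>: "\<psi> \<in> states A - {\<delta>}"
      \<comment> \<open>Writing the zero component as 0 times itself lets homogeneity of the form
        annihilate every summand other than \<delta>.\<close>
      have "(\<lambda>b. \<xi> (\<psi>, b)) = (\<lambda>b. 0 * \<xi> (\<psi>, b))" using \<psi> by (simp add: comp)
      then show "gns_inner A \<psi> (\<lambda>b. \<xi> (\<psi>, b)) (\<lambda>b. rep f \<xi> (\<psi>, b)) = 0"
        using semi_inner.ip_scale_left[OF gns_semi component_mem[OF \<xi>] component_mem[OF rep_mem[OF f \<xi>]],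
            of \<psi> 0] \<psi>
        by simp
    qed (use \<delta> in auto)
    also have "\<dots> = gip v (gact f v)"
      using rep_component[OF \<xi> \<delta>, of f] by (simp add: comp)
    also have "\<dots> = f p"
    proof (rule LIMSEQ_unique)
      show "(\<lambda>n. \<delta> (\<lambda>x. cnj (indicator (topspace X) x) * (f x * indicator (topspace X) x))) \<longlonglongrightarrow> gip v (gact f v)"
        unfolding v_def gact_gv[OF f one] by (rule gip_tendsto[OF one ncauchy_mult[OF f one]])
      have "\<delta> (\<lambda>x. cnj (indicator (topspace X) x) * (f x * indicator (topspace X) x)) = f p"
        unfolding \<delta>_def using p by (simp add: carrier_closed indicator_mem_carrier f)
      then show "(\<lambda>n. \<delta> (\<lambda>x. cnj (indicator (topspace X) x) * (f x * indicator (topspace X) x))) \<longlonglongrightarrow> f p"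
        by simp
    qed
    finally show ?thesis .
  qed
  then show ?thesis using \<xi> by blast
qed

section \<open>Non-standard frames of \<open>C\<^sub>0(X)\<close>\<close>

lemma frame_term_mem:
  assumes "y \<in> C0 X" "z \<in> C0 X"
  shows "C0_inner y z \<otimes>\<^bsub>A\<^esub> C0_inner z y \<in> carrier A"
  unfolding C0_inner_def C0_unitalization_simps
  by (intro carrier_closed C0_subset_carrier assms)

text \<open>The algebra is commutative, so each frame term is \<bar>y\<bar>^2 \<bar>x j\<bar>^2 and
  the factor \<bar>y\<bar>^2 comes out of the sum.\<close>

lemma frame_sum:
  assumes "y \<in> C0 X" "\<And>j. j \<in> F \<Longrightarrow> x j \<in> C0 X" "finite F"
  shows "finsum A (\<lambda>j. C0_inner y (x j) \<otimes>\<^bsub>A\<^esub> C0_inner (x j) y) F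
      = (\<lambda>p. complex_of_real ((cmod (y p))\<^sup>2 * (\<Sum>j\<in>F. (cmod (x j p))\<^sup>2)))"
    and "finsum A (\<lambda>j. C0_inner y (x j) \<otimes>\<^bsub>A\<^esub> C0_inner (x j) y) F \<in> carrier A"
proof -
  have m: "C0_inner y (x j) \<otimes>\<^bsub>A\<^esub> C0_inner (x j) y \<in> carrier A" if "j \<in> F" for j
    using frame_term_mem[OF assms(1) assms(2)[OF that]] .
  note fs = finsum_C0_unitalization[of F "\<lambda>j. C0_inner y (x j) \<otimes>\<^bsub>A\<^esub> C0_inner (x j) y", OF assms(3) m]
  show "finsum A (\<lambda>j. C0_inner y (x j) \<otimes>\<^bsub>A\<^esub> C0_inner (x j) y) F \<in> carrier A"
    using fs by simp
  have "C0_inner y z p * C0_inner z y p = complex_of_real ((cmod (y p))\<^sup>2 * (cmod (z p))\<^sup>2)" for z p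
    by (simp add: C0_inner_def complex_norm_square mult_ac del: of_real_power)
  then show "finsum A (\<lambda>j. C0_inner y (x j) \<otimes>\<^bsub>A\<^esub> C0_inner (x j) y) F
      = (\<lambda>p. complex_of_real ((cmod (y p))\<^sup>2 * (\<Sum>j\<in>F. (cmod (x j p))\<^sup>2)))"
    using fs(1) by (simp add: sum_distrib_left)
qed

lemma C0_inner_self: "C0_inner y y = (\<lambda>p. complex_of_real ((cmod (y p))\<^sup>2))"
  by (simp add: C0_inner_def complex_norm_square mult.commute fun_eq_iff del: of_real_power)

text \<open>The ultraweak limit is tested at the vector belonging to p, where partial sums become
  finite sums of numbers. The weight \<bar>y p\<bar>^2 stays until some y with y p \<noteq> 0 is
  chosen.\<close>

lemma normalized_frame_pointwise:
  assumes fr: "normalized_frame A (C0 X) C0_inner J x" and y: "y \<in> C0 X" and p: "p \<in> topspace X"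
  shows "((\<lambda>j. (cmod (y p))\<^sup>2 * (cmod (x j p))\<^sup>2) has_sum (cmod (y p))\<^sup>2) J"
proof -
  have x: "x j \<in> C0 X" if "j \<in> J" for j
    using fr that by (auto simp: normalized_frame_def nonstandard_frame_bounds_def)
  define a where "a F = finsum A (\<lambda>j. C0_inner y (x j) \<otimes>\<^bsub>A\<^esub> C0_inner (x j) y) F" for F
  have "\<exists>S\<in>enveloping_vN A. ultraweak_limit U uip (\<lambda>F. rep (a F)) S (finite_subsets_at_top J) \<and>
      operator_le U uip (rep (C0_inner y y)) S \<and> operator_le U uip S (rep (C0_inner y y))"
    using fr y by (simp add: normalized_frame_def nonstandard_frame_bounds_def a_def)
  then obtain S where S: "S \<in> enveloping_vN A"
    and lim: "ultraweak_limit U uip (\<lambda>F. rep (a F)) S (finite_subsets_at_top J)"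
    and le: "operator_le U uip (rep (C0_inner y y)) S" "operator_le U uip S (rep (C0_inner y y))" by blast
  obtain \<xi> where \<xi>: "\<xi> \<in> U" "\<And>f. f \<in> carrier A \<Longrightarrow> uip \<xi> (rep f \<xi>) = f p"
    using point_vector[OF p] by blast
  have yy: "C0_inner y y \<in> carrier A"
    unfolding C0_inner_def by (intro carrier_closed C0_subset_carrier y)
  \<comment> \<open>Both frame constants are 1, so the two operator inequalities force
    equality.\<close>
  have S\<xi>: "uip \<xi> (S \<xi>) = complex_of_real ((cmod (y p))\<^sup>2)"
    using le \<xi>(1) \<xi>(2)[OF yy] unfolding operator_le_def C0_inner_self
    by (fastforce simp: complex_nonneg_Reals_iff complex_eq_iff)
  have ev: "\<forall>\<^sub>F F in finite_subsets_at_top J. finite F \<and> F \<subseteq> J"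
    by (rule eventually_finite_subsets_at_top_weakI) auto
  have aF: "a F \<in> carrier A" "a F p = complex_of_real (\<Sum>j\<in>F. (cmod (y p))\<^sup>2 * (cmod (x j p))\<^sup>2)"
    if "finite F" "F \<subseteq> J" for F
  proof -
    have xF: "\<And>j. j \<in> F \<Longrightarrow> x j \<in> C0 X" using x \<open>F \<subseteq> J\<close> by blast
    show "a F \<in> carrier A" unfolding a_def by (intro frame_sum(2) y xF \<open>finite F\<close>)
    have fs: "a F = (\<lambda>p. complex_of_real ((cmod (y p))\<^sup>2 * (\<Sum>j\<in>F. (cmod (x j p))\<^sup>2)))"
      unfolding a_def by (intro frame_sum(1) y xF \<open>finite F\<close>)
    show "a F p = complex_of_real (\<Sum>j\<in>F. (cmod (y p))\<^sup>2 * (cmod (x j p))\<^sup>2)"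
      unfolding fs by (simp add: sum_distrib_left)
  qed
  have "((\<lambda>F. uip \<xi> (rep (a F) \<xi>)) \<longlongrightarrow> uip \<xi> (S \<xi>)) (finite_subsets_at_top J)"
  proof (rule uni.ultraweak_limit_vector[OF lim \<xi>(1)])
    show "\<forall>\<^sub>F F in finite_subsets_at_top J. rep (a F) (\<lambda>i. 0) \<in> U"
      using ev by eventually_elim (auto intro!: rep_mem uni.zero_mem aF)
    show "S (\<lambda>i. 0) \<in> U"
      using S uni.zero_mem by (auto simp: enveloping_vN_def commutant_def bounded_operators_def)
  qed
  then have "((\<lambda>F. complex_of_real (\<Sum>j\<in>F. (cmod (y p))\<^sup>2 * (cmod (x j p))\<^sup>2)) \<longlongrightarrow>
      complex_of_real ((cmod (y p))\<^sup>2)) (finite_subsets_at_top J)"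
    unfolding S\<xi>
  proof (rule Lim_transform_eventually)
    show "\<forall>\<^sub>F F in finite_subsets_at_top J. uip \<xi> (rep (a F) \<xi>)
        = complex_of_real (\<Sum>j\<in>F. (cmod (y p))\<^sup>2 * (cmod (x j p))\<^sup>2)"
      using ev by eventually_elim (use \<xi>(2) aF in auto)
  qed
  then show ?thesis unfolding has_sum_def by (simp only: tendsto_of_real_iff)
qed

text \<open>Where y is small the claim is free, because c \<bar>y\<bar>^2 is already below e. On the
  remaining compact set the open sets \<open>V F\<close>, where the partial sum over F is good
  enough, form a cover; finitely many suffice, and partial sums only grow when their index sets are
  united.\<close>

lemma partial_sums_approximate:
  assumes y: "y \<in> C0 X" and x: "\<And>j. j \<in> J \<Longrightarrow> x j \<in> C0 X" and "c > 0"
    and lower: "\<And>p e. p \<in> topspace X \<Longrightarrow> e > 0 \<Longrightarrow>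
      \<exists>F. finite F \<and> F \<subseteq> J \<and> c - e < (\<Sum>j\<in>F. (cmod (x j p))\<^sup>2)"
    and "e > 0"
  shows "\<exists>F. finite F \<and> F \<subseteq> J \<and>
    (\<forall>p\<in>topspace X. c * (cmod (y p))\<^sup>2 - e \<le> (cmod (y p))\<^sup>2 * (\<Sum>j\<in>F. (cmod (x j p))\<^sup>2))"
proof -
  define d where "d F p = (cmod (y p))\<^sup>2 * (\<Sum>j\<in>F. (cmod (x j p))\<^sup>2) - c * (cmod (y p))\<^sup>2" for F p
  have cont: "continuous_map X euclideanreal (d F)" if "finite F" "F \<subseteq> J" for F
    unfolding d_def using y x that
    by (intro continuous_intros) (auto simp: C0_def)
  \<comment> \<open>Chosen so that c \<delta>^2 = e.\<close>
  define \<delta> where "\<delta> = sqrt (e / c)"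
  have "\<delta> > 0" using \<open>e > 0\<close> \<open>c > 0\<close> by (simp add: \<delta>_def)
  then obtain C where C: "compactin X C" "\<And>p. p \<in> topspace X - C \<Longrightarrow> cmod (y p) < \<delta>"
    using y unfolding C0_def by blast
  have outside: "- e < d F p" if "p \<in> topspace X - C" for F p
  proof -
    have "(cmod (y p))\<^sup>2 < \<delta>\<^sup>2" using C(2)[OF that] by (intro power_strict_mono) auto
    then have "c * (cmod (y p))\<^sup>2 < e" using \<open>e > 0\<close> \<open>c > 0\<close> by (simp add: \<delta>_def field_simps)
    moreover have "0 \<le> (cmod (y p))\<^sup>2 * (\<Sum>j\<in>F. (cmod (x j p))\<^sup>2)"
      by (intro mult_nonneg_nonneg sum_nonneg) auto
    ultimately show ?thesis by (simp add: d_def)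
  qed
  define V where "V F = {p \<in> topspace X. d F p \<in> {- e<..}}" for F
  have "\<exists>F. finite F \<and> F \<subseteq> J \<and> p \<in> V F" if p: "p \<in> topspace X" for p
  proof -
    \<comment> \<open>The tolerance at p is rescaled so that \<bar>y p\<bar>^2 r < e; the summand 1
      covers y p = 0.\<close>
    define r where "r = e / ((cmod (y p))\<^sup>2 + 1)"
    have "r > 0" using \<open>e > 0\<close> by (simp add: r_def add_nonneg_pos)
    then obtain F where F: "finite F" "F \<subseteq> J" "c - r < (\<Sum>j\<in>F. (cmod (x j p))\<^sup>2)"
      using lower[OF p] by blast
    have "(cmod (y p))\<^sup>2 * (c - r) \<le> (cmod (y p))\<^sup>2 * (\<Sum>j\<in>F. (cmod (x j p))\<^sup>2)"
      using F(3) by (intro mult_left_mono) auto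
    moreover have "(cmod (y p))\<^sup>2 * r < e"
      using \<open>e > 0\<close> by (simp add: r_def pos_divide_less_eq add_nonneg_pos)
    ultimately have "- e < d F p" by (simp add: d_def algebra_simps)
    then show ?thesis using F p by (auto simp: V_def)
  qed
  then have cover: "C \<subseteq> \<Union> (V ` {F. finite F \<and> F \<subseteq> J})"
    using compactin_subset_topspace[OF C(1)] by blast
  have "openin X W" if W: "W \<in> V ` {F. finite F \<and> F \<subseteq> J}" for W
  proof -
    obtain F where F: "W = V F" "finite F" "F \<subseteq> J" using W by blast
    show ?thesis
      unfolding F(1) V_def by (rule openin_continuous_map_preimage[OF cont[OF F(2,3)]]) simp
  qed
  from compactinD[OF C(1) this cover] obtain \<W>
    where "finite \<W>" "\<W> \<subseteq> V ` {F. finite F \<and> F \<subseteq> J}" and CW: "C \<subseteq> \<Union> \<W>" by blast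
  then obtain \<F> where \<F>: "finite \<F>" "\<F> \<subseteq> {F. finite F \<and> F \<subseteq> J}" "\<W> = V ` \<F>"
    by (meson finite_subset_image)
  \<comment> \<open>All terms are squares, so the sum over G dominates the sum over each member of
    the finite family.\<close>
  define G where "G = \<Union> \<F>"
  have G: "finite G" "G \<subseteq> J" using \<F> by (auto simp: G_def)
  have "- e < d G p" if p: "p \<in> topspace X" for p
  proof (cases "p \<in> C")
    case True
    then obtain F where F: "F \<in> \<F>" "- e < d F p" using CW \<F>(3) by (auto simp: V_def)
    have "(\<Sum>j\<in>F. (cmod (x j p))\<^sup>2) \<le> (\<Sum>j\<in>G. (cmod (x j p))\<^sup>2)"
      using F(1) G by (intro sum_mono2) (auto simp: G_def)
    then have "d F p \<le> d G p" by (simp add: d_def mult_left_mono)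
    then show ?thesis using F(2) by linarith
  next
    case False
    then show ?thesis using outside p by blast
  qed
  then have "\<forall>p\<in>topspace X. c * (cmod (y p))\<^sup>2 - e \<le> (cmod (y p))\<^sup>2 * (\<Sum>j\<in>G. (cmod (x j p))\<^sup>2)"
    by (auto simp: d_def algebra_simps less_imp_le)
  then show ?thesis using G by blast
qed

text \<open>Turns pointwise bounds into frame bounds. The upper bound holds for every partial sum
  and passes to the limit, since the nonnegative reals are closed. The lower bound holds only for
  the supremum over F, possibly for no single partial sum, and needs the approximation up to
  e.\<close>

lemma nonstandard_frame_boundsI:
  assumes x: "\<And>j. j \<in> J \<Longrightarrow> x j \<in> C0 X" and c1: "c\<^sub>1 > 0"
    and lower: "\<And>p e. p \<in> topspace X \<Longrightarrow> e > 0 \<Longrightarrow>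
      \<exists>F. finite F \<and> F \<subseteq> J \<and> c\<^sub>1 - e < (\<Sum>j\<in>F. (cmod (x j p))\<^sup>2)"
    and upper: "\<And>p F. finite F \<Longrightarrow> F \<subseteq> J \<Longrightarrow> (\<Sum>j\<in>F. (cmod (x j p))\<^sup>2) \<le> c\<^sub>2"
  shows "nonstandard_frame_bounds A (C0 X) C0_inner J x c\<^sub>1 c\<^sub>2"
  unfolding nonstandard_frame_bounds_def
proof (intro conjI ballI x)
  fix y assume y: "y \<in> C0 X"
  obtain M where M: "M \<ge> 0" "\<And>p. cmod (y p) \<le> M"
    using carrier_C0_unitalization_bounded[OF C0_subset_carrier[OF y]] by blast
  have M2: "(cmod (y p))\<^sup>2 \<le> M\<^sup>2" for p using M by (intro power_mono) auto
  have "c\<^sub>2 \<ge> 0" using upper[of "{}"] by simp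
  define a where "a F = finsum A (\<lambda>j. C0_inner y (x j) \<otimes>\<^bsub>A\<^esub> C0_inner (x j) y) F" for F
  have aF: "a F \<in> carrier A" "\<And>p. a F p = complex_of_real ((cmod (y p))\<^sup>2 * (\<Sum>j\<in>F. (cmod (x j p))\<^sup>2))"
    if "finite F" "F \<subseteq> J" for F
  proof -
    have xF: "\<And>j. j \<in> F \<Longrightarrow> x j \<in> C0 X" using x \<open>F \<subseteq> J\<close> by blast
    show "a F \<in> carrier A" unfolding a_def by (intro frame_sum(2) y xF \<open>finite F\<close>)
    have fs: "a F = (\<lambda>p. complex_of_real ((cmod (y p))\<^sup>2 * (\<Sum>j\<in>F. (cmod (x j p))\<^sup>2)))"
      unfolding a_def by (intro frame_sum(1) y xF \<open>finite F\<close>)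
    show "a F p = complex_of_real ((cmod (y p))\<^sup>2 * (\<Sum>j\<in>F. (cmod (x j p))\<^sup>2))" for p
      unfolding fs ..
  qed
  have yy: "C0_inner y y \<in> carrier A"
    unfolding C0_inner_def by (intro carrier_closed C0_subset_carrier y)
  have ev: "\<forall>\<^sub>F F in finite_subsets_at_top J. finite F \<and> F \<subseteq> J"
    by (rule eventually_finite_subsets_at_top_weakI) auto
  have "\<exists>S\<in>enveloping_vN A. ultraweak_limit U uip (\<lambda>F. rep (a F)) S (finite_subsets_at_top J) \<and>
      (\<forall>h\<in>U. ((\<lambda>F. uip h (rep (a F) h)) \<longlongrightarrow> uip h (S h)) (finite_subsets_at_top J))"
  proof (rule increasing_net_limit)
    show "a F \<in> carrier A" if "finite F" "F \<subseteq> J" for F using aF(1)[OF that] .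
    show "a F p \<in> \<real>\<^sub>\<ge>\<^sub>0" if "finite F" "F \<subseteq> J" for F p
      unfolding aF(2)[OF that] by (simp add: sum_nonneg del: of_real_mult of_real_sum of_real_power)
    show "Re (a F p) \<le> Re (a G p)" if "finite G" "F \<subseteq> G" "G \<subseteq> J" for F G p
    proof -
      have F: "finite F" "F \<subseteq> J" using that finite_subset by auto
      show ?thesis
        unfolding aF(2)[OF F] aF(2)[OF that(1,3)] Re_complex_of_real
        using that by (intro mult_left_mono sum_mono2) auto
    qed
    show "Re (a F p) \<le> M\<^sup>2 * c\<^sub>2" if "finite F" "F \<subseteq> J" for F p
      unfolding aF(2)[OF that] Re_complex_of_real
      by (intro mult_mono M2 upper that sum_nonneg) auto
  qed
  then obtain S where S: "S \<in> enveloping_vN A"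
    "ultraweak_limit U uip (\<lambda>F. rep (a F)) S (finite_subsets_at_top J)"
    and lim: "\<And>h. h \<in> U \<Longrightarrow> ((\<lambda>F. uip h (rep (a F) h)) \<longlongrightarrow> uip h (S h)) (finite_subsets_at_top J)"
    by blast
  have "operator_le U uip S (rep (\<lambda>p. complex_of_real c\<^sub>2 * C0_inner y y p))"
    unfolding operator_le_def
  proof
    fix h assume h: "h \<in> U"
    define b where "b = (\<lambda>p. complex_of_real c\<^sub>2 * C0_inner y y p)"
    have b: "b \<in> carrier A" unfolding b_def by (rule carrier_scale[OF yy])
    show "uip h (rep b h) - uip h (S h) \<in> \<real>\<^sub>\<ge>\<^sub>0"
    proof (rule Lim_in_closed_set[OF closed_nonneg_Reals_complex _ finite_subsets_at_top_neq_bot])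
      show "((\<lambda>F. uip h (rep b h) - uip h (rep (a F) h)) \<longlongrightarrow> uip h (rep b h) - uip h (S h)) (finite_subsets_at_top J)"
        by (intro tendsto_diff tendsto_const lim h)
      show "\<forall>\<^sub>F F in finite_subsets_at_top J. uip h (rep b h) - uip h (rep (a F) h) \<in> \<real>\<^sub>\<ge>\<^sub>0"
        using ev
      proof eventually_elim
        case (elim F)
        then have F: "finite F" "F \<subseteq> J" by auto
        have m: "(\<lambda>p. b p - a F p) \<in> carrier A" by (intro carrier_diff b aF F)
        have "uip h (rep b h) - uip h (rep (a F) h) = uip h (rep (\<lambda>p. b p - a F p) h)"
          unfolding rep_diff[OF b aF(1)[OF F] h] by (intro uni.ip_diff[symmetric] h rep_mem b aF F)
        also have "\<dots> \<in> \<real>\<^sub>\<ge>\<^sub>0"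
        proof (rule rep_nonneg[OF m _ h])
          fix p
          have "b p - a F p = complex_of_real ((cmod (y p))\<^sup>2 * (c\<^sub>2 - (\<Sum>j\<in>F. (cmod (x j p))\<^sup>2)))"
            unfolding aF(2)[OF F] b_def C0_inner_self by (simp add: algebra_simps)
          moreover have "0 \<le> (cmod (y p))\<^sup>2 * (c\<^sub>2 - (\<Sum>j\<in>F. (cmod (x j p))\<^sup>2))"
            using upper[OF F] by simp
          ultimately show "b p - a F p \<in> \<real>\<^sub>\<ge>\<^sub>0" by (simp only: nonneg_Reals_of_real_iff)
        qed
        finally show ?case .
      qed
    qed
  qed
  moreover have "operator_le U uip (rep (\<lambda>p. complex_of_real c\<^sub>1 * C0_inner y y p)) S"
    unfolding operator_le_def
  proof
    fix h assume h: "h \<in> U"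
    define b where "b = (\<lambda>p. complex_of_real c\<^sub>1 * C0_inner y y p)"
    \<comment> \<open>The form of the unit at h. The error e in the pointwise estimate becomes e
      times the unit, which is available because the algebra is the unitalization.\<close>
    define w where "w = uip h (rep (indicator (topspace X)) h)"
    have b: "b \<in> carrier A" unfolding b_def by (rule carrier_scale[OF yy])
    have approx: "uip h (S h) - uip h (rep b h) + complex_of_real e * w \<in> \<real>\<^sub>\<ge>\<^sub>0" if "e > 0" for e
    proof (rule Lim_in_closed_set[OF closed_nonneg_Reals_complex _ finite_subsets_at_top_neq_bot])
      show "((\<lambda>F. uip h (rep (a F) h) - uip h (rep b h) + complex_of_real e * w) \<longlongrightarrow>
          uip h (S h) - uip h (rep b h) + complex_of_real e * w) (finite_subsets_at_top J)"
        by (intro tendsto_intros lim h)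
      obtain F0 where F0: "finite F0" "F0 \<subseteq> J" "\<And>p. p \<in> topspace X \<Longrightarrow>
          c\<^sub>1 * (cmod (y p))\<^sup>2 - e \<le> (cmod (y p))\<^sup>2 * (\<Sum>j\<in>F0. (cmod (x j p))\<^sup>2)"
        using partial_sums_approximate[OF y x c1 lower \<open>e > 0\<close>] by blast
      have "uip h (rep (a F) h) - uip h (rep b h) + complex_of_real e * w \<in> \<real>\<^sub>\<ge>\<^sub>0"
        if F: "finite F" "F \<subseteq> J" and F0F: "F0 \<subseteq> F" for F
      proof -
        define g where "g = (\<lambda>p. (a F p - b p) + complex_of_real e * indicator (topspace X) p)"
        have m1: "(\<lambda>p. a F p - b p) \<in> carrier A" by (intro carrier_diff b aF F)
        have m2: "(\<lambda>p. complex_of_real e * indicator (topspace X) p) \<in> carrier A"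
          by (intro carrier_scale indicator_mem_carrier)
        have g: "g \<in> carrier A" unfolding g_def by (intro carrier_add m1 m2)
        have "rep g h = (\<lambda>i. (rep (a F) h i - rep b h i) + complex_of_real e * rep (indicator (topspace X)) h i)"
          unfolding g_def rep_add[OF m1 m2 h] rep_diff[OF aF(1)[OF F] b h]
            rep_scale[OF indicator_mem_carrier h] ..
        then have "uip h (rep g h) = uip h (rep (a F) h) - uip h (rep b h) + complex_of_real e * w"
          by (simp add: uni.ip_add uni.ip_diff uni.ip_scale uni.diff_mem uni.scale_mem h
              rep_mem aF(1)[OF F] b indicator_mem_carrier w_def)
        moreover have "uip h (rep g h) \<in> \<real>\<^sub>\<ge>\<^sub>0"
        proof (rule rep_nonneg[OF g _ h])
          fix p
          show "g p \<in> \<real>\<^sub>\<ge>\<^sub>0"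
          proof (cases "p \<in> topspace X")
            case True
            have "g p = complex_of_real ((cmod (y p))\<^sup>2 * (\<Sum>j\<in>F. (cmod (x j p))\<^sup>2)
                - c\<^sub>1 * (cmod (y p))\<^sup>2 + e)"
              unfolding g_def aF(2)[OF F] b_def C0_inner_self using True by simp
            moreover have "(cmod (y p))\<^sup>2 * (\<Sum>j\<in>F0. (cmod (x j p))\<^sup>2) \<le> (cmod (y p))\<^sup>2 * (\<Sum>j\<in>F. (cmod (x j p))\<^sup>2)"
              using F F0F by (intro mult_left_mono sum_mono2) auto
            then have "0 \<le> (cmod (y p))\<^sup>2 * (\<Sum>j\<in>F. (cmod (x j p))\<^sup>2) - c\<^sub>1 * (cmod (y p))\<^sup>2 + e"
              using F0(3)[OF True] by linarith
            ultimately show ?thesis by (simp only: nonneg_Reals_of_real_iff)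
          next
            case False
            then show ?thesis using carrier_C0_unitalization_outside[OF g False] by simp
          qed
        qed
        ultimately show ?thesis by simp
      qed
      then show "\<forall>\<^sub>F F in finite_subsets_at_top J.
          uip h (rep (a F) h) - uip h (rep b h) + complex_of_real e * w \<in> \<real>\<^sub>\<ge>\<^sub>0"
        unfolding eventually_finite_subsets_at_top using F0 by blast
    qed
    \<comment> \<open>The limit over F has been taken for each fixed e; now e tends to 0 from the
      right. The set F0 depends on e, so the order of the two limits matters.\<close>
    show "uip h (S h) - uip h (rep b h) \<in> \<real>\<^sub>\<ge>\<^sub>0"
    proof (rule Lim_in_closed_set[OF closed_nonneg_Reals_complex])
      show "\<forall>\<^sub>F e in at_right 0. uip h (S h) - uip h (rep b h) + complex_of_real e * w \<in> \<real>\<^sub>\<ge>\<^sub>0"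
        using approx by (simp add: eventually_at_right_less eventually_mono[OF eventually_at_right_less])
      have "((\<lambda>e. uip h (S h) - uip h (rep b h) + complex_of_real e * w) \<longlongrightarrow>
          uip h (S h) - uip h (rep b h) + complex_of_real 0 * w) (at_right 0)"
        by (intro tendsto_intros)
      then show "((\<lambda>e. uip h (S h) - uip h (rep b h) + complex_of_real e * w) \<longlongrightarrow>
          uip h (S h) - uip h (rep b h)) (at_right 0)" by simp
    qed simp
  qed
  ultimately show "\<exists>S\<in>enveloping_vN A.
      ultraweak_limit U uip
        (\<lambda>F. rep (finsum A (\<lambda>j. C0_inner y (x j) \<otimes>\<^bsub>A\<^esub> C0_inner (x j) y) F)) S (finite_subsets_at_top J) \<and>
      operator_le U uip (rep (cscale A (complex_of_real c\<^sub>1) (C0_inner y y))) S \<and>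
      operator_le U uip S (rep (cscale A (complex_of_real c\<^sub>2) (C0_inner y y)))"
    using S unfolding a_def C0_unitalization_simps(5) by blast
qed

end

section \<open>The space \<open>K\<close>\<close>

text \<open>Complete regularity separates p from the complement of a neighbourhood V inside a
  compact C by a function f; then 1 - f is 1 at p and vanishes off C.\<close>

lemma locally_compact_Hausdorff_C0_nonzero:
  assumes "locally_compact_space X" "Hausdorff_space X" "p \<in> topspace X"
  shows "\<exists>y\<in>C0 X. y p \<noteq> 0"
proof -
  obtain V C where V: "openin X V" "compactin X C" "p \<in> V" "V \<subseteq> C"
    using assms(1,3) unfolding locally_compact_space_def by blast
  have "completely_regular_space X"
    using assms by (intro locally_compact_regular_imp_completely_regular_space) auto
  then obtain f where f: "continuous_map X euclideanreal f" "f p = 0" "f ` (topspace X - V) \<subseteq> {1}"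
    using V unfolding completely_regular_space_alt' by meson
  define y where "y q = (if q \<in> topspace X then complex_of_real (1 - f q) else 0)" for q
  have "continuous_map X euclidean (\<lambda>q. complex_of_real (1 - f q))"
    using continuous_map_compose[OF f(1), of euclidean "\<lambda>t. complex_of_real (1 - t)"]
    by (simp add: o_def continuous_intros)
  then have "continuous_map X euclidean y"
    by (rule continuous_map_eq) (simp add: y_def)
  moreover have "y q = 0" if "q \<in> topspace X - C" for q
    using that f(3) V(4) by (auto simp: y_def)
  ultimately have "y \<in> C0 X"
    using V(2) by (auto simp: C0_def y_def intro!: exI[of _ C])
  then show ?thesis using f(2) assms(3) by (auto simp: y_def intro!: bexI[of _ y])
qed

text \<open>Divides the weighted identity by \<bar>y p\<bar>^2 for a y that does not vanish at
  p.\<close>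

lemma normalized_frame_has_sum_1:
  assumes "locally_compact_space X" "Hausdorff_space X" "p \<in> topspace X"
    and fr: "normalized_frame (C0_unitalization X) (C0 X) C0_inner J x"
  shows "((\<lambda>j. (cmod (x j p))\<^sup>2) has_sum 1) J"
proof -
  interpret C0_algebra X .
  obtain y where y: "y \<in> C0 X" "y p \<noteq> 0" using locally_compact_Hausdorff_C0_nonzero[OF assms(1-3)] by blast
  show ?thesis
    using has_sum_cmult_right[OF normalized_frame_pointwise[OF fr y(1) assms(3)], of "1 / (cmod (y p))\<^sup>2"] y(2)
    by simp
qed

text \<open>Vanishing at infinity becomes continuity at \<open>None\<close>. If V contains 0, the
  set C of points that u sends outside V is closed as a preimage and compact as a closed part of D,
  as neighbourhoods of \<open>None\<close> require; otherwise the preimage lies in P.\<close>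

lemma continuous_map_Alexandroff_C0:
  assumes u: "u \<in> C0 P"
  shows "continuous_map (Alexandroff_compactification P) euclidean (case_option 0 u)"
  unfolding continuous_map_def
proof (intro conjI allI impI)
  let ?v = "case_option 0 u" and ?Q = "Alexandroff_compactification P"
  fix V :: "complex set" assume "openin euclidean V"
  then have V: "open V" by simp
  have cu: "continuous_map P euclidean u" using u by (simp add: C0_def)
  show "openin ?Q {q \<in> topspace ?Q. ?v q \<in> V}"
  proof (cases "0 \<in> V")
    case True
    then obtain e where e: "e > 0" "\<And>z. cmod z < e \<Longrightarrow> z \<in> V"
      using V unfolding open_dist by (auto simp: dist_norm)
    define C where "C = {p \<in> topspace P. u p \<in> - V}"
    have closed: "closedin P C"
      unfolding C_def using V by (intro closedin_continuous_map_preimage[OF cu]) (simp add: closed_open)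
    obtain D where D: "compactin P D" "\<And>p. p \<in> topspace P - D \<Longrightarrow> cmod (u p) < e"
      using u e(1) unfolding C0_def by blast
    have "C \<subseteq> D" using D(2) e(2) by (auto simp: C_def)
    then have "compactin P C" using closed_compactin D(1) closed by blast
    moreover have "{q \<in> topspace ?Q. ?v q \<in> V} = insert None (Some ` (topspace P - C))"
      using True by (auto simp: C_def)
    ultimately show ?thesis
      using closed by (simp only: openin_Alexandroff_compactification) blast
  next
    case False
    then have "{q \<in> topspace ?Q. ?v q \<in> V} = Some ` {p \<in> topspace P. u p \<in> V}" by auto
    then show ?thesis
      using openin_continuous_map_preimage[OF cu, of V] V by simp
  qed
qed simp

text \<open>The full product is compact, and K lacks just the corner (\<open>None\<close>,
  \<open>\<infinity>\<close>); closed sets that avoid the corner stay compact.\<close>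

lemma compactin_K_space:
  assumes "closedin (prod_topology (Alexandroff_compactification P) euclidean) D" "(None, \<infinity>) \<notin> D"
  shows "compactin (K_space P) D"
proof -
  let ?Q = "prod_topology (Alexandroff_compactification P) (euclidean :: enat topology)"
  have "compact_space (euclidean :: enat topology)"
    using compact_UNIV[where 'a = enat] by (simp add: compact_space_def)
  then have "compactin ?Q D"
    by (intro closedin_compact_space assms) (simp add: compact_space_prod_topology)
  then show ?thesis
    using closedin_subset[OF assms(1)] assms(2)
    unfolding K_space_def Let_def compactin_subtopology by blast
qed

lemma topspace_K_space:
  "topspace (K_space P) = insert None (Some ` topspace P) \<times> UNIV - {(None, \<infinity>)}"
  unfolding K_space_def Let_def by auto

lemma continuous_map_K_space:
  assumes "continuous_map (prod_topology (Alexandroff_compactification P) euclidean) Y f"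
  shows "continuous_map (K_space P) Y f"
  unfolding K_space_def Let_def by (rule continuous_map_from_subtopology[OF assms])

text \<open>The function factors through the first coordinate. It is 0 on the whole column over
  \<open>None\<close>, so the closed set where its modulus is at least r avoids the corner.\<close>

lemma y_fun_C0:
  assumes u: "u \<in> C0 P"
  shows "y_fun u \<in> C0 (K_space P)"
proof -
  let ?Q = "prod_topology (Alexandroff_compactification P) (euclidean :: enat topology)"
  have e: "y_fun u = case_option 0 u \<circ> fst" by (auto simp: y_fun_def fun_eq_iff split: option.split)
  have cont: "continuous_map ?Q euclidean (y_fun u)"
    unfolding e by (rule continuous_map_compose[OF continuous_map_fst continuous_map_Alexandroff_C0[OF u]])
  have "\<exists>C. compactin (K_space P) C \<and> (\<forall>z\<in>topspace (K_space P) - C. cmod (y_fun u z) < r)" if "r > 0" for r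
  proof (intro exI conjI ballI)
    let ?C = "{z \<in> topspace ?Q. y_fun u z \<in> - ball 0 r}"
    show "compactin (K_space P) ?C"
      by (intro compactin_K_space closedin_continuous_map_preimage[OF cont])
        (use \<open>r > 0\<close> in \<open>auto simp: y_fun_def simp flip: closed_closedin\<close>)
    show "cmod (y_fun u z) < r" if "z \<in> topspace (K_space P) - ?C" for z
      using that by (auto simp: topspace_K_space)
  qed
  moreover have "y_fun u z = 0" if "z \<notin> topspace (K_space P)" for z
    using that u by (auto simp: topspace_K_space y_fun_def C0_def split: option.split prod.split)
  ultimately show ?thesis using continuous_map_K_space[OF cont] by (simp add: C0_def)
qed

text \<open>A finite level is isolated and closed in \<open>enat\<close>, so its slice is clopen;
  being away from level \<open>\<infinity>\<close> it avoids the corner and is compact in K.\<close>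

lemma w_fun_C0: "w_fun P n \<in> C0 (K_space P)"
proof -
  let ?Q = "prod_topology (Alexandroff_compactification P) (euclidean :: enat topology)"
  let ?C = "{z \<in> topspace ?Q. snd z \<in> {enat n}}"
  have C: "?C = topspace (Alexandroff_compactification P) \<times> {enat n}" by auto
  have "continuous_map ?Q euclidean ((\<lambda>m. if m = enat n then 1 else 0 :: complex) \<circ> snd)"
  proof (rule continuous_map_compose[OF continuous_map_snd])
    have "continuous_on UNIV (\<lambda>m. if m = enat n then 1 else 0 :: complex)"
      unfolding continuous_on_open_vimage[OF open_UNIV]
    proof (intro allI impI)
      fix V :: "complex set"
      show "open ((\<lambda>m. if m = enat n then 1 else 0) -` V \<inter> UNIV)"
        \<comment> \<open>The preimage is empty, everything, the point \<open>enat n\<close>, or its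
          complement; each is open because a finite level is clopen.\<close>
        by (cases "0 \<in> V"; cases "1 \<in> V")
          (auto simp: vimage_def open_enat open_Compl Collect_neg_eq)
    qed
    then show "continuous_map euclidean euclidean (\<lambda>m. if m = enat n then 1 else 0 :: complex)" by simp
  qed
  then have "continuous_map ?Q euclidean (w_fun P n)"
    by (rule continuous_map_eq) (auto simp: w_fun_def)
  moreover have "compactin (K_space P) ?C"
    by (intro compactin_K_space closedin_continuous_map_preimage[OF continuous_map_snd]) auto
  moreover have w0: "w_fun P n z = 0" if "z \<notin> ?C" for z
    using that unfolding C w_fun_def by simp
  moreover have "?C \<subseteq> topspace (K_space P)"
    by (auto simp: topspace_K_space)
  ultimately show ?thesis
    unfolding C0_def mem_Collect_eq
    using w0 by (intro conjI continuous_map_K_space allI impI exI[of _ ?C]) (assumption, assumption, simp, blast)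
qed

theorem theorem2p8:
  fixes P :: "'p topology" and B :: "'b set" and u :: "'b \<Rightarrow> 'p \<Rightarrow> complex"
  assumes "locally_compact_space P" and "Hausdorff_space P"
    and "\<not> sigma_compact_space P"
    and "normalized_frame (C0_unitalization P) (C0 P) C0_inner B u"
  shows "nonstandard_frame (C0_unitalization (K_space P)) (C0 (K_space P)) C0_inner
           (B <+> (UNIV :: nat set)) (case_sum (\<lambda>\<beta>. y_fun (u \<beta>)) (w_fun P))"
proof -
  interpret K: C0_algebra "K_space P" .
  let ?x = "case_sum (\<lambda>\<beta>. y_fun (u \<beta>)) (w_fun P)"
  have u: "u \<beta> \<in> C0 P" if "\<beta> \<in> B" for \<beta>
    using assms(4) that by (auto simp: normalized_frame_def nonstandard_frame_bounds_def)
  have sum1: "((\<lambda>\<beta>. (cmod (u \<beta> p))\<^sup>2) has_sum 1) B" if "p \<in> topspace P" for p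
    using normalized_frame_has_sum_1[OF assms(1,2) that assms(4)] .
  \<comment> \<open>1 is the value of the full sum at level \<open>\<infinity>\<close>; 2 adds one
    unit from each family, as happens at (p, n) with p in P and n finite.\<close>
  have "nonstandard_frame_bounds (C0_unitalization (K_space P)) (C0 (K_space P)) C0_inner
      (B <+> UNIV) ?x 1 2"
  proof (rule K.nonstandard_frame_boundsI)
    show "?x j \<in> C0 (K_space P)" if "j \<in> B <+> UNIV" for j
      using that by (elim PlusE) (simp_all add: y_fun_C0 u w_fun_C0)
    fix z e assume z: "z \<in> topspace (K_space P)" and e: "(e::real) > 0"
    obtain q m where qm: "z = (q, m)" by (cases z)
    show "\<exists>F. finite F \<and> F \<subseteq> B <+> UNIV \<and> 1 - e < (\<Sum>j\<in>F. (cmod (?x j z))\<^sup>2)"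
    proof (cases m)
      case (enat n)
      have "w_fun P n z = 1" using z qm enat by (auto simp: w_fun_def topspace_K_space)
      then show ?thesis using e by (intro exI[of _ "{Inr n}"]) auto
    next
      case infinity
      \<comment> \<open>At level \<open>\<infinity>\<close> every w vanishes, but the corner has
        been removed, so the first coordinate is a point of P, where the squares of the u \<beta>
        sum to 1.\<close>
      then obtain p where p: "q = Some p" "p \<in> topspace P" using z qm by (auto simp: topspace_K_space)
      obtain F where F: "finite F" "F \<subseteq> B" "dist (\<Sum>\<beta>\<in>F. (cmod (u \<beta> p))\<^sup>2) 1 \<le> e/2"
        using has_sum_finite_approximation[OF sum1[OF p(2)], of "e/2"] e by auto
      have "(\<Sum>j\<in>Inl ` F. (cmod (?x j z))\<^sup>2) = (\<Sum>\<beta>\<in>F. (cmod (u \<beta> p))\<^sup>2)"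
        by (simp add: sum.reindex qm p y_fun_def)
      moreover have "1 - e < (\<Sum>\<beta>\<in>F. (cmod (u \<beta> p))\<^sup>2)"
        using F(3) e unfolding dist_real_def by linarith
      ultimately show ?thesis
        using F(1,2) by (intro exI[of _ "Inl ` F"]) auto
    qed
  next
    fix z :: "'p option \<times> enat" and F :: "('b + nat) set"
    assume F: "finite F" "F \<subseteq> B <+> UNIV"
    obtain q m where qm: "z = (q, m)" by (cases z)
    have split: "F = (Inl -` F) <+> (Inr -` F)"
    proof (rule Set.set_eqI)
      fix j show "j \<in> F \<longleftrightarrow> j \<in> (Inl -` F) <+> (Inr -` F)" by (cases j) auto
    qed
    have fin: "finite (Inl -` F)" "finite (Inr -` F)" using F(1) by (auto intro: finite_vimageI)
    have "(\<Sum>j\<in>F. (cmod (?x j z))\<^sup>2)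
        = (\<Sum>\<beta>\<in>Inl -` F. (cmod (y_fun (u \<beta>) z))\<^sup>2) + (\<Sum>n\<in>Inr -` F. (cmod (w_fun P n z))\<^sup>2)"
      by (subst split, subst sum.Plus[OF fin]) simp
    also have "\<dots> \<le> 1 + 1"
    proof (rule add_mono)
      have B: "Inl -` F \<subseteq> B" using F(2) by auto
      show "(\<Sum>\<beta>\<in>Inl -` F. (cmod (y_fun (u \<beta>) z))\<^sup>2) \<le> 1"
      proof (cases "\<exists>p\<in>topspace P. q = Some p")
        case True
        then obtain p where p: "q = Some p" "p \<in> topspace P" by blast
        show ?thesis
          using finite_sum_le_has_sum[OF sum1[OF p(2)] fin(1) B] by (simp add: qm p y_fun_def)
      next
        case False
        \<comment> \<open>At \<open>None\<close> this is the definition of \<open>y_fun\<close>; off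
          P it is the convention that \<open>C0\<close> functions vanish outside the space.\<close>
        then have "y_fun (u \<beta>) z = 0" if "\<beta> \<in> B" for \<beta>
          using u[OF that] by (auto simp: qm y_fun_def C0_def split: option.split)
        then show ?thesis using B by (subst sum.neutral) auto
      qed
      \<comment> \<open>The slices are disjoint, so at most one w is nonzero at z. At level
        \<open>\<infinity>\<close> the value of \<open>the_enat\<close> is unspecified, but all
        terms on the left are then 0 and the bound still holds.\<close>
      have "(\<Sum>n\<in>Inr -` F. (cmod (w_fun P n z))\<^sup>2) \<le> (\<Sum>n\<in>Inr -` F. if n = the_enat m then 1 else 0)"
        by (intro sum_mono) (auto simp: w_fun_def qm indicator_def)
      also have "\<dots> \<le> 1" using fin(2) by simp
      finally show "(\<Sum>n\<in>Inr -` F. (cmod (w_fun P n z))\<^sup>2) \<le> 1" .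
    qed
    finally show "(\<Sum>j\<in>F. (cmod (?x j z))\<^sup>2) \<le> 2" by simp
  qed simp
  then show ?thesis
    unfolding nonstandard_frame_def by (intro exI[of _ 1] exI[of _ 2] conjI) auto
qed

end
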